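(* Let $F$ be a self-affine carpet (as defined in the context), the attractor of $\{S_i\}_{i\in\mathcal I}$. If $F$ is of horizontal type, then \[ \dim_{\mathrm L}F=\dim_{\mathrm B}\pi_1(F)+\min_{i\in\mathcal I}\dim_{\mathrm B}\mathrm{Slice}_{1,i}(F); \] if $F$ is of vertical type, then \[ \dim_{\mathrm L}F=\dim_{\mathrm B}\pi_2(F)+\min_{i\in\mathcal I}\dim_{\mathrm B}\mathrm{Slice}_{2,i}(F); \] and if $F$ is of mixed type, then \[ \dim_{\mathrm L}F=\min_{i\in\mathcal I}\min_{j=1,2}\big(\dim_{\mathrm B}\pi_j(F)+\dim_{\mathrm B}\mathrm{Slice}_{j,i}(F)\big). \]
   Context: Self-affine carpets. Two classes of finite iterated function systems (IFS) on $[0,1]^2$ are considered. Extended Lalley–Gatzouras class: divide $[0,1]^2$ into columns by a finite positive number of vertical lines; divide each column independently into rectangles by horizontal slices; select a subset of the resulting rectangles, subject only to the requirement that each selected rectangle has base length greater than or equal to its height. Barański class: divide $[0,1]^2$ into a grid of rectangles by a finite number of full vertical lines and full horizontal lines (at least one in each direction); select any subset of the resulting rectangles. In both cases, for each selected rectangle include in the IFS the orientation-preserving map $S_i(x,y)=(c_ix,d_iy)+(a_i,b_i)$ taking $[0,1]^2$ onto that rectangle; thus $c_i,d_i\in(0,1)$ are its base length and height. The index set is $\mathcal I$, finite with $|\mathcal I|\geq2$. The attractor is the unique non-empty compact $F$ with $F=\bigcup_{i\in\mathcal I}S_i(F)$. $F$ is called a self-affine carpet if it is the attractor of an IFS in one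 of these two classes with at least one map that is not a similarity (i.e. $c_i\neq d_i$ for some $i$). $F$ is of horizontal type if $c_i\geq d_i$ for all $i$; of vertical type if $c_i\leq d_i$ for all $i$; of mixed type otherwise. $\pi_1,\pi_2$ are the orthogonal projections of the plane onto the horizontal and vertical axes respectively. $\mathrm{Slice}_{1,i}(F)$ is the intersection of $F$ with the vertical line through the fixed point of $S_i$; $\mathrm{Slice}_{2,i}(F)$ is the intersection of $F$ with the horizontal line through the fixed point of $S_i$. $\dim_{\mathrm B}$ is box dimension. Lower dimension: with $N_r(E)$ the smallest number of open sets of diameter at most $r$ needed to cover $E$ and $B(x,R)$ the closed ball, \[ \dim_{\mathrm L}F=\sup\Big\{\alpha:\ \exists\, C,\rho>0 \text{ such that for all } 0<r<R\leq\rho,\ \inf_{x\in F}N_r(B(x,R)\cap F)\geq C (R/r)^{\alpha}\Big\}. \] *)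

theory Defs
  imports "HOL-Analysis.Analysis"
begin

section \<open>Dimensions\<close>

text \<open>
  The least number of open sets of diameter at most \<open>r\<close> needed to cover \<open>E\<close>. It is meaningful for
  \<open>r > 0\<close> and totally bounded \<open>E\<close>, so in particular for bounded subsets of the plane; otherwise
  there may be no finite cover and the value is arbitrary. Boundedness of the covering sets is
  required explicitly because \<^const>\<open>diameter\<close> is real-valued and unspecified on unbounded sets.
\<close>

definition covering_number :: "real \<Rightarrow> 'a::metric_space set \<Rightarrow> nat" where
  "covering_number r E =
     (LEAST n. \<exists>\<U>. finite \<U> \<and> card \<U> = n \<and> E \<subseteq> \<Union>\<U> \<and>
                (\<forall>U\<in>\<U>. open U \<and> bounded U \<and> diameter U \<le> r))"

definition has_box_dim :: "'a::metric_space set \<Rightarrow> real \<Rightarrow> bool" where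
  "has_box_dim E s \<longleftrightarrow>
     ((\<lambda>r. ln (real (covering_number r E)) / (- ln r)) \<longlongrightarrow> s) (at_right 0)"

definition box_dim_exists :: "'a::metric_space set \<Rightarrow> bool" where
  "box_dim_exists E \<longleftrightarrow> (\<exists>s. has_box_dim E s)"

text \<open>Meaningful only if \<open>box_dim_exists E\<close>, i.e. if lower and upper box dimension agree.\<close>

definition box_dim :: "'a::metric_space set \<Rightarrow> real" where
  "box_dim E = (THE s. has_box_dim E s)"

text \<open>
  For non-empty sets in the plane the exponents contain \<open>0\<close> and are bounded above by \<open>2\<close>, so the
  real-valued supremum is the true one.
\<close>

definition lower_dim :: "(real \<times> real) set \<Rightarrow> real" where
  "lower_dim F = Sup {\<alpha>. \<exists>C>0. \<exists>\<rho>>0. \<forall>r R. 0 < r \<and> r < R \<and> R \<le> \<rho> \<longrightarrow>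
       real (INF x\<in>F. covering_number r (cball x R \<inter> F)) \<ge> C * (R / r) powr \<alpha>}"


section \<open>Self-affine carpets\<close>

definition aff_map :: "('i \<Rightarrow> real) \<Rightarrow> ('i \<Rightarrow> real) \<Rightarrow> ('i \<Rightarrow> real) \<Rightarrow> ('i \<Rightarrow> real) \<Rightarrow>
    'i \<Rightarrow> real \<times> real \<Rightarrow> real \<times> real" where
  "aff_map c d a b i p = (c i * fst p + a i, d i * snd p + b i)"

text \<open>A division of \<open>[0,1]\<close> into \<open>n\<close> intervals \<open>[t k, t (Suc k)]\<close>, i.e. by \<open>n - 1\<close> interior points.\<close>

definition division :: "nat \<Rightarrow> (nat \<Rightarrow> real) \<Rightarrow> bool" where
  "division n t \<longleftrightarrow> t 0 = 0 \<and> t n = 1 \<and> (\<forall>k<n. t k < t (Suc k))"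

text \<open>
  In both classes below, \<open>i \<in> I\<close> selects the rectangle in column \<open>col i\<close> and row \<open>row i\<close>;
  injectivity says that each selected rectangle contributes exactly one map. At least one
  vertical line means at least two columns, and likewise for rows in the second class.
\<close>

definition extended_Lalley_Gatzouras ::
  "'i set \<Rightarrow> ('i \<Rightarrow> real) \<Rightarrow> ('i \<Rightarrow> real) \<Rightarrow> ('i \<Rightarrow> real) \<Rightarrow> ('i \<Rightarrow> real) \<Rightarrow> bool" where
  "extended_Lalley_Gatzouras I c d a b \<longleftrightarrow>
     (\<exists>m v n h col row.
        m \<ge> 2 \<and> division m v \<and> (\<forall>j<m. division (n j) (h j)) \<and>
        inj_on (\<lambda>i. (col i, row i)) I \<and>
        (\<forall>i\<in>I. col i < m \<and> row i < n (col i) \<and>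
           a i = v (col i) \<and> c i = v (Suc (col i)) - v (col i) \<and>
           b i = h (col i) (row i) \<and> d i = h (col i) (Suc (row i)) - h (col i) (row i) \<and>
           c i \<ge> d i))"

definition Baranski ::
  "'i set \<Rightarrow> ('i \<Rightarrow> real) \<Rightarrow> ('i \<Rightarrow> real) \<Rightarrow> ('i \<Rightarrow> real) \<Rightarrow> ('i \<Rightarrow> real) \<Rightarrow> bool" where
  "Baranski I c d a b \<longleftrightarrow>
     (\<exists>m v n h col row.
        m \<ge> 2 \<and> division m v \<and> n \<ge> 2 \<and> division n h \<and>
        inj_on (\<lambda>i. (col i, row i)) I \<and>
        (\<forall>i\<in>I. col i < m \<and> row i < n \<and>
           a i = v (col i) \<and> c i = v (Suc (col i)) - v (col i) \<and>
           b i = h (row i) \<and> d i = h (Suc (row i)) - h (row i)))"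

definition attractor :: "'i set \<Rightarrow> ('i \<Rightarrow> 'a \<Rightarrow> 'a) \<Rightarrow> 'a::topological_space set \<Rightarrow> bool" where
  "attractor I S F \<longleftrightarrow> F \<noteq> {} \<and> compact F \<and> F = (\<Union>i\<in>I. S i ` F)"

definition self_affine_carpet ::
  "'i set \<Rightarrow> ('i \<Rightarrow> real) \<Rightarrow> ('i \<Rightarrow> real) \<Rightarrow> ('i \<Rightarrow> real) \<Rightarrow> ('i \<Rightarrow> real) \<Rightarrow>
     (real \<times> real) set \<Rightarrow> bool" where
  "self_affine_carpet I c d a b F \<longleftrightarrow>
     finite I \<and> card I \<ge> 2 \<and>
     (extended_Lalley_Gatzouras I c d a b \<or> Baranski I c d a b) \<and>
     (\<exists>i\<in>I. c i \<noteq> d i) \<and>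
     attractor I (aff_map c d a b) F"

definition horizontal_type :: "'i set \<Rightarrow> ('i \<Rightarrow> real) \<Rightarrow> ('i \<Rightarrow> real) \<Rightarrow> bool" where
  "horizontal_type I c d \<longleftrightarrow> (\<forall>i\<in>I. c i \<ge> d i)"

definition vertical_type :: "'i set \<Rightarrow> ('i \<Rightarrow> real) \<Rightarrow> ('i \<Rightarrow> real) \<Rightarrow> bool" where
  "vertical_type I c d \<longleftrightarrow> (\<forall>i\<in>I. c i \<le> d i)"

definition mixed_type :: "'i set \<Rightarrow> ('i \<Rightarrow> real) \<Rightarrow> ('i \<Rightarrow> real) \<Rightarrow> bool" where
  "mixed_type I c d \<longleftrightarrow> \<not> horizontal_type I c d \<and> \<not> vertical_type I c d"

definition proj1 :: "real \<times> real \<Rightarrow> real \<times> real" where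
  "proj1 p = (fst p, 0)"

definition proj2 :: "real \<times> real \<Rightarrow> real \<times> real" where
  "proj2 p = (0, snd p)"

definition fixed_point :: "('a \<Rightarrow> 'a) \<Rightarrow> 'a" where
  "fixed_point f = (THE p. f p = p)"

text \<open>
  Intersection of \<open>F\<close> with the vertical (\<open>slice1\<close>), respectively horizontal (\<open>slice2\<close>), line through
  the fixed point of \<open>f\<close>.
\<close>

definition slice1 :: "(real \<times> real \<Rightarrow> real \<times> real) \<Rightarrow> (real \<times> real) set \<Rightarrow> (real \<times> real) set" where
  "slice1 f F = F \<inter> {p. fst p = fst (fixed_point f)}"

definition slice2 :: "(real \<times> real \<Rightarrow> real \<times> real) \<Rightarrow> (real \<times> real) set \<Rightarrow> (real \<times> real) set" where
  "slice2 f F = F \<inter> {p. snd p = snd (fixed_point f)}"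

end

theory Submission
  imports Defs
begin

text \<open>
  Write \<open>s\<close> for the dimension of the projection of \<open>F\<close> to the horizontal axis and \<open>t\<^sub>i\<close> for the
  dimension of the vertical slice through the fixed point of \<open>S\<^sub>i\<close>. That slice is self-similar: only
  the rectangles in the column of \<open>i\<close> contribute to it, so \<open>t\<^sub>i\<close> is the root of \<open>\<Sum> d\<^sub>k\<^sup>t = 1\<close> over this
  column, and \<open>s\<close> is the root of \<open>\<Sum> c\<^sup>s = 1\<close> with one summand per column. Everything rests on two
  counts that see the two directions separately: \<open>packs p q E z\<close> (at least \<open>z\<close> non-overlapping
  \<open>p \<times> q\<close> boxes in the unit square meet \<open>E\<close>) and \<open>covers p q E z\<close> (at most \<open>z\<close> boxes of this size,
  placed anywhere, cover \<open>E\<close>). Boxes rescale freely in both directions, and under maps whose images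
  of the unit square do not overlap packings add up exactly, without a constant. Hence
  \<open>\<Sum> c\<^sub>k\<^sup>s d\<^sub>k\<^sup>t \<ge> 1\<close> gives \<open>packs p q E (C p\<^sup>-\<^sup>s q\<^sup>-\<^sup>t)\<close> by a plain induction on the scale
  (\<open>packs_selfaffine\<close>), and dually for covers (\<open>covers_selfaffine\<close>). For projections and slices this
  yields the box dimensions.

  Let \<open>t\<close> be at most every \<open>t\<^sub>i\<close>. Then \<open>\<Sum> c\<^sub>i\<^sup>s d\<^sub>i\<^sup>t \<ge> 1\<close> over all rectangles, so \<open>F\<close> itself carries
  packings of size \<open>p\<^sup>-\<^sup>s q\<^sup>-\<^sup>t\<close>, and so does, uniformly, every strip of \<open>F\<close> over a cylinder of the
  projection once it is stretched horizontally to width one (\<open>packs_strip\<close>). Zooming in on a point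
  of \<open>F\<close> with the system until the cylinder is about \<open>R\<close> high (if its height gets there first), and
  then cutting out the strip of width about \<open>R\<close>, leaves inside every ball of radius \<open>R\<close> a piece that
  needs at least a constant times \<open>(R/r)\<^sup>s\<^sup>+\<^sup>t\<close> sets of diameter \<open>r\<close>. If the width gets there first,
  the same is done with the roles of rows and columns exchanged. In the horizontal case the height
  always gets there first; in the mixed case both happen, and the minimum over both directions
  results. The vertical case is the reflected horizontal one.

  For the upper bound fix \<open>i\<close> and a rectangle \<open>j\<close> that is strictly wider than high. Iterating \<open>S\<^sub>j\<close>
  produces a very elongated cylinder of height about \<open>R\<close>, and in it one finds a strip of width about
  \<open>R\<close> whose columns are, up to two of them, all the column of \<open>i\<close>. A suitable ball of radius
  comparable to \<open>R\<close> meets \<open>F\<close> only inside this strip, and down to the scale \<open>r\<close> at which the columns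
  of the strip are used up, which is arbitrarily small relative to \<open>R\<close>, the strip looks like a
  product of the projection with the slice, so that \<open>(R/r)\<^sup>s\<^sup>+\<^sup>t\<close> with \<open>t = t\<^sub>i\<close> sets suffice
  (\<open>thin_pieces\<close>).
\<close>

section \<open>Packing and covering by boxes\<close>

definition aff :: "real \<Rightarrow> real \<Rightarrow> real \<Rightarrow> real \<Rightarrow> real \<times> real \<Rightarrow> real \<times> real" where
  "aff c d a b p = (c * fst p + a, d * snd p + b)"

text \<open>Boxes are closed and are represented by their lower left corner.\<close>
abbreviation in_box :: "real \<Rightarrow> real \<Rightarrow> real \<times> real \<Rightarrow> real \<times> real \<Rightarrow> bool" where
  "in_box p q w e \<equiv> fst w \<le> fst e \<and> fst e \<le> fst w + p \<and> snd w \<le> snd e \<and> snd e \<le> snd w + q"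

text \<open>
  Two boxes of size \<open>p \<times> q\<close> have disjoint interiors iff their corners differ by at least \<open>p\<close>
  horizontally or at least \<open>q\<close> vertically.
\<close>
abbreviation is_packing ::
  "real \<Rightarrow> real \<Rightarrow> (real \<times> real) set \<Rightarrow> real \<Rightarrow> (real \<times> real) set \<Rightarrow> bool" where
  "is_packing p q E z Q \<equiv> finite Q \<and> z \<le> real (card Q) \<and>
     (\<forall>w\<in>Q. 0 \<le> fst w \<and> fst w + p \<le> 1 \<and> 0 \<le> snd w \<and> snd w + q \<le> 1 \<and>
        (\<exists>e\<in>E. in_box p q w e)) \<and>
     (\<forall>w\<in>Q. \<forall>w'\<in>Q. w \<noteq> w' \<longrightarrow> p \<le> \<bar>fst w - fst w'\<bar> \<or> q \<le> \<bar>snd w - snd w'\<bar>)"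

definition packs :: "real \<Rightarrow> real \<Rightarrow> (real \<times> real) set \<Rightarrow> real \<Rightarrow> bool" where
  "packs p q E z \<longleftrightarrow> (\<exists>Q. is_packing p q E z Q)"

definition covers :: "real \<Rightarrow> real \<Rightarrow> (real \<times> real) set \<Rightarrow> real \<Rightarrow> bool" where
  "covers p q E z \<longleftrightarrow> (\<exists>Q. finite Q \<and> real (card Q) \<le> z \<and>
     (\<forall>e\<in>E. \<exists>w\<in>Q. in_box p q w e))"

abbreviation unit_square :: "(real \<times> real) set" where
  "unit_square \<equiv> {0..1} \<times> {0..1}"

lemma packs_weaken:
  assumes P: "packs p q E z" and z: "z' \<le> z" and E: "E \<subseteq> E'"
  shows "packs p q E' z'"
proof -
  obtain Q where QQ: "is_packing p q E z Q"
    using P unfolding packs_def by (rule exE)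
  show ?thesis unfolding packs_def
  proof (intro exI[of _ Q] conjI ballI impI)
    fix w assume w: "w \<in> Q"
    then obtain e where "e \<in> E" "in_box p q w e"
      using QQ by blast
    then show "\<exists>e\<in>E'. in_box p q w e"
      using E by blast
  qed (use QQ z in auto)
qed

lemma covers_weaken:
  assumes "covers p q E z" "z \<le> z'" "E' \<subseteq> E" "p \<le> p'" "q \<le> q'"
  shows "covers p' q' E' z'"
proof -
  obtain Q where Q: "finite Q" "real (card Q) \<le> z"
     "\<forall>e\<in>E. \<exists>w\<in>Q. in_box p q w e"
    using assms(1) unfolding covers_def by blast
  show ?thesis unfolding covers_def
  proof (intro exI[of _ Q] conjI ballI)
    fix e assume "e \<in> E'"
    then obtain w where "w \<in> Q" "fst w \<le> fst e" "fst e \<le> fst w + p" "snd w \<le> snd e" "snd e \<le> snd w + q"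
      using Q(3) assms(3) by blast
    then show "\<exists>w\<in>Q. in_box p' q' w e"
      using assms by (intro bexI[of _ w]) auto
  qed (use Q assms in auto)
qed

lemma shrink_interval:
  fixes u p p' x :: real
  assumes "u \<le> x" "x \<le> u + p" "0 < p'" "p' \<le> p"
  shows "\<exists>v. u \<le> v \<and> v + p' \<le> u + p \<and> v \<le> x \<and> x \<le> v + p'"
  using assms by (intro exI[of _ "max u (x - p')"]) auto

lemma packs_shrink:
  assumes P: "packs p q E z" and p: "0 < p'" "p' \<le> p" and q: "0 < q'" "q' \<le> q"
  shows "packs p' q' E z"
proof -
  obtain Q where QQ: "is_packing p q E z Q"
    using P unfolding packs_def by (rule exE)
  have Q: "finite Q" "z \<le> real (card Q)"
    "\<And>w. w \<in> Q \<Longrightarrow> 0 \<le> fst w \<and> fst w + p \<le> 1 \<and> 0 \<le> snd w \<and> snd w + q \<le> 1 \<and>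
        (\<exists>e\<in>E. in_box p q w e)"
    using QQ by simp_all
  have sep: "\<And>w w'. w \<in> Q \<Longrightarrow> w' \<in> Q \<Longrightarrow> w \<noteq> w' \<Longrightarrow> p \<le> \<bar>fst w - fst w'\<bar> \<or> q \<le> \<bar>snd w - snd w'\<bar>"
    using QQ by simp
  have "\<forall>w\<in>Q. \<exists>w'. fst w \<le> fst w' \<and> fst w' + p' \<le> fst w + p \<and> snd w \<le> snd w' \<and> snd w' + q' \<le> snd w + q \<and>
      (\<exists>e\<in>E. in_box p' q' w' e)"
  proof
    fix w assume "w \<in> Q"
    then obtain e where e: "e \<in> E" "fst w \<le> fst e" "fst e \<le> fst w + p" "snd w \<le> snd e" "snd e \<le> snd w + q"
      using Q(3) by blast
    obtain u where "fst w \<le> u \<and> u + p' \<le> fst w + p \<and> u \<le> fst e \<and> fst e \<le> u + p'"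
      using shrink_interval[OF e(2,3) p] by blast
    moreover obtain v where "snd w \<le> v \<and> v + q' \<le> snd w + q \<and> v \<le> snd e \<and> snd e \<le> v + q'"
      using shrink_interval[OF e(4,5) q] by blast
    ultimately show "\<exists>w'. fst w \<le> fst w' \<and> fst w' + p' \<le> fst w + p \<and> snd w \<le> snd w' \<and> snd w' + q' \<le>
        snd w + q \<and>
      (\<exists>e\<in>E. in_box p' q' w' e)"
      using e(1) by (intro exI[of _ "(u, v)"]) auto
  qed
  then obtain f where f: "\<And>w. w \<in> Q \<Longrightarrow> fst w \<le> fst (f w) \<and> fst (f w) + p' \<le> fst w + p \<and>
      snd w \<le> snd (f w) \<and> snd (f w) + q' \<le> snd w + q \<and>
      (\<exists>e\<in>E. fst (f w) \<le> fst e \<and> fst e \<le> fst (f w) + p' \<and> snd (f w) \<le> snd e \<and> snd e \<le> snd (f w) + q')"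
    by metis
  have sep': "p' \<le> \<bar>fst (f w) - fst (f w')\<bar> \<or> q' \<le> \<bar>snd (f w) - snd (f w')\<bar>"
    if "w \<in> Q" "w' \<in> Q" "w \<noteq> w'" for w w'
    using sep[OF that] f[OF that(1)] f[OF that(2)] by linarith
  have inj: "inj_on f Q"
    using sep' p q by (smt (verit) inj_on_def)
  show ?thesis
    unfolding packs_def
  proof (intro exI[of _ "f ` Q"] conjI ballI impI)
    show "z \<le> real (card (f ` Q))" using Q(2) card_image[OF inj] by simp
  next
    fix w w' assume "w \<in> f ` Q" "w' \<in> f ` Q" "w \<noteq> w'"
    then show "p' \<le> \<bar>fst w - fst w'\<bar> \<or> q' \<le> \<bar>snd w - snd w'\<bar>"
      using sep' by blast
  next
    fix w assume "w \<in> f ` Q"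
    then obtain w0 where w0: "w0 \<in> Q" "w = f w0" by blast
    show "0 \<le> fst w" "fst w + p' \<le> 1" "0 \<le> snd w" "snd w + q' \<le> 1"
      using Q(3)[OF w0(1)] f[OF w0(1)] w0(2) by auto
    show "\<exists>e\<in>E. in_box p' q' w e"
      using f[OF w0(1)] w0(2) by auto
  qed (simp add: Q(1))
qed

lemma packs_one:
  assumes "E \<inter> unit_square \<noteq> {}" "0 < p" "p \<le> 1" "0 < q" "q \<le> 1"
  shows "packs p q E 1"
proof -
  obtain e where "e \<in> E" "e \<in> unit_square" using assms(1) by blast
  then have e: "e \<in> E" "0 \<le> fst e" "fst e \<le> 1" "0 \<le> snd e" "snd e \<le> 1" by auto
  have "packs 1 1 E 1"
    unfolding packs_def by (rule exI[of _ "{(0, 0)}"]) (use e in \<open>simp, blast\<close>)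
  from packs_shrink[OF this] assms show ?thesis by auto
qed

text \<open>
  Boxes in the image rectangles of two different maps cannot overlap, so nothing is lost when the
  packings of the pieces are put together. This exactness is what makes packings of boxes preferable
  to covering numbers in lower bounds.
\<close>
lemma packs_union:
  fixes c d a b :: "'k \<Rightarrow> real"
  assumes fin: "finite K"
    and pos: "\<And>k. k \<in> K \<Longrightarrow> 0 < c k \<and> 0 < d k \<and> 0 \<le> a k \<and> a k + c k \<le> 1 \<and> 0 \<le> b k \<and> b k + d k \<le> 1"
    and sep: "\<And>k l. k \<in> K \<Longrightarrow> l \<in> K \<Longrightarrow> k \<noteq> l \<Longrightarrow>
       a k + c k \<le> a l \<or> a l + c l \<le> a k \<or> b k + d k \<le> b l \<or> b l + d l \<le> b k"
    and P: "\<And>k. k \<in> K \<Longrightarrow> packs (p / c k) (q / d k) (E k) (z k)"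
    and p: "0 < p" and q: "0 < q"
  shows "packs p q (\<Union>k\<in>K. aff (c k) (d k) (a k) (b k) ` E k) (\<Sum>k\<in>K. z k)"
proof -
  let ?A = "\<lambda>k. aff (c k) (d k) (a k) (b k)"
  let ?P = "\<lambda>k Q. is_packing (p / c k) (q / d k) (E k) (z k) Q"
  have "\<forall>k\<in>K. \<exists>Q. ?P k Q"
    using P unfolding packs_def by (rule ballI)
  from bchoice[OF this] obtain Q where QQ: "\<forall>k\<in>K. ?P k (Q k)" by (rule exE)
  have Q: "\<And>k. k \<in> K \<Longrightarrow> finite (Q k)" "\<And>k. k \<in> K \<Longrightarrow> z k \<le> real (card (Q k))"
    using QQ by simp_all
  have Qw: "\<And>k w. k \<in> K \<Longrightarrow> w \<in> Q k \<Longrightarrow> 0 \<le> fst w \<and> fst w + p / c k \<le> 1 \<and> 0 \<le> snd w \<and> snd w + q / d k \<le> 1 \<and>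
        (\<exists>e\<in>E k. in_box (p / c k) (q / d k) w e)"
    using QQ by simp
  have Qs: "\<And>k w w'. k \<in> K \<Longrightarrow> w \<in> Q k \<Longrightarrow> w' \<in> Q k \<Longrightarrow> w \<noteq> w' \<Longrightarrow>
        p / c k \<le> \<bar>fst w - fst w'\<bar> \<or> q / d k \<le> \<bar>snd w - snd w'\<bar>"
    using QQ by simp
  have scale: "x + p / y \<le> x' \<longleftrightarrow> y * x + p \<le> y * x'" if "0 < y" for x x' y p :: real
    using that by (simp add: field_simps)
  have scale2: "p / y \<le> \<bar>x - x'\<bar> \<longleftrightarrow> p \<le> \<bar>y * x - y * x'\<bar>" if "0 < y" for x x' y p :: real
  proof -
    have "\<bar>y * x - y * x'\<bar> = y * \<bar>x - x'\<bar>"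
      using that by (simp add: right_diff_distrib[symmetric] abs_mult)
    then show ?thesis using that by (simp add: field_simps)
  qed
  have box: "a k \<le> fst (?A k w) \<and> fst (?A k w) + p \<le> a k + c k \<and> b k \<le> snd (?A k w) \<and> snd (?A k w) + q \<le>
      b k + d k \<and>
     (\<exists>e\<in>E k. fst (?A k w) \<le> fst (?A k e) \<and> fst (?A k e) \<le> fst (?A k w) + p \<and>
        snd (?A k w) \<le> snd (?A k e) \<and> snd (?A k e) \<le> snd (?A k w) + q)"
    if k: "k \<in> K" and w: "w \<in> Q k" for k w
  proof -
    note [simp] = aff_def
    have pk: "0 < c k" "0 < d k" using pos[OF k] by auto
    obtain e where e: "e \<in> E k" "fst w \<le> fst e" "fst e \<le> fst w + p / c k" "snd w \<le> snd e"
        "snd e \<le> snd w + q / d k"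
      using Qw[OF k w] by blast
    have "c k * fst e \<le> c k * fst w + p" "d k * snd e \<le> d k * snd w + q"
      using e pk by (simp_all add: field_simps)
    moreover have "c k * fst w + p \<le> c k" "d k * snd w + q \<le> d k"
      using Qw[OF k w] scale[of "c k" "fst w" p 1] scale[of "d k" "snd w" q 1] pk by auto
    ultimately show ?thesis using e pk Qw[OF k w] by (auto intro!: bexI[of _ e])
  qed
  have sepA: "p \<le> \<bar>fst (?A k w) - fst (?A l w')\<bar> \<or> q \<le> \<bar>snd (?A k w) - snd (?A l w')\<bar>"
    if "k \<in> K" "l \<in> K" "w \<in> Q k" "w' \<in> Q l" "k \<noteq> l \<or> w \<noteq> w'" for k l w w'
  proof (cases "k = l")
    case True
    then show ?thesis
      using Qs[of k w w'] that pos[of k] scale2[of "c k" p] scale2[of "d k" q] by (auto simp: aff_def)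
  next
    case False
    then show ?thesis using sep[OF that(1,2)] box[OF that(1,3)] box[OF that(2,4)] by linarith
  qed
  let ?Z = "SIGMA k:K. Q k"
  let ?f = "\<lambda>(k, w). ?A k w"
  have finZ: "finite ?Z" using fin Q(1) by (rule finite_SigmaI)
  have inj: "inj_on ?f ?Z"
  proof (rule inj_onI)
    fix x y assume x: "x \<in> ?Z" and y: "y \<in> ?Z" and eq: "?f x = ?f y"
    show "x = y"
    proof (rule ccontr)
      assume "x \<noteq> y"
      then have "fst x \<noteq> fst y \<or> snd x \<noteq> snd y" by (simp add: prod_eq_iff)
      with sepA[of "fst x" "fst y" "snd x" "snd y"] x y eq p q
      show False by (auto simp: case_prod_beta)
    qed
  qed
  have "(\<Sum>k\<in>K. z k) \<le> (\<Sum>k\<in>K. real (card (Q k)))" by (rule sum_mono) (rule Q(2))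
  also have "\<dots> = real (card ?Z)"
    using fin Q(1) by (subst card_SigmaI) auto
  also have "\<dots> = real (card (?f ` ?Z))" using card_image[OF inj] by simp
  finally have z: "(\<Sum>k\<in>K. z k) \<le> real (card (?f ` ?Z))" .
  show ?thesis unfolding packs_def
  proof (intro exI[of _ "?f ` ?Z"] conjI ballI impI)
    show "finite (?f ` ?Z)" using finZ by blast
    show "(\<Sum>k\<in>K. z k) \<le> real (card (?f ` ?Z))" by (rule z)
  next
    fix w w' assume "w \<in> ?f ` ?Z" "w' \<in> ?f ` ?Z" "w \<noteq> w'"
    then obtain k v l v' where *: "k \<in> K" "v \<in> Q k" "w = ?A k v" "l \<in> K" "v' \<in> Q l" "w' = ?A l v'"
      by auto
    with \<open>w \<noteq> w'\<close> have "k \<noteq> l \<or> v \<noteq> v'" by auto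
    then show "p \<le> \<bar>fst w - fst w'\<bar> \<or> q \<le> \<bar>snd w - snd w'\<bar>"
      using sepA[of k l v v'] * by auto
  next
    fix w assume "w \<in> ?f ` ?Z"
    then obtain k v where *: "k \<in> K" "v \<in> Q k" "w = ?A k v" by auto
    show "0 \<le> fst w" "fst w + p \<le> 1" "0 \<le> snd w" "snd w + q \<le> 1"
      using box[OF *(1,2)] pos[OF *(1)] *(3) by auto
    show "\<exists>e\<in>(\<Union>k\<in>K. ?A k ` E k). in_box p q w e"
      using box[OF *(1,2)] * by blast
  qed
qed

lemma covers_union:
  fixes c d a b :: "'k \<Rightarrow> real"
  assumes fin: "finite K"
    and pos: "\<And>k. k \<in> K \<Longrightarrow> 0 < c k \<and> 0 < d k"
    and P: "\<And>k. k \<in> K \<Longrightarrow> covers (p / c k) (q / d k) (E k) (z k)"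
  shows "covers p q (\<Union>k\<in>K. aff (c k) (d k) (a k) (b k) ` E k) (\<Sum>k\<in>K. z k)"
proof -
  let ?A = "\<lambda>k. aff (c k) (d k) (a k) (b k)"
  let ?P = "\<lambda>k Q. finite Q \<and> real (card Q) \<le> z k \<and>
     (\<forall>e\<in>E k. \<exists>w\<in>Q. in_box (p / c k) (q / d k) w e)"
  have "\<forall>k\<in>K. \<exists>Q. ?P k Q" using P unfolding covers_def by (rule ballI)
  from bchoice[OF this] obtain Q where QQ: "\<forall>k\<in>K. ?P k (Q k)" by (rule exE)
  have Q: "\<And>k. k \<in> K \<Longrightarrow> finite (Q k)" "\<And>k. k \<in> K \<Longrightarrow> real (card (Q k)) \<le> z k"
    using QQ by simp_all
  have Qe: "\<And>k e. k \<in> K \<Longrightarrow> e \<in> E k \<Longrightarrow> \<exists>w\<in>Q k. in_box (p / c k) (q / d k) w e"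
    using QQ by simp
  let ?Q = "\<Union>k\<in>K. ?A k ` Q k"
  have "card ?Q \<le> (\<Sum>k\<in>K. card (?A k ` Q k))" by (rule card_UN_le[OF fin])
  also have "\<dots> \<le> (\<Sum>k\<in>K. card (Q k))" by (intro sum_mono card_image_le Q)
  finally have "real (card ?Q) \<le> real (\<Sum>k\<in>K. card (Q k))" by (rule of_nat_mono)
  also have "\<dots> = (\<Sum>k\<in>K. real (card (Q k)))" by simp
  also have "\<dots> \<le> (\<Sum>k\<in>K. z k)" by (intro sum_mono Q)
  finally have card: "real (card ?Q) \<le> (\<Sum>k\<in>K. z k)" .
  show ?thesis unfolding covers_def
  proof (intro exI[of _ ?Q] conjI ballI)
    fix e assume "e \<in> (\<Union>k\<in>K. ?A k ` E k)"
    then obtain k e' where k: "k \<in> K" "e' \<in> E k" "e = ?A k e'" by blast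
    obtain w where w: "w \<in> Q k" "fst w \<le> fst e'" "fst e' \<le> fst w + p / c k" "snd w \<le> snd e'"
        "snd e' \<le> snd w + q / d k"
      using Qe[OF k(1,2)] by blast
    have "c k * fst e' \<le> c k * fst w + p" "d k * snd e' \<le> d k * snd w + q"
      using w pos[OF k(1)] by (simp_all add: field_simps)
    then show "\<exists>w\<in>?Q. in_box p q w e"
      using k w pos[OF k(1)] by (intro bexI[of _ "?A k w"]) (auto simp: aff_def)
  qed (use fin Q card in auto)
qed

lemma covers_aff:
  assumes "covers p q E z" "0 < c" "0 < d"
  shows "covers (c * p) (d * q) (aff c d a b ` E) z"
  using covers_union[of "{()}" "\<lambda>_. c" "\<lambda>_. d" "c * p" "d * q" "\<lambda>_. E" "\<lambda>_. z" "\<lambda>_. a" "\<lambda>_. b"] assms by simp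

lemma covers_one:
  assumes "E \<subseteq> unit_square" "1 \<le> p" "1 \<le> q"
  shows "covers p q E 1"
  unfolding covers_def by (rule exI[of _ "{(0,0)}"]) (use assms in fastforce)

lemma dist_le_sum: "dist x y \<le> \<bar>fst x - fst y\<bar> + \<bar>snd x - snd y\<bar>" for x y :: "real \<times> real"
  by (cases x, cases y) (simp add: dist_Pair_Pair dist_real_def sqrt_sum_squares_le_sum_abs)

lemma abs_fst_le_dist: "\<bar>fst x - fst y\<bar> \<le> dist x y" for x y :: "real \<times> real"
  by (metis dist_fst_le dist_real_def)

lemma abs_snd_le_dist: "\<bar>snd x - snd y\<bar> \<le> dist x y" for x y :: "real \<times> real"
  by (metis dist_snd_le dist_real_def)

lemma covering_number_le:
  assumes "finite U" "card U = n" "E \<subseteq> \<Union>U" "\<And>A. A \<in> U \<Longrightarrow> open A \<and> bounded A \<and> diameter A \<le> r"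
  shows "covering_number r E \<le> n"
  unfolding covering_number_def by (rule Least_le) (use assms in blast)

lemma covering_number_attained:
  fixes E :: "(real \<times> real) set"
  assumes "bounded E" "0 < r"
  obtains U where "finite U" "card U = covering_number r E" "E \<subseteq> \<Union>U"
    "\<And>A. A \<in> U \<Longrightarrow> open A \<and> bounded A \<and> diameter A \<le> r"
proof -
  have "compact (closure E)" using assms(1) by simp
  moreover have "closure E \<subseteq> (\<Union>x\<in>closure E. ball x (r/2))" using assms(2) by auto
  ultimately obtain X where X: "X \<subseteq> closure E" "finite X" "closure E \<subseteq> (\<Union>x\<in>X. ball x (r/2))"
    using compactE_image[of "closure E" "closure E" "\<lambda>x. ball x (r/2)"] by (metis open_ball)
  define D where "D = (\<lambda>x. ball x (r/2)) ` X"
  have D: "finite D" "closure E \<subseteq> \<Union>D" using X by (auto simp: D_def)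
  have DA: "open A \<and> bounded A \<and> diameter A \<le> r" if "A \<in> D" for A
    using that assms(2) by (auto simp: D_def diameter_ball)
  have "\<exists>n U. finite U \<and> card U = n \<and> E \<subseteq> \<Union>U \<and> (\<forall>U\<in>U. open U \<and> bounded U \<and> diameter U \<le> r)"
    using D DA closure_subset[of E] by (intro exI[of _ "card D"] exI[of _ D]) auto
  then have "\<exists>U. finite U \<and> card U = covering_number r E \<and> E \<subseteq> \<Union>U \<and> (\<forall>U\<in>U. open U \<and> bounded U \<and>
      diameter U \<le> r)"
    unfolding covering_number_def by (rule LeastI_ex)
  then show ?thesis using that by blast
qed

text \<open>
  The open ball of radius \<open>r / 2\<close> about the corner contains the whole closed box, with room to
  spare.
\<close>
lemma covering_number_le_covers:
  assumes C: "covers p q E z" and r: "p \<le> r / 5" "q \<le> r / 5" "0 < r"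
  shows "real (covering_number r E) \<le> z"
proof -
  obtain Q where Q: "finite Q" "real (card Q) \<le> z"
     "\<forall>e\<in>E. \<exists>w\<in>Q. in_box p q w e"
    using C unfolding covers_def by blast
  have "covering_number r E \<le> card ((\<lambda>w. ball w (r/2)) ` Q)"
  proof (rule covering_number_le[where U = "(\<lambda>w. ball w (r/2)) ` Q"])
    show "E \<subseteq> \<Union>((\<lambda>w. ball w (r/2)) ` Q)"
    proof
      fix e assume "e \<in> E"
      then obtain w where w: "w \<in> Q" "fst w \<le> fst e" "fst e \<le> fst w + p" "snd w \<le> snd e" "snd e \<le> snd w + q"
        using Q(3) by blast
      have "dist w e < r / 2" using dist_le_sum[of w e] w r by linarith
      then show "e \<in> \<Union>((\<lambda>w. ball w (r/2)) ` Q)" using w(1) by auto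
    qed
  qed (use Q r in \<open>auto simp: diameter_ball\<close>)
  also have "\<dots> \<le> card Q" using Q(1) by (rule card_image_le)
  finally show ?thesis using Q(2) by linarith
qed

text \<open>
  The affine map turns the packed boxes into squares of side \<open>r\<close>. A set of diameter at most \<open>r\<close>
  meets at most nine of them: their corners lie in different cells of a grid of mesh \<open>r\<close>, and all of
  these cells belong to a \<open>3 \<times> 3\<close> block.
\<close>
lemma covering_number_ge_packs:
  assumes P: "packs (r / c) (r / d) T z" and pos: "0 < c" "0 < d" "0 < r"
    and sub: "aff c d a b ` T \<subseteq> E" and bdd: "bounded E"
  shows "z \<le> 9 * real (covering_number r E)"
proof -
  obtain Q where QQ: "is_packing (r / c) (r / d) T z Q"
    using P unfolding packs_def by (rule exE)
  have Q: "finite Q" "z \<le> real (card Q)"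
    "\<And>w. w \<in> Q \<Longrightarrow> (\<exists>e\<in>T. in_box (r / c) (r / d) w e)"
    using QQ by simp_all
  have sep: "\<And>w w'. w \<in> Q \<Longrightarrow> w' \<in> Q \<Longrightarrow> w \<noteq> w' \<Longrightarrow> r / c \<le> \<bar>fst w - fst w'\<bar> \<or> r / d \<le> \<bar>snd w - snd w'\<bar>"
    using QQ by simp
  obtain e where e: "\<And>w. w \<in> Q \<Longrightarrow> e w \<in> T \<and> fst w \<le> fst (e w) \<and> fst (e w) \<le> fst w + r / c \<and> snd w \<le>
      snd (e w) \<and> snd (e w) \<le> snd w + r / d"
    using Q(3) by metis
  obtain U where U: "finite U" "card U = covering_number r E" "E \<subseteq> \<Union>U"
    "\<And>A. A \<in> U \<Longrightarrow> open A \<and> bounded A \<and> diameter A \<le> r"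
    using covering_number_attained[OF bdd pos(3)] by blast
  have "\<forall>w\<in>Q. \<exists>A\<in>U. aff c d a b (e w) \<in> A" using e sub U(3) by blast
  then obtain A where A: "\<And>w. w \<in> Q \<Longrightarrow> A w \<in> U \<and> aff c d a b (e w) \<in> A w" by metis
  have per: "card {w \<in> Q. A w = B} \<le> 9" if B: "B \<in> U" for B
  proof (cases "{w \<in> Q. A w = B} = {}")
    case True
    then show ?thesis by (metis card.empty zero_le)
  next
    case False
    then obtain w0 where w0: "w0 \<in> Q" "A w0 = B" by blast
    have UB: "bounded B" "diameter B \<le> r" using U(4)[OF B] by auto
    let ?g = "\<lambda>w::real\<times>real. (\<lfloor>c * fst w / r\<rfloor>, \<lfloor>d * snd w / r\<rfloor>)"
    let ?W = "{w \<in> Q. A w = B}"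
    (* corners of boxes hitting the same small set fall, in units of r, into a 3 x 3 block of cells *)
    define lo1 where "lo1 = Min ((\<lambda>w. \<lfloor>c * fst w / r\<rfloor>) ` ?W)"
    define lo2 where "lo2 = Min ((\<lambda>w. \<lfloor>d * snd w / r\<rfloor>) ` ?W)"
    have fin: "finite ?W" using Q(1) by simp
    have close: "\<lfloor>c * fst w' / r\<rfloor> \<le> \<lfloor>c * fst w / r\<rfloor> + 2 \<and> \<lfloor>d * snd w' / r\<rfloor> \<le> \<lfloor>d * snd w / r\<rfloor> + 2"
      if w: "w \<in> ?W" "w' \<in> ?W" for w w'
    proof -
      have "dist (aff c d a b (e w')) (aff c d a b (e w)) \<le> diameter B"
        using w A[of w] A[of w'] by (intro diameter_bounded_bound UB(1)) auto
      then have "dist (aff c d a b (e w')) (aff c d a b (e w)) \<le> r" using UB by linarith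
      then have f: "c * fst (e w') - c * fst (e w) \<le> r" "d * snd (e w') - d * snd (e w) \<le> r"
        using abs_fst_le_dist[of "aff c d a b (e w')" "aff c d a b (e w)"]
          abs_snd_le_dist[of "aff c d a b (e w')" "aff c d a b (e w)"] by (auto simp: aff_def)
      have g: "c * fst (e w) \<le> c * fst w + r" "d * snd (e w) \<le> d * snd w + r"
        "c * fst w' \<le> c * fst (e w')" "d * snd w' \<le> d * snd (e w')"
        using e w pos by (auto simp: field_simps)
      have "c * fst w' \<le> c * fst w + 2 * r" "d * snd w' \<le> d * snd w + 2 * r"
        using f g by linarith+
      then have "c * fst w' / r \<le> c * fst w / r + 2" "d * snd w' / r \<le> d * snd w / r + 2"
        using pos by (auto simp: field_simps)
      then show ?thesis by linarith
    qed
    have min: "\<exists>w\<in>?W. f w = Min (f ` ?W)" for f :: "real \<times> real \<Rightarrow> int"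
    proof -
      have "Min (f ` ?W) \<in> f ` ?W" using fin False by (intro Min_in) simp_all
      then show ?thesis by (metis (no_types, lifting) imageE)
    qed
    obtain w1 where w1: "w1 \<in> ?W" "\<lfloor>c * fst w1 / r\<rfloor> = lo1"
        using min[of "\<lambda>w. \<lfloor>c * fst w / r\<rfloor>"] unfolding lo1_def by blast
    obtain w2 where w2: "w2 \<in> ?W" "\<lfloor>d * snd w2 / r\<rfloor> = lo2"
        using min[of "\<lambda>w. \<lfloor>d * snd w / r\<rfloor>"] unfolding lo2_def by blast
    have sub: "?g ` ?W \<subseteq> {lo1..lo1+2} \<times> {lo2..lo2+2}"
    proof
      fix g assume "g \<in> ?g ` ?W"
      then obtain w where w: "w \<in> ?W" "g = ?g w" by blast
      have "lo1 \<le> \<lfloor>c * fst w / r\<rfloor>" "lo2 \<le> \<lfloor>d * snd w / r\<rfloor>"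
        unfolding lo1_def lo2_def using fin w(1) by (auto intro!: Min_le)
      moreover have "\<lfloor>c * fst w / r\<rfloor> \<le> lo1 + 2" "\<lfloor>d * snd w / r\<rfloor> \<le> lo2 + 2"
        using close[OF w1(1) w(1)] close[OF w2(1) w(1)] w1(2) w2(2) by simp_all
      ultimately show "g \<in> {lo1..lo1+2} \<times> {lo2..lo2+2}" using w(2) by auto
    qed
    have inj: "inj_on ?g ?W"
    proof (rule inj_onI, rule ccontr)
      fix w w' assume w: "w \<in> ?W" "w' \<in> ?W" "?g w = ?g w'" "w \<noteq> w'"
      have fl: "\<bar>x - y\<bar> < 1" if "\<lfloor>x\<rfloor> = \<lfloor>y\<rfloor>" for x y :: real using that by linarith
      have "\<bar>c * fst w / r - c * fst w' / r\<bar> < 1" "\<bar>d * snd w / r - d * snd w' / r\<bar> < 1"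
        using fl w(3) by auto
      moreover have "\<bar>x - y\<bar> < r / k" if "\<bar>k * x / r - k * y / r\<bar> < 1" "0 < k" for x y k :: real
      proof -
        have "k * x / r - k * y / r = (k / r) * (x - y)" using pos by (simp add: field_simps)
        then have "\<bar>x - y\<bar> * (k / r) < 1" using that pos by (simp add: abs_mult mult.commute)
        then have "\<bar>x - y\<bar> < 1 / (k / r)" using that pos by (subst pos_less_divide_eq) auto
        then show ?thesis by simp
      qed
      ultimately have "\<bar>fst w - fst w'\<bar> < r / c" "\<bar>snd w - snd w'\<bar> < r / d"
        using pos by blast+
      then show False using sep[of w w'] w by auto
    qed
    have "card ?W = card (?g ` ?W)" using card_image[OF inj] by simp
    also have "\<dots> \<le> card ({lo1..lo1+2} \<times> {lo2..lo2+2})" by (rule card_mono[OF _ sub]) simp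
    also have "\<dots> = 9" by (simp add: card_cartesian_product)
    finally show ?thesis .
  qed
  have "Q \<subseteq> (\<Union>B\<in>U. {w \<in> Q. A w = B})" using A by blast
  then have "card Q \<le> card (\<Union>B\<in>U. {w \<in> Q. A w = B})" using Q(1) U(1) by (intro card_mono) auto
  also have "\<dots> \<le> (\<Sum>B\<in>U. card {w \<in> Q. A w = B})" by (rule card_UN_le[OF U(1)])
  also have "\<dots> \<le> (\<Sum>B\<in>U. 9)" by (rule sum_mono) (rule per)
  also have "\<dots> = 9 * covering_number r E" using U(2) by simp
  finally show ?thesis using Q(2) by linarith
qed

section \<open>Box dimension and self-affine recursions\<close>
lemma has_box_dimI:
  assumes "0 < A" "0 < B" "0 < r0"
    and bounds: "\<And>r. 0 < r \<Longrightarrow> r < r0 \<Longrightarrow> A * r powr (- s) \<le> real (covering_number r E) \<and>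
        real (covering_number r E) \<le> B * r powr (- s)"
  shows "has_box_dim E s"
proof -
  let ?N = "\<lambda>r. ln (real (covering_number r E)) / (- ln r)"
  have lim: "((\<lambda>r. s + ln K / (- ln r)) \<longlongrightarrow> s) (at_right 0)" if "K > 0" for K :: real
  proof -
    have "filterlim (\<lambda>r::real. - ln r) at_top (at_right 0)"
      using ln_at_0 by (simp add: filterlim_uminus_at_top)
    then have "((\<lambda>r. ln K / (- ln r)) \<longlongrightarrow> 0) (at_right (0::real))"
      by (intro tendsto_divide_0[OF tendsto_const] filterlim_at_top_imp_at_infinity)
    from tendsto_add[OF tendsto_const this] show ?thesis by simp
  qed
  have ev: "eventually (\<lambda>r. 0 < r \<and> r < min r0 1) (at_right (0::real))"
    using assms(3) by (intro eventually_conj eventually_at_right_less)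
      (auto simp: eventually_at_right_field intro!: exI[of _ "min r0 1"])
  have b: "s + ln A / (- ln r) \<le> ?N r \<and> ?N r \<le> s + ln B / (- ln r)" if r: "0 < r \<and> r < min r0 1" for r
  proof -
    have l: "- ln r > 0" using r by simp
    have N: "A * r powr (- s) \<le> real (covering_number r E)" "real (covering_number r E) \<le> B * r powr (- s)"
      using bounds r by auto
    have pos: "0 < A * r powr (- s)" using assms(1) r by simp
    have "ln (A * r powr (- s)) \<le> ln (real (covering_number r E))"
      using N pos by (intro ln_mono) auto
    moreover have "ln (real (covering_number r E)) \<le> ln (B * r powr (- s))"
      using N pos by (intro ln_mono) auto
    moreover have "ln (A * r powr (- s)) = ln A + s * (- ln r)" "ln (B * r powr (- s)) = ln B + s * (- ln r)"
      using assms r by (simp_all add: ln_mult ln_powr)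
    ultimately have "(ln A + s * (- ln r)) / (- ln r) \<le> ?N r" "?N r \<le> (ln B + s * (- ln r)) / (- ln r)"
      using l by (metis divide_right_mono less_imp_le)+
    then show ?thesis using l by (simp add: add_divide_distrib diff_divide_distrib)
  qed
  show ?thesis unfolding has_box_dim_def
  proof (rule tendsto_sandwich[OF _ _ lim[OF assms(1)] lim[OF assms(2)]])
    show "eventually (\<lambda>r. s + ln A / (- ln r) \<le> ?N r) (at_right 0)"
      using ev by eventually_elim (use b in blast)
    show "eventually (\<lambda>r. ?N r \<le> s + ln B / (- ln r)) (at_right 0)"
      using ev by eventually_elim (use b in blast)
  qed
qed

lemma box_dim_eqI:
  assumes "has_box_dim E s"
  shows "box_dim E = s" "box_dim_exists E"
proof -
  show "box_dim_exists E" using assms unfolding box_dim_exists_def by blast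
  show "box_dim E = s" unfolding box_dim_def
    using assms unfolding has_box_dim_def
    by (intro the_equality) (auto intro: tendsto_unique[OF trivial_limit_at_right_real])
qed

lemma has_box_dim_packs_covers:
  assumes "bounded E" and A: "0 < A" and B: "0 < B"
    and P: "\<And>p. 0 < p \<Longrightarrow> p \<le> 1 \<Longrightarrow> packs p p E (A * p powr (- s))"
    and C: "\<And>p. 0 < p \<Longrightarrow> p \<le> 1 \<Longrightarrow> covers p p E (B * p powr (- s))"
  shows "has_box_dim E s"
proof (rule has_box_dimI[where A = "A / 9" and B = "B * 5 powr s" and ?r0.0 = 1])
  fix r :: real assume r: "0 < r" "r < 1"
  have "aff 1 1 0 0 ` E \<subseteq> E" by (auto simp: aff_def)
  then have "A * r powr (- s) \<le> 9 * real (covering_number r E)"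
    using P[of r] r assms(1) by (intro covering_number_ge_packs[of r 1 1 E _ 0 0]) auto
  moreover have "real (covering_number r E) \<le> B * (r / 5) powr (- s)"
    using r C[of "r / 5"] by (intro covering_number_le_covers[of "r/5" "r/5"]) auto
  moreover have "(r / 5) powr (- s) = 5 powr s * r powr (- s)"
    using r by (simp add: powr_divide powr_minus field_simps)
  ultimately show "A / 9 * r powr (- s) \<le> real (covering_number r E) \<and>
      real (covering_number r E) \<le> B * 5 powr s * r powr (- s)" by simp
qed (use A B in auto)

lemma powr_scale:
  fixes p c s :: real
  assumes "0 < p" "0 < c"
  shows "(p / c) powr (- s) = p powr (- s) * c powr s"
  using assms by (simp add: powr_divide powr_minus field_simps)

text \<open>
  The exponents reproduce themselves under the recursion \<open>N(p, q) \<ge> \<Sum> N(p / c\<^sub>k, q / d\<^sub>k)\<close> for packing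
  counts as soon as \<open>\<Sum> c\<^sub>k\<^sup>s d\<^sub>k\<^sup>t \<ge> 1\<close>. The set \<open>D\<close> of admissible box sizes lets the same induction run
  in one direction only (projections and slices) or in both; the sizes at which the recursion would
  leave \<open>D\<close> are those where the estimate has to be known beforehand.
\<close>
lemma packs_selfaffine:
  fixes c d a b :: "'k \<Rightarrow> real"
  assumes fin: "finite K"
    and pos: "\<And>k. k \<in> K \<Longrightarrow> 0 < c k \<and> 0 < d k \<and> 0 \<le> a k \<and> a k + c k \<le> 1 \<and> 0 \<le> b k \<and> b k + d k \<le> 1"
    and sep: "\<And>k l. k \<in> K \<Longrightarrow> l \<in> K \<Longrightarrow> k \<noteq> l \<Longrightarrow>
       a k + c k \<le> a l \<or> a l + c l \<le> a k \<or> b k + d k \<le> b l \<or> b l + d l \<le> b k"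
    and contr: "\<And>k. k \<in> K \<Longrightarrow> c k * d k \<le> \<rho>" and \<rho>: "0 < \<rho>" "\<rho> < 1"
    and sub: "(\<Union>k\<in>K. aff (c k) (d k) (a k) (b k) ` E) \<subseteq> E"
    and weight: "1 \<le> (\<Sum>k\<in>K. c k powr s * d k powr t)"
    and C: "0 \<le> C"
    and D: "\<And>p q. (p, q) \<in> D \<Longrightarrow> 0 < p \<and> p \<le> 1 \<and> 0 < q \<and> q \<le> 1"
    and step: "\<And>p q. (p, q) \<in> D \<Longrightarrow> packs p q E (C * p powr (- s) * q powr (- t)) \<or> (\<forall>k\<in>K. (p / c k, q / d
        k) \<in> D)"
    and pq: "(p, q) \<in> D"
  shows "packs p q E (C * p powr (- s) * q powr (- t))"
proof -
  have main: "packs p q E (C * p powr (- s) * q powr (- t))" if "\<rho> ^ n \<le> p * q" "(p, q) \<in> D" for n p q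
    using that
  proof (induction n arbitrary: p q)
    case 0
    show ?case
    proof (cases "\<forall>k\<in>K. (p / c k, q / d k) \<in> D")
      case True
      have "K \<noteq> {}" using weight by auto
      then obtain k where k: "k \<in> K" by blast
      have ck: "0 < c k" "0 < d k" using pos[OF k] by auto
      have "p / c k \<le> 1" "q / d k \<le> 1" "0 < p" "0 < q" using True k D 0 by blast+
      then have "p \<le> c k" "q \<le> d k" using ck by (auto simp: field_simps)
      then have "p * q \<le> c k * d k" using \<open>0 < p\<close> \<open>0 < q\<close> ck by (intro mult_mono) auto
      then show ?thesis using contr[OF k] \<rho> 0 by simp
    qed (use step 0 in blast)
  next
    case (Suc n)
    show ?case
    proof (cases "\<forall>k\<in>K. (p / c k, q / d k) \<in> D")
      case True
      have p: "0 < p" "0 < q" using D Suc.prems by blast+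
      have "packs p q (\<Union>k\<in>K. aff (c k) (d k) (a k) (b k) ` E)
          (\<Sum>k\<in>K. C * (p / c k) powr (- s) * (q / d k) powr (- t))"
      proof (rule packs_union[OF fin pos sep])
        fix k assume k: "k \<in> K"
        have ck: "0 < c k" "0 < d k" using pos[OF k] by auto
        have "\<rho> ^ n * (c k * d k) \<le> \<rho> ^ n * \<rho>" using contr[OF k] \<rho> by (intro mult_left_mono) auto
        also have "\<dots> \<le> p * q" using Suc.prems by (simp add: mult.commute)
        finally have "\<rho> ^ n \<le> (p / c k) * (q / d k)" using ck by (simp add: field_simps)
        then show "packs (p / c k) (q / d k) E (C * (p / c k) powr (- s) * (q / d k) powr (- t))"
          using Suc.IH True k by blast
      qed (use p in auto)
      moreover have "C * p powr (- s) * q powr (- t) \<le>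
          (\<Sum>k\<in>K. C * (p / c k) powr (- s) * (q / d k) powr (- t))"
      proof -
        have "C * p powr (- s) * q powr (- t) * 1 \<le>
            C * p powr (- s) * q powr (- t) * (\<Sum>k\<in>K. c k powr s * d k powr t)"
          using weight C by (intro mult_left_mono) auto
        also have "\<dots> = (\<Sum>k\<in>K. C * (p / c k) powr (- s) * (q / d k) powr (- t))"
          unfolding sum_distrib_left
        proof (rule sum.cong[OF refl])
          fix k assume k: "k \<in> K"
          show "C * p powr (- s) * q powr (- t) * (c k powr s * d k powr t) =
              C * (p / c k) powr (- s) * (q / d k) powr (- t)"
            using powr_scale[of p "c k" s] powr_scale[of q "d k" t] pos[OF k] p by simp
        qed
        finally show ?thesis by simp
      qed
      ultimately show ?thesis using sub packs_weaken by blast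
    qed (use step Suc.prems in blast)
  qed
  have "0 < p * q" using D[OF pq] by simp
  then obtain n where "\<rho> ^ n < p * q" using real_arch_pow_inv \<rho> by blast
  then show ?thesis using main[OF less_imp_le pq] by blast
qed

text \<open>The dual induction, from \<open>N(p, q) \<le> \<Sum> N(p / c\<^sub>k, q / d\<^sub>k)\<close> for covering counts.\<close>
lemma covers_selfaffine:
  fixes c d a b :: "'k \<Rightarrow> real"
  assumes fin: "finite K"
    and pos: "\<And>k. k \<in> K \<Longrightarrow> 0 < c k \<and> 0 < d k"
    and contr: "\<And>k. k \<in> K \<Longrightarrow> c k * d k \<le> \<rho>" and \<rho>: "0 < \<rho>" "\<rho> < 1"
    and sub: "E \<subseteq> (\<Union>k\<in>K. aff (c k) (d k) (a k) (b k) ` E)"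
    and weight: "(\<Sum>k\<in>K. c k powr s * d k powr t) \<le> 1"
    and C: "0 \<le> C"
    and D: "\<And>p q. (p, q) \<in> D \<Longrightarrow> 0 < p \<and> 0 < q"
    and step: "\<And>p q. (p, q) \<in> D \<Longrightarrow> covers p q E (C * p powr (- s) * q powr (- t)) \<or> (p * q < 1 \<and>
        (\<forall>k\<in>K. (p / c k, q / d k) \<in> D))"
    and pq: "(p, q) \<in> D"
  shows "covers p q E (C * p powr (- s) * q powr (- t))"
proof -
  have main: "covers p q E (C * p powr (- s) * q powr (- t))" if "\<rho> ^ n \<le> p * q" "(p, q) \<in> D" for n p q
    using that
  proof (induction n arbitrary: p q)
    case 0
    then show ?case using step by force
  next
    case (Suc n)
    show ?case
    proof (cases "\<forall>k\<in>K. (p / c k, q / d k) \<in> D")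
      case True
      have p: "0 < p" "0 < q" using D Suc.prems by blast+
      have "covers p q (\<Union>k\<in>K. aff (c k) (d k) (a k) (b k) ` E)
          (\<Sum>k\<in>K. C * (p / c k) powr (- s) * (q / d k) powr (- t))"
      proof (rule covers_union[OF fin pos])
        fix k assume k: "k \<in> K"
        have ck: "0 < c k" "0 < d k" using pos[OF k] by auto
        have "\<rho> ^ n * (c k * d k) \<le> \<rho> ^ n * \<rho>" using contr[OF k] \<rho> by (intro mult_left_mono) auto
        also have "\<dots> \<le> p * q" using Suc.prems by (simp add: mult.commute)
        finally have "\<rho> ^ n \<le> (p / c k) * (q / d k)" using ck by (simp add: field_simps)
        then show "covers (p / c k) (q / d k) E (C * (p / c k) powr (- s) * (q / d k) powr (- t))"
          using Suc.IH True k by blast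
      qed auto
      moreover have "(\<Sum>k\<in>K. C * (p / c k) powr (- s) * (q / d k) powr (- t)) \<le>
          C * p powr (- s) * q powr (- t)"
      proof -
        have "(\<Sum>k\<in>K. C * (p / c k) powr (- s) * (q / d k) powr (- t)) =
            C * p powr (- s) * q powr (- t) * (\<Sum>k\<in>K. c k powr s * d k powr t)"
          unfolding sum_distrib_left
        proof (rule sum.cong[OF refl])
          fix k assume k: "k \<in> K"
          show "C * (p / c k) powr (- s) * (q / d k) powr (- t) =
              C * p powr (- s) * q powr (- t) * (c k powr s * d k powr t)"
            using powr_scale[of p "c k" s] powr_scale[of q "d k" t] pos[OF k] p by simp
        qed
        also have "\<dots> \<le> C * p powr (- s) * q powr (- t) * 1"
          using weight C by (intro mult_left_mono) auto
        finally show ?thesis by simp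
      qed
      ultimately show ?thesis using covers_weaken sub by blast
    qed (use step Suc.prems in blast)
  qed
  have "0 < p * q" using D[OF pq] by simp
  then obtain n where "\<rho> ^ n < p * q" using real_arch_pow_inv \<rho> by blast
  then show ?thesis using main[OF less_imp_le pq] by blast
qed

lemma moran_exponent_exists:
  fixes c :: "'k \<Rightarrow> real"
  assumes fin: "finite K" "K \<noteq> {}" and c: "\<And>k. k \<in> K \<Longrightarrow> 0 < c k \<and> c k < 1"
  shows "\<exists>s\<ge>0. (\<Sum>k\<in>K. c k powr s) = 1"
proof -
  let ?f = "\<lambda>s. \<Sum>k\<in>K. c k powr s"
  have "((\<lambda>s. \<Sum>k\<in>K. c k powr s) \<longlongrightarrow> (\<Sum>k\<in>K. 0)) at_top"
  proof (rule tendsto_sum)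
    fix k assume k: "k \<in> K"
    have "((\<lambda>s. exp (ln (c k) * s)) \<longlongrightarrow> 0) at_top"
    proof (rule filterlim_compose[OF exp_at_bot])
      show "filterlim (\<lambda>s. ln (c k) * s) at_bot at_top"
        using c[OF k] by (intro filterlim_tendsto_neg_mult_at_bot[OF tendsto_const _ filterlim_ident]) auto
    qed
    then show "((\<lambda>s. c k powr s) \<longlongrightarrow> 0) at_top"
      using c[OF k] by (simp add: powr_def mult.commute)
  qed
  then have "eventually (\<lambda>s. ?f s < 1) at_top" by (intro order_tendstoD) auto
  then obtain M where M: "\<And>s. M \<le> s \<Longrightarrow> ?f s < 1" unfolding eventually_at_top_linorder by blast
  have "1 \<le> card K" using fin by (simp add: Suc_leI card_gt_0_iff)
  moreover have "?f 0 = (\<Sum>k\<in>K. 1)" by (intro sum.cong refl) (use c in force)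
  ultimately have "1 \<le> ?f 0" by simp
  moreover have "?f (max M 0) \<le> 1" using M[of "max M 0"] by simp
  moreover have "continuous_on {0..max M 0} ?f"
    using c by (intro continuous_intros) force+
  ultimately show ?thesis
    using IVT2'[of ?f "max M 0" 1 0] by auto
qed

lemma covers_flat_snd:
  assumes "covers p q E z" "\<And>e. e \<in> E \<Longrightarrow> snd e = y" "0 \<le> q'"
  shows "covers p q' E z"
proof -
  obtain Q where Q: "finite Q" "real (card Q) \<le> z"
     "\<forall>e\<in>E. \<exists>w\<in>Q. in_box p q w e"
    using assms(1) unfolding covers_def by blast
  have "card ((\<lambda>w. (fst w, y)) ` Q) \<le> card Q" using Q(1) by (rule card_image_le)
  then show ?thesis unfolding covers_def
  proof (intro exI[of _ "(\<lambda>w. (fst w, y)) ` Q"] conjI ballI)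
    fix e assume e: "e \<in> E"
    then obtain w where "w \<in> Q" "in_box p q w e"
      using Q(3) by blast
    then show "\<exists>w\<in>(\<lambda>w. (fst w, y)) ` Q. in_box p q' w e"
      using assms(2)[OF e] assms(3) by auto
  qed (use Q in auto)
qed

lemma covers_flat_fst:
  assumes "covers p q E z" "\<And>e. e \<in> E \<Longrightarrow> fst e = x" "0 \<le> p'"
  shows "covers p' q E z"
proof -
  obtain Q where Q: "finite Q" "real (card Q) \<le> z"
     "\<forall>e\<in>E. \<exists>w\<in>Q. in_box p q w e"
    using assms(1) unfolding covers_def by blast
  have "card ((\<lambda>w. (x, snd w)) ` Q) \<le> card Q" using Q(1) by (rule card_image_le)
  then show ?thesis unfolding covers_def
  proof (intro exI[of _ "(\<lambda>w. (x, snd w)) ` Q"] conjI ballI)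
    fix e assume e: "e \<in> E"
    then obtain w where "w \<in> Q" "in_box p q w e"
      using Q(3) by blast
    then show "\<exists>w\<in>(\<lambda>w. (x, snd w)) ` Q. in_box p' q w e"
      using assms(2)[OF e] assms(3) by auto
  qed (use Q in auto)
qed

text \<open>
  A maximum above 1 would be the image of a strictly larger point, and similarly for the minimum.
\<close>
lemma selfsimilar_in_unit_interval:
  fixes E :: "real set"
  assumes "compact E" "E \<noteq> {}"
    and s: "\<And>x. x \<in> E \<Longrightarrow> \<exists>y\<in>E. \<exists>c a. 0 < c \<and> c < 1 \<and> 0 \<le> a \<and> a + c \<le> 1 \<and> x = c * y + a"
  shows "E \<subseteq> {0..1}"
proof -
  obtain M where M: "M \<in> E" "\<And>x. x \<in> E \<Longrightarrow> x \<le> M" using compact_attains_sup[OF assms(1,2)] by blast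
  obtain m where m: "m \<in> E" "\<And>x. x \<in> E \<Longrightarrow> m \<le> x" using compact_attains_inf[OF assms(1,2)] by blast
  obtain y c a where y: "y \<in> E" "0 < c" "c < 1" "0 \<le> a" "a + c \<le> 1" "M = c * y + a" using s[OF M(1)] by blast
  have "c * y \<le> c * M" using y M by simp
  then have "(1 - c) * M \<le> (1 - c) * 1" using y by (simp add: algebra_simps)
  then have "M \<le> 1" using y by (simp only: mult_le_cancel_left_pos)
  obtain y' c' a' where y': "y' \<in> E" "0 < c'" "c' < 1" "0 \<le> a'" "a' + c' \<le> 1" "m = c' * y' + a'"
      using s[OF m(1)] by blast
  have "c' * m \<le> c' * y'" using y' m by simp
  then have "(1 - c') * 0 \<le> (1 - c') * m" using y' by (simp add: algebra_simps)
  then have "0 \<le> m" using y' mult_le_cancel_left_pos[of "1 - c'" 0 m] by simp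
  show ?thesis using \<open>M \<le> 1\<close> \<open>0 \<le> m\<close> M(2) m(2) by force
qed

text \<open>
  Boxes of full height only see the horizontal projection.
\<close>
lemma packs_of_projection:
  assumes P: "packs p 1 E z" and sub: "fst ` E \<subseteq> fst ` E'" and E': "E' \<subseteq> unit_square"
  shows "packs p 1 E' z"
proof -
  obtain Q where QQ: "is_packing p 1 E z Q"
    using P unfolding packs_def by (rule exE)
  show ?thesis unfolding packs_def
  proof (intro exI[of _ Q] conjI ballI impI)
    fix w assume w: "w \<in> Q"
    then obtain e where e: "e \<in> E" "in_box p 1 w e"
      using QQ by blast
    from e(1) sub obtain e' where e': "e' \<in> E'" "fst e' = fst e" by (metis image_iff image_subset_iff)
    have "0 \<le> snd e' \<and> snd e' \<le> 1" using e'(1) E' by auto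
    moreover have "snd w = 0" using QQ w by force
    ultimately show "\<exists>e\<in>E'. in_box p 1 w e"
      using e e' by (intro bexI[of _ e']) auto
  qed (use QQ in auto)
qed

lemma covers_of_projection:
  assumes C: "covers p q E z" and sub: "fst ` E' \<subseteq> fst ` E" and E': "E' \<subseteq> unit_square"
  shows "covers p 1 E' z"
proof -
  obtain Q where Q: "finite Q" "real (card Q) \<le> z"
     "\<forall>e\<in>E. \<exists>w\<in>Q. in_box p q w e"
    using C unfolding covers_def by blast
  have "card ((\<lambda>w. (fst w, 0::real)) ` Q) \<le> card Q" using Q(1) by (rule card_image_le)
  then show ?thesis unfolding covers_def
  proof (intro exI[of _ "(\<lambda>w. (fst w, 0)) ` Q"] conjI ballI)
    fix e' assume e': "e' \<in> E'"
    then obtain e where e: "e \<in> E" "fst e = fst e'" using sub by (metis image_iff image_subset_iff)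
    then obtain w where "w \<in> Q" "in_box p q w e"
      using Q(3) by blast
    moreover have "0 \<le> snd e' \<and> snd e' \<le> 1" using e' E' by auto
    ultimately show "\<exists>w\<in>(\<lambda>w. (fst w, 0)) ` Q. in_box p 1 w e'"
      using e by auto
  qed (use Q in auto)
qed

lemma powr_quotient_le_1:
  fixes \<delta> p s :: real
  assumes "0 < \<delta>" "\<delta> \<le> p" "0 \<le> s"
  shows "\<delta> powr s * p powr (- s) \<le> 1"
proof -
  have "\<delta> powr s * p powr (- s) = (\<delta> / p) powr s" using assms
      by (simp add: powr_divide powr_minus field_simps)
  also have "\<dots> \<le> 1" using assms by (intro powr_le1) auto
  finally show ?thesis .
qed

lemma one_le_powr_quotient:
  fixes \<delta> p s :: real
  assumes "0 < \<delta>" "0 < p" "p \<le> 1 / \<delta>" "0 \<le> s"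
  shows "1 \<le> \<delta> powr (- s) * p powr (- s)"
proof -
  have "p powr s \<le> (1 / \<delta>) powr s" using assms by (intro powr_mono2) auto
  then show ?thesis using assms by (simp add: powr_divide powr_minus field_simps)
qed

section \<open>Systems of rectangles arranged in columns\<close>

text \<open>
  What both classes of carpets have in common: the chosen rectangles fill parts of vertical columns.
  Widths and heights are not compared with each other, so that a system in the Baranski class can be
  viewed both through its columns and, after reflection in the diagonal, through its rows.
\<close>
locale column_system =
  fixes I :: "'i set" and col :: "'i \<Rightarrow> nat" and c d a b :: "'i \<Rightarrow> real" and F :: "(real \<times> real) set"
  assumes fin: "finite I" and ne: "I \<noteq> {}"
    and pos: "\<And>i. i \<in> I \<Longrightarrow> 0 < c i \<and> c i < 1 \<and> 0 < d i \<and> d i < 1 \<and>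
       0 \<le> a i \<and> a i + c i \<le> 1 \<and> 0 \<le> b i \<and> b i + d i \<le> 1"
    and same: "\<And>i k. i \<in> I \<Longrightarrow> k \<in> I \<Longrightarrow> col i = col k \<Longrightarrow> c i = c k \<and> a i = a k"
    and diff: "\<And>i k. i \<in> I \<Longrightarrow> k \<in> I \<Longrightarrow> col i \<noteq> col k \<Longrightarrow> a i + c i \<le> a k \<or> a k + c k \<le> a i"
    and rows: "\<And>i k. i \<in> I \<Longrightarrow> k \<in> I \<Longrightarrow> i \<noteq> k \<Longrightarrow> col i = col k \<Longrightarrow> b i + d i \<le> b k \<or> b k + d k \<le> b i"
    and compact_F: "compact F" and F_ne: "F \<noteq> {}"
    and F_eq: "F = (\<Union>i\<in>I. aff (c i) (d i) (a i) (b i) ` F)"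
begin

abbreviation S :: "'i \<Rightarrow> real \<times> real \<Rightarrow> real \<times> real" where
  "S i \<equiv> aff (c i) (d i) (a i) (b i)"

definition column_of :: "'i \<Rightarrow> 'i set" where
  "column_of i = {k \<in> I. col k = col i}"

text \<open>One rectangle from each column that is in use.\<close>
definition reps :: "'i set" where
  "reps = (SOME J. J \<subseteq> I \<and> inj_on col J \<and> col ` J = col ` I)"

text \<open>
  Roots of Moran equations: the dimension of the horizontal projection, and that of the vertical
  slices in the column of \<open>i\<close>.
\<close>
definition base_dim :: real where
  "base_dim = (SOME s. 0 \<le> s \<and> (\<Sum>j\<in>reps. c j powr s) = 1)"

definition fibre_dim :: "'i \<Rightarrow> real" where
  "fibre_dim i = (SOME t. 0 \<le> t \<and> (\<Sum>k\<in>column_of i. d k powr t) = 1)"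

definition smallest :: real where "smallest = Min (c ` I \<union> d ` I)"
definition largest :: real where "largest = Max (c ` I \<union> d ` I)"

lemma smallest: "0 < smallest" "i \<in> I \<Longrightarrow> smallest \<le> c i" "i \<in> I \<Longrightarrow> smallest \<le> d i"
  unfolding smallest_def using fin ne pos by (auto intro!: Min_le)

lemma largest: "0 < largest" "largest < 1" "i \<in> I \<Longrightarrow> c i \<le> largest" "i \<in> I \<Longrightarrow> d i \<le> largest"
proof -
  show "largest < 1" unfolding largest_def using fin ne pos by auto
  show "i \<in> I \<Longrightarrow> c i \<le> largest" "i \<in> I \<Longrightarrow> d i \<le> largest"
    unfolding largest_def using fin by (auto intro!: Max_ge)
  obtain k where "k \<in> I" using ne by blast
  then have "c k \<le> largest" "0 < c k" unfolding largest_def using fin pos by (auto intro!: Max_ge)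
  then show "0 < largest" by linarith
qed

lemma reps: "reps \<subseteq> I" "inj_on col reps" "col ` reps = col ` I"
proof -
  have "\<exists>J. J \<subseteq> I \<and> inj_on col J \<and> col ` J = col ` I"
    by (metis subset_image_inj subset_refl)
  from someI_ex[OF this] show "reps \<subseteq> I" "inj_on col reps" "col ` reps = col ` I"
    unfolding reps_def by blast+
qed

lemma finite_reps: "finite reps" using reps(1) fin finite_subset by blast

lemma base_dim: "0 \<le> base_dim" "(\<Sum>j\<in>reps. c j powr base_dim) = 1"
proof -
  have "\<exists>s\<ge>0. (\<Sum>j\<in>reps. c j powr s) = 1"
    using moran_exponent_exists[of reps c] finite_reps reps ne pos by (metis image_is_empty subsetD)
  from someI_ex[OF this] show "0 \<le> base_dim" "(\<Sum>j\<in>reps. c j powr base_dim) = 1"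
    unfolding base_dim_def by blast+
qed

lemma column_of: "column_of i \<subseteq> I" "finite (column_of i)" "i \<in> I \<Longrightarrow> i \<in> column_of i"
  using fin by (auto simp: column_of_def)

lemma fibre_dim: assumes "i \<in> I" shows "0 \<le> fibre_dim i" "(\<Sum>k\<in>column_of i. d k powr fibre_dim i) = 1"
proof -
  have "\<exists>t\<ge>0. (\<Sum>k\<in>column_of i. d k powr t) = 1"
    using moran_exponent_exists[of "column_of i" d] column_of assms pos by (metis empty_iff subsetD)
  from someI_ex[OF this] show "0 \<le> fibre_dim i" "(\<Sum>k\<in>column_of i. d k powr fibre_dim i) = 1"
    unfolding fibre_dim_def by blast+
qed

lemma S_in_F: "i \<in> I \<Longrightarrow> p \<in> F \<Longrightarrow> S i p \<in> F"
  using F_eq by blast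

lemma F_cases: assumes "p \<in> F" obtains i p' where "i \<in> I" "p' \<in> F" "p = S i p'"
  using assms F_eq by blast

lemma F_unit: "F \<subseteq> unit_square"
proof -
  have "fst ` F \<subseteq> {0..1}"
  proof (rule selfsimilar_in_unit_interval)
    show "compact (fst ` F)" using compact_F by (intro compact_continuous_image continuous_intros)
    fix x assume "x \<in> fst ` F"
    then obtain p where p: "p \<in> F" "x = fst p" by blast
    from F_cases[OF p(1)] obtain i p' where ip: "i \<in> I" "p' \<in> F" "p = S i p'" .
    then show "\<exists>y\<in>fst ` F. \<exists>c a. 0 < c \<and> c < 1 \<and> 0 \<le> a \<and> a + c \<le> 1 \<and> x = c * y + a"
      using pos[OF ip(1)] p by (intro bexI[of _ "fst p'"] exI[of _ "c i"] exI[of _ "a i"]) (auto simp: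
          aff_def)
  qed (use F_ne in auto)
  moreover have "snd ` F \<subseteq> {0..1}"
  proof (rule selfsimilar_in_unit_interval)
    show "compact (snd ` F)" using compact_F by (intro compact_continuous_image continuous_intros)
    fix x assume "x \<in> snd ` F"
    then obtain p where p: "p \<in> F" "x = snd p" by blast
    from F_cases[OF p(1)] obtain i p' where ip: "i \<in> I" "p' \<in> F" "p = S i p'" .
    then show "\<exists>y\<in>snd ` F. \<exists>c a. 0 < c \<and> c < 1 \<and> 0 \<le> a \<and> a + c \<le> 1 \<and> x = c * y + a"
      using pos[OF ip(1)] p by (intro bexI[of _ "snd p'"] exI[of _ "d i"] exI[of _ "b i"]) (auto simp:
          aff_def)
  qed (use F_ne in auto)
  ultimately show ?thesis by (metis image_subset_iff mem_Times_iff subsetI)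
qed

lemma F_bounds: "p \<in> F \<Longrightarrow> 0 \<le> fst p \<and> fst p \<le> 1 \<and> 0 \<le> snd p \<and> snd p \<le> 1"
  using F_unit by auto

lemma S_box:
  assumes "i \<in> I" "p \<in> F"
  shows "a i \<le> fst (S i p) \<and> fst (S i p) \<le> a i + c i \<and> b i \<le> snd (S i p) \<and> snd (S i p) \<le> b i + d i"
proof -
  have "0 \<le> c i * fst p" "c i * fst p \<le> c i * 1" "0 \<le> d i * snd p" "d i * snd p \<le> d i * 1"
    using F_bounds[OF assms(2)] pos[OF assms(1)] by (intro mult_nonneg_nonneg mult_left_mono; simp)+
  then show ?thesis by (simp add: aff_def)
qed

lemma proj1_eq: "proj1 ` F = (\<Union>j\<in>reps. aff (c j) 1 (a j) 0 ` proj1 ` F)"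
proof (intro equalityI subsetI)
  fix x assume "x \<in> proj1 ` F"
  then obtain p where p: "p \<in> F" "x = proj1 p" by blast
  from F_cases[OF p(1)] obtain i p' where ip: "i \<in> I" "p' \<in> F" "p = S i p'" .
  then obtain j where j: "j \<in> reps" "col j = col i" using reps(3) by (metis imageE imageI)
  then have "c j = c i" "a j = a i" using same ip reps(1) by blast+
  then have "x = aff (c j) 1 (a j) 0 (proj1 p')" using p ip by (simp add: proj1_def aff_def)
  then show "x \<in> (\<Union>j\<in>reps. aff (c j) 1 (a j) 0 ` proj1 ` F)" using j ip by blast
next
  fix x assume "x \<in> (\<Union>j\<in>reps. aff (c j) 1 (a j) 0 ` proj1 ` F)"
  then obtain j p where "j \<in> reps" "p \<in> F" "x = aff (c j) 1 (a j) 0 (proj1 p)" by blast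
  then have "x = proj1 (S j p)" "S j p \<in> F" using S_in_F reps(1) by (auto simp: proj1_def aff_def)
  then show "x \<in> proj1 ` F" by blast
qed

lemma proj1_unit: "proj1 ` F \<subseteq> unit_square"
  using F_bounds by (auto simp: proj1_def)

lemma packs_proj1:
  assumes "0 < p" "p \<le> 1"
  shows "packs p 1 (proj1 ` F) (smallest powr base_dim * p powr (- base_dim))"
proof -
  have "packs p 1 (proj1 ` F) (smallest powr base_dim * p powr (- base_dim) * 1 powr (- 0))"
  proof (rule packs_selfaffine[where K = reps and c = c and d = "\<lambda>_. 1" and a = a and b = "\<lambda>_. 0"
        and \<rho> = largest and D = "{0<..1} \<times> {1}"])
    fix k l assume "k \<in> reps" "l \<in> reps" "k \<noteq> l"
    then show "a k + c k \<le> a l \<or> a l + c l \<le> a k \<or> 0 + 1 \<le> 0 \<or> 0 + 1 \<le> (0::real)"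
      using diff[of k l] reps by (meson inj_onD subsetD)
  next
    show "(\<Union>k\<in>reps. aff (c k) 1 (a k) 0 ` proj1 ` F) \<subseteq> proj1 ` F" using proj1_eq by blast
    show "1 \<le> (\<Sum>k\<in>reps. c k powr base_dim * 1 powr 0)" using base_dim by simp
    fix p q :: real assume pq: "(p, q) \<in> {0<..1} \<times> {1}"
    show "packs p q (proj1 ` F) (smallest powr base_dim * p powr - base_dim * q powr - 0) \<or>
        (\<forall>k\<in>reps. (p / c k, q / 1) \<in> {0<..1} \<times> {1})"
    proof (cases "smallest \<le> p")
      case True
      have "packs p q (proj1 ` F) 1"
        by (rule packs_one) (use pq F_ne proj1_unit in auto)
      moreover have "smallest powr base_dim * p powr (- base_dim) \<le> 1"
        by (intro powr_quotient_le_1 smallest True base_dim)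
      ultimately show ?thesis
        using packs_weaken[OF _ _ subset_refl] pq by auto
    next
      case False
      have "p / c k \<le> 1 \<and> 0 < p / c k" if "k \<in> reps" for k
        using False smallest(2)[of k] pos[of k] that reps(1) pq by (auto simp: field_simps)
      then show ?thesis using pq by auto
    qed
  qed (use finite_reps pos reps(1) largest assms in auto)
  then show ?thesis by simp
qed

lemma covers_proj1:
  assumes "0 < p" "p \<le> 1"
  shows "covers p 1 (proj1 ` F) (smallest powr (- base_dim) * p powr (- base_dim))"
proof -
  have le1: "smallest \<le> 1" using smallest ne pos by (metis ex_in_conv less_imp_le order_trans)
  have "covers p 1 (proj1 ` F) (smallest powr (- base_dim) * p powr (- base_dim) * 1 powr (- 0))"
  proof (rule covers_selfaffine[where K = reps and c = c and d = "\<lambda>_. 1" and a = a and b = "\<lambda>_. 0"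
        and \<rho> = largest and D = "{0<..1 / smallest} \<times> {1}"])
    show "proj1 ` F \<subseteq> (\<Union>k\<in>reps. aff (c k) 1 (a k) 0 ` proj1 ` F)" using proj1_eq by blast
    show "(\<Sum>k\<in>reps. c k powr base_dim * 1 powr 0) \<le> 1" using base_dim by simp
    fix p q :: real assume pq: "(p, q) \<in> {0<..1 / smallest} \<times> {1}"
    show "covers p q (proj1 ` F) (smallest powr - base_dim * p powr - base_dim * q powr - 0) \<or>
        p * q < 1 \<and> (\<forall>k\<in>reps. (p / c k, q / 1) \<in> {0<..1 / smallest} \<times> {1})"
    proof (cases "1 \<le> p")
      case True
      have "covers p q (proj1 ` F) 1" by (rule covers_one) (use pq True proj1_unit in auto)
      moreover have "1 \<le> smallest powr (- base_dim) * p powr (- base_dim)"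
        using pq smallest(1) by (intro one_le_powr_quotient base_dim) auto
      ultimately show ?thesis
        using covers_weaken[OF _ _ subset_refl order_refl order_refl] pq by auto
    next
      case False
      have "p / c k \<le> 1 / smallest \<and> 0 < p / c k" if "k \<in> reps" for k
        using False smallest(1) smallest(2)[of k] pos[of k] that reps(1) pq by (auto intro!: frac_le)
      then show ?thesis using pq False by auto
    qed
  qed (use finite_reps pos reps(1) largest assms le1 smallest in \<open>auto intro: order_trans\<close>)
  then show ?thesis by simp
qed

lemma bounded_F: "bounded F" using compact_F compact_imp_bounded by blast

lemma bounded_unit: "bounded unit_square" by (simp add: bounded_Times)

lemma has_box_dim_proj1: "has_box_dim (proj1 ` F) base_dim"
proof (rule has_box_dim_packs_covers)
  show "bounded (proj1 ` F)" using bounded_subset[OF bounded_unit proj1_unit] .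
  show "0 < smallest powr base_dim" "0 < smallest powr (- base_dim)" using smallest by auto
  fix p :: real assume p: "0 < p" "p \<le> 1"
  show "packs p p (proj1 ` F) (smallest powr base_dim * p powr (- base_dim))"
    using packs_shrink[OF packs_proj1[OF p]] p by auto
  show "covers p p (proj1 ` F) (smallest powr (- base_dim) * p powr (- base_dim))"
    by (rule covers_flat_snd[OF covers_proj1[OF p], where y = 0]) (use p in \<open>auto simp: proj1_def\<close>)
qed

text \<open>
  The abscissa \<open>a i / (1 - c i)\<close> is that of the fixed point of \<open>S i\<close>.
\<close>
definition vslice :: "'i \<Rightarrow> (real \<times> real) set" where
  "vslice i = F \<inter> {p. fst p = a i / (1 - c i)}"

lemma fixed_point_S: assumes "i \<in> I" shows "fixed_point (S i) = (a i / (1 - c i), b i / (1 - d i))"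
  unfolding fixed_point_def
proof (rule the_equality)
  show "S i (a i / (1 - c i), b i / (1 - d i)) = (a i / (1 - c i), b i / (1 - d i))"
    using pos[OF assms] by (simp add: aff_def field_simps)
  fix p assume "S i p = p"
  then have "c i * fst p + a i = fst p" "d i * snd p + b i = snd p" by (metis aff_def fst_conv snd_conv)+
  then have "fst p = a i / (1 - c i)" "snd p = b i / (1 - d i)" using pos[OF assms]
      by (auto simp: field_simps)
  then show "p = (a i / (1 - c i), b i / (1 - d i))" by (simp add: prod_eq_iff)
qed

lemma slice1_eq_vslice: "i \<in> I \<Longrightarrow> slice1 (S i) F = vslice i"
  by (simp add: slice1_def vslice_def fixed_point_S)

text \<open>The fixed point itself belongs to \<open>F\<close>, by Banach's theorem on the complete set \<open>F\<close>.\<close>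
lemma vslice_ne: assumes i: "i \<in> I" shows "vslice i \<noteq> {}"
proof -
  let ?m = "max (c i) (d i)"
  have m: "0 \<le> ?m" "?m < 1" "c i \<le> ?m" "d i \<le> ?m" using pos[OF i] by auto
  have "\<exists>!x\<in>F. S i x = x"
  proof (rule Banach_fix[where c = ?m])
    show "complete F" using compact_F by (rule compact_imp_complete)
    fix x y
    have "dist (S i x) (S i y) = sqrt ((c i * \<bar>fst x - fst y\<bar>)\<^sup>2 + (d i * \<bar>snd x - snd y\<bar>)\<^sup>2)"
      by (simp add: aff_def dist_Pair_Pair dist_real_def right_diff_distrib[symmetric] power_mult_distrib)
    also have "\<dots> \<le> sqrt ((?m * \<bar>fst x - fst y\<bar>)\<^sup>2 + (?m * \<bar>snd x - snd y\<bar>)\<^sup>2)"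
      using m pos[OF i] by (intro real_sqrt_le_mono add_mono power_mono mult_right_mono) auto
    also have "\<dots> = sqrt (?m\<^sup>2 * ((fst x - fst y)\<^sup>2 + (snd x - snd y)\<^sup>2))"
      by (simp add: power_mult_distrib distrib_left)
    also have "\<dots> = ?m * sqrt ((fst x - fst y)\<^sup>2 + (snd x - snd y)\<^sup>2)"
      using m by (simp only: real_sqrt_mult real_sqrt_abs abs_of_nonneg)
    also have "sqrt ((fst x - fst y)\<^sup>2 + (snd x - snd y)\<^sup>2) = dist x y"
      by (simp add: dist_prod_def dist_real_def)
    finally show "dist (S i x) (S i y) \<le> ?m * dist x y" .
  qed (use m F_ne S_in_F i in auto)
  then obtain x where x: "x \<in> F" "S i x = x" by blast
  then have "c i * fst x + a i = fst x" by (metis aff_def fst_conv)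
  then have "fst x = a i / (1 - c i)" using pos[OF i] by (simp add: field_simps)
  then show ?thesis using x(1) unfolding vslice_def by blast
qed

text \<open>
  The line through the fixed point can touch another column only along a vertical edge shared with
  it. But the abscissa of the fixed point is an end point of its column only if it is 0 or 1, and
  there no other column is adjacent. So the slice is a self-similar set generated by the column of
  \<open>i\<close> alone.
\<close>
lemma vslice_eq: assumes i: "i \<in> I" shows "vslice i = (\<Union>k\<in>column_of i. aff 1 (d k) 0 (b k) ` vslice i)"
proof (intro equalityI subsetI)
  define x where "x = a i / (1 - c i)"
  have vs: "vslice i = F \<inter> {p. fst p = x}" by (simp add: vslice_def x_def)
  have fx: "c i * x + a i = x" using pos[OF i] by (simp add: x_def field_simps)
  fix p assume p: "p \<in> vslice i"
  then have "p \<in> F" by (simp add: vs)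
  from F_cases[OF this] obtain k p' where kp: "k \<in> I" "p' \<in> F" "p = S k p'" .
  have px: "fst p = x" using p by (simp add: vs)
  have xk: "a k \<le> x" "x \<le> a k + c k" using S_box[OF kp(1,2)] px unfolding kp(3) by auto
  obtain e where e: "e \<in> vslice i" using vslice_ne[OF i] by blast
  then have x01: "0 \<le> x" "x \<le> 1" using F_bounds[of e] by (auto simp: vs)
  have "col k = col i"
  proof (rule ccontr)
    assume "col k \<noteq> col i"
    then consider "a k + c k \<le> a i" | "a i + c i \<le> a k" using diff[OF kp(1) i] by blast
    then show False
    proof cases
      case 1
      then have "c i * x \<le> 0" using xk fx by linarith
      then have "x = 0" using pos[OF i] x01 by (simp add: mult_le_0_iff)
      then show False using 1 pos[OF kp(1)] fx by auto
    next
      case 2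
      then have "c i \<le> c i * x" using xk fx by linarith
      then have "x = 1" using pos[OF i] x01 by simp
      then show False using 2 pos[OF kp(1)] fx by auto
    qed
  qed
  then have ck: "c k = c i" "a k = a i" "k \<in> column_of i" using same[OF kp(1) i] kp(1)
      by (auto simp: column_of_def)
  have "c i * fst p' + a i = c i * x + a i" using px kp(3) ck fx by (simp add: aff_def)
  then have "fst p' = x" using pos[OF i] by auto
  then have "p' \<in> vslice i" "p = aff 1 (d k) 0 (b k) p'"
    using kp px by (auto simp: vs aff_def)
  then show "p \<in> (\<Union>k\<in>column_of i. aff 1 (d k) 0 (b k) ` vslice i)" using ck by blast
next
  define x where "x = a i / (1 - c i)"
  have vs: "vslice i = F \<inter> {p. fst p = x}" by (simp add: vslice_def x_def)
  have fx: "c i * x + a i = x" using pos[OF i] by (simp add: x_def field_simps)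
  fix p assume "p \<in> (\<Union>k\<in>column_of i. aff 1 (d k) 0 (b k) ` vslice i)"
  then obtain k p' where k: "k \<in> column_of i" "p' \<in> vslice i" "p = aff 1 (d k) 0 (b k) p'" by blast
  then have kI: "k \<in> I" "c k = c i" "a k = a i" using same[of k i] i by (simp_all add: column_of_def)
  have p': "p' \<in> F" "fst p' = x" using k(2) by (auto simp: vs)
  have "p = S k p'" unfolding k(3) aff_def kI p'(2) fx by simp
  moreover have "fst p = x" using k(3) p' by (simp add: aff_def)
  ultimately show "p \<in> vslice i" using S_in_F[OF kI(1) p'(1)] by (simp add: vs)
qed

lemma vslice_unit: "vslice i \<subseteq> unit_square"
  using F_unit by (auto simp: vslice_def)

lemma packs_vslice:
  assumes i: "i \<in> I" and "0 < q" "q \<le> 1"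
  shows "packs 1 q (vslice i) (smallest powr fibre_dim i * q powr (- fibre_dim i))"
proof -
  have "packs 1 q (vslice i) (smallest powr fibre_dim i * 1 powr (- 0) * q powr (- fibre_dim i))"
  proof (rule packs_selfaffine[where K = "column_of i" and c = "\<lambda>_. 1" and d = d and a = "\<lambda>_. 0" and b = b
        and \<rho> = largest and D = "{1} \<times> {0<..1}"])
    fix k l assume "k \<in> column_of i" "l \<in> column_of i" "k \<noteq> l"
    then show "0 + 1 \<le> 0 \<or> 0 + 1 \<le> (0::real) \<or> b k + d k \<le> b l \<or> b l + d l \<le> b k"
      using rows[of k l] by (auto simp: column_of_def)
  next
    show "(\<Union>k\<in>column_of i. aff 1 (d k) 0 (b k) ` vslice i) \<subseteq> vslice i" using vslice_eq[OF i] by blast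
    show "1 \<le> (\<Sum>k\<in>column_of i. 1 powr 0 * d k powr fibre_dim i)" using fibre_dim[OF i] by simp
    fix p q :: real assume pq: "(p, q) \<in> {1} \<times> {0<..1}"
    show "packs p q (vslice i) (smallest powr fibre_dim i * p powr - 0 * q powr - fibre_dim i) \<or>
        (\<forall>k\<in>column_of i. (p / 1, q / d k) \<in> {1} \<times> {0<..1})"
    proof (cases "smallest \<le> q")
      case True
      have "packs p q (vslice i) 1"
        by (rule packs_one) (use pq vslice_ne[OF i] vslice_unit[of i] in \<open>auto simp: Int_absorb2\<close>)
      moreover have "smallest powr fibre_dim i * q powr (- fibre_dim i) \<le> 1"
        by (intro powr_quotient_le_1 smallest True fibre_dim[OF i])
      ultimately show ?thesis
        using packs_weaken[OF _ _ subset_refl] pq by auto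
    next
      case False
      have "q / d k \<le> 1 \<and> 0 < q / d k" if "k \<in> column_of i" for k
        using False smallest(3)[of k] pos[of k] subsetD[OF column_of(1) that] pq by (auto simp: field_simps)
      then show ?thesis using pq by auto
    qed
  qed (use column_of(1)[of i] column_of(2) pos largest assms in auto)
  then show ?thesis by simp
qed

lemma covers_vslice:
  assumes i: "i \<in> I" and "0 < q" "q \<le> 1"
  shows "covers 1 q (vslice i) (smallest powr (- fibre_dim i) * q powr (- fibre_dim i))"
proof -
  have le1: "smallest \<le> 1" using smallest ne pos by (metis ex_in_conv less_imp_le order_trans)
  have "covers 1 q (vslice i) (smallest powr (- fibre_dim i) * 1 powr (- 0) * q powr (- fibre_dim i))"
  proof (rule covers_selfaffine[where K = "column_of i" and c = "\<lambda>_. 1" and d = d and a = "\<lambda>_. 0" and b = b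
        and \<rho> = largest and D = "{1} \<times> {0<..1 / smallest}"])
    show "vslice i \<subseteq> (\<Union>k\<in>column_of i. aff 1 (d k) 0 (b k) ` vslice i)" using vslice_eq[OF i] by blast
    show "(\<Sum>k\<in>column_of i. 1 powr 0 * d k powr fibre_dim i) \<le> 1" using fibre_dim[OF i] by simp
    fix p q :: real assume pq: "(p, q) \<in> {1} \<times> {0<..1 / smallest}"
    show "covers p q (vslice i) (smallest powr - fibre_dim i * p powr - 0 * q powr - fibre_dim i) \<or>
        p * q < 1 \<and> (\<forall>k\<in>column_of i. (p / 1, q / d k) \<in> {1} \<times> {0<..1 / smallest})"
    proof (cases "1 \<le> q")
      case True
      have "covers p q (vslice i) 1" by (rule covers_one) (use pq True vslice_unit in auto)
      moreover have "1 \<le> smallest powr (- fibre_dim i) * q powr (- fibre_dim i)"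
        using pq smallest(1) by (intro one_le_powr_quotient fibre_dim[OF i]) auto
      ultimately show ?thesis
        using covers_weaken[OF _ _ subset_refl order_refl order_refl] pq by auto
    next
      case False
      have "q / d k \<le> 1 / smallest \<and> 0 < q / d k" if "k \<in> column_of i" for k
        using False smallest(1) smallest(3)[of k] pos[of k] subsetD[OF column_of(1) that] pq
            by (auto intro!: frac_le)
      then show ?thesis using pq False by auto
    qed
  qed (use column_of(1)[of i] column_of(2) pos largest assms le1 smallest in \<open>auto intro: order_trans\<close>)
  then show ?thesis by simp
qed

lemma has_box_dim_vslice: assumes i: "i \<in> I" shows "has_box_dim (vslice i) (fibre_dim i)"
proof (rule has_box_dim_packs_covers)
  show "bounded (vslice i)" using bounded_subset[OF bounded_unit vslice_unit] .
  show "0 < smallest powr fibre_dim i" "0 < smallest powr (- fibre_dim i)" using smallest by auto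
  fix p :: real assume p: "0 < p" "p \<le> 1"
  show "packs p p (vslice i) (smallest powr fibre_dim i * p powr (- fibre_dim i))"
    using packs_shrink[OF packs_vslice[OF i p]] p by auto
  show "covers p p (vslice i) (smallest powr (- fibre_dim i) * p powr (- fibre_dim i))"
    by (rule covers_flat_fst[OF covers_vslice[OF i p], where x = "a i / (1 - c i)"])
      (use p in \<open>auto simp: vslice_def\<close>)
qed

end

section \<open>The lower bound: every ball contains a rich piece\<close>

text \<open>
  A normalised set with as many pieces at every scale as a set of dimension \<open>\<sigma>\<close>, with constant \<open>C\<close>;
  only square boxes are considered, so that the notion is symmetric in the two axes.
\<close>
definition rich :: "real \<Rightarrow> real \<Rightarrow> (real \<times> real) set \<Rightarrow> bool" where
  "rich \<sigma> C T \<longleftrightarrow> T \<subseteq> unit_square \<and> (\<forall>p. 0 < p \<and> p \<le> 1 \<longrightarrow> packs p p T (C * p powr (- \<sigma>)))"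

text \<open>
  The point \<open>x\<close> lies in a piece of \<open>F\<close> of size about \<open>R\<^sub>1 \<times> R\<^sub>2\<close> which is rich once its bounding box
  is normalised to the unit square. The two sizes are kept apart because zooming in by a
  non-conformal map changes their ratio.
\<close>
definition rich_piece :: "(real \<times> real) set \<Rightarrow> real \<Rightarrow> real \<Rightarrow> real \<Rightarrow> real \<Rightarrow> real \<Rightarrow> real \<times> real \<Rightarrow> bool" where
  "rich_piece F \<sigma> C \<epsilon> R\<^sub>1 R\<^sub>2 x \<longleftrightarrow> (\<exists>T c d a b. rich \<sigma> C T \<and> \<epsilon> * R\<^sub>1 \<le> c \<and> c \<le> R\<^sub>1 \<and> \<epsilon> * R\<^sub>2 \<le> d \<and> d \<le> R\<^sub>2 \<and>
     x \<in> aff c d a b ` T \<and> aff c d a b ` T \<subseteq> F)"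

lemma covering_number_pos:
  fixes E :: "(real \<times> real) set"
  assumes "bounded E" "0 < r" "E \<noteq> {}"
  shows "1 \<le> covering_number r E"
proof -
  obtain U where U: "finite U" "card U = covering_number r E" "E \<subseteq> \<Union>U"
    by (rule covering_number_attained[OF assms(1,2)])
  then have "U \<noteq> {}" using assms(3) by auto
  then have "0 < card U" using U(1) by (simp add: card_gt_0_iff)
  then show ?thesis using U(2) by simp
qed

lemma aff_comp: "aff c d a b (aff c' d' a' b' p) = aff (c * c') (d * d') (c * a' + a) (d * b' + b) p"
  by (simp add: aff_def algebra_simps)

text \<open>
  A piece of size at most \<open>R / 2\<close> in both directions lies in the ball. For \<open>r\<close> below the size of the
  piece its packings count; for larger \<open>r\<close> the ratio \<open>R / r\<close> is bounded and one set is enough.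
\<close>
lemma covering_number_rich_piece:
  assumes piece: "rich_piece F \<sigma> C \<epsilon> (R / 2) (R / 2) x" and F: "bounded F"
    and \<sigma>: "0 \<le> \<sigma>" and C: "0 < C" and \<epsilon>: "0 < \<epsilon>" and r: "0 < r" "r < R"
  shows "min (C / 9) 1 * (\<epsilon> / 2) powr \<sigma> * (R / r) powr \<sigma> \<le> real (covering_number r (cball x R \<inter> F))"
proof -
  obtain T c d a b where T: "rich \<sigma> C T" and c: "\<epsilon> * (R / 2) \<le> c" "c \<le> R / 2" and d: "\<epsilon> * (R / 2) \<le> d"
      "d \<le> R / 2"
    and x: "x \<in> aff c d a b ` T" and sub: "aff c d a b ` T \<subseteq> F"
    using piece unfolding rich_piece_def by blast
  have R: "0 < R" using r by simp
  then have "0 < \<epsilon> * (R / 2)" using \<epsilon> by simp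
  then have pos: "0 < c" "0 < d" using c d by linarith+
  have bdd: "bounded (cball x R \<inter> F)" using F by (simp add: bounded_Int)
  have sub': "aff c d a b ` T \<subseteq> cball x R \<inter> F"
  proof
    fix y assume y: "y \<in> aff c d a b ` T"
    obtain u v where uv: "u \<in> T" "v \<in> T" "x = aff c d a b u" "y = aff c d a b v" using x y by blast
    have u: "0 \<le> fst u" "fst u \<le> 1" "0 \<le> snd u" "snd u \<le> 1" "0 \<le> fst v" "fst v \<le> 1" "0 \<le> snd v" "snd v \<le> 1"
      using T uv(1,2) unfolding rich_def by auto
    have "\<bar>fst x - fst y\<bar> = c * \<bar>fst u - fst v\<bar>" "\<bar>snd x - snd y\<bar> = d * \<bar>snd u - snd v\<bar>"
      using pos uv by (simp_all add: aff_def right_diff_distrib[symmetric] abs_mult)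
    moreover have "c * \<bar>fst u - fst v\<bar> \<le> c * 1" "d * \<bar>snd u - snd v\<bar> \<le> d * 1"
      using pos u by (intro mult_left_mono; linarith)+
    ultimately have "dist x y \<le> R" using dist_le_sum[of x y] c d by linarith
    then show "y \<in> cball x R \<inter> F" using y sub by auto
  qed
  have "x \<in> cball x R \<inter> F" using x sub R by auto
  then have one: "1 \<le> real (covering_number r (cball x R \<inter> F))"
    using covering_number_pos[OF bdd r(1)] by fastforce
  show ?thesis
  proof (cases "r \<le> \<epsilon> * (R / 2)")
    case True
    \<comment> \<open>Square boxes of the larger relative size are shrunk to the true relative size of an \<open>r \<times> r\<close> box.\<close>
    define p where "p = max (r / c) (r / d)"
    have rc: "r / c \<le> 2 * r / (\<epsilon> * R)" "r / d \<le> 2 * r / (\<epsilon> * R)"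
      using c(1) d(1) pos r \<epsilon> R by (auto simp: field_simps)
    have p: "0 < p" "p \<le> 1" "p \<le> 2 * r / (\<epsilon> * R)"
      using True c(1) d(1) pos r rc by (auto simp: p_def less_max_iff_disj)
    have "packs p p T (C * p powr (- \<sigma>))" using T p unfolding rich_def by blast
    then have "packs (r / c) (r / d) T (C * p powr (- \<sigma>))"
      by (rule packs_shrink) (use pos r in \<open>auto simp: p_def\<close>)
    then have "C * p powr (- \<sigma>) \<le> 9 * real (covering_number r (cball x R \<inter> F))"
      by (rule covering_number_ge_packs[OF _ pos r(1) sub' bdd])
    moreover have "(\<epsilon> / 2) powr \<sigma> * (R / r) powr \<sigma> \<le> p powr (- \<sigma>)"
    proof -
      have "(\<epsilon> / 2) powr \<sigma> * (R / r) powr \<sigma> = (2 * r / (\<epsilon> * R)) powr (- \<sigma>)"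
        using \<epsilon> R r by (simp add: powr_mult[symmetric] powr_divide powr_minus field_simps)
      also have "\<dots> \<le> p powr (- \<sigma>)" using p \<sigma> by (intro powr_mono2') auto
      finally show ?thesis .
    qed
    moreover have "min (C / 9) 1 * ((\<epsilon> / 2) powr \<sigma> * (R / r) powr \<sigma>) \<le> C / 9 * p powr (- \<sigma>)"
      using calculation(2) C by (intro mult_mono) auto
    ultimately show ?thesis by (simp add: mult.assoc)
  next
    case False
    have "(\<epsilon> / 2) powr \<sigma> * (R / r) powr \<sigma> = (\<epsilon> * (R / 2) / r) powr \<sigma>"
      using \<epsilon> R r by (simp add: powr_mult[symmetric])
    also have "\<dots> \<le> 1" using False \<epsilon> R r \<sigma> by (intro powr_le1) auto
    finally have "min (C / 9) 1 * ((\<epsilon> / 2) powr \<sigma> * (R / r) powr \<sigma>) \<le> 1 * 1"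
      using C by (intro mult_mono) auto
    then show ?thesis using one by (simp add: mult.assoc)
  qed
qed

text \<open>The set of exponents whose supremum is the lower dimension.\<close>
definition lower_exponents :: "(real \<times> real) set \<Rightarrow> real set" where
  "lower_exponents F = {\<alpha>. \<exists>C>0. \<exists>\<rho>>0. \<forall>r R. 0 < r \<and> r < R \<and> R \<le> \<rho> \<longrightarrow>
       real (INF x\<in>F. covering_number r (cball x R \<inter> F)) \<ge> C * (R / r) powr \<alpha>}"

lemma lower_exponentI:
  assumes piece: "\<And>x R. x \<in> F \<Longrightarrow> 0 < R \<Longrightarrow> R \<le> 1 \<Longrightarrow> rich_piece F \<sigma> C \<epsilon> R R x"
    and F: "bounded F" "F \<noteq> {}" and \<sigma>: "0 \<le> \<sigma>" and C: "0 < C" and \<epsilon>: "0 < \<epsilon>"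
  shows "\<sigma> \<in> lower_exponents F"
proof -
  let ?C = "min (C / 9) 1 * (\<epsilon> / 2) powr \<sigma>"
  have "?C > 0" using C \<epsilon> by simp
  moreover have "?C * (R / r) powr \<sigma> \<le> real (INF x\<in>F. covering_number r (cball x R \<inter> F))"
    if r: "0 < r \<and> r < R \<and> R \<le> 1" for r R
  proof -
    have "(INF x\<in>F. covering_number r (cball x R \<inter> F)) \<in> (\<lambda>x. covering_number r (cball x R \<inter> F)) ` F"
      using F(2) by (intro Inf_nat_def1) auto
    then obtain x where x: "x \<in> F" "(INF x\<in>F. covering_number r (cball x R \<inter> F)) =
        covering_number r (cball x R \<inter> F)"
      by blast
    show ?thesis unfolding x(2)
      using covering_number_rich_piece[OF piece[of x "R / 2"] F(1) \<sigma> C \<epsilon>, of r] x(1) r by simp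
  qed
  ultimately show ?thesis unfolding lower_exponents_def
      by (intro CollectI exI[of _ ?C] conjI exI[of _ 1]) auto
qed

context column_system
begin

lemma column_weight:
  assumes "i \<in> I" "t \<le> fibre_dim i"
  shows "1 \<le> (\<Sum>k\<in>column_of i. d k powr t)"
proof -
  have "1 = (\<Sum>k\<in>column_of i. d k powr fibre_dim i)" using fibre_dim[OF assms(1)] by simp
  also have "\<dots> \<le> (\<Sum>k\<in>column_of i. d k powr t)"
  proof (rule sum_mono)
    fix k assume "k \<in> column_of i"
    then have "k \<in> I" using column_of(1) by blast
    then show "d k powr fibre_dim i \<le> d k powr t" using pos[of k] assms(2) by (intro powr_mono') auto
  qed
  finally show ?thesis .
qed

text \<open>
  Summing over a column first: the heights in it contribute a factor of at least one, and what
  remains is the Moran equation of the projection.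
\<close>
lemma total_weight:
  assumes t: "\<And>i. i \<in> I \<Longrightarrow> t \<le> fibre_dim i"
  shows "1 \<le> (\<Sum>i\<in>I. c i powr base_dim * d i powr t)"
proof -
  have I_eq: "I = (\<Union>j\<in>reps. column_of j)"
  proof (intro equalityI subsetI)
    fix i assume i: "i \<in> I"
    then obtain j where "j \<in> reps" "col j = col i" using reps(3) by (metis imageE imageI)
    then show "i \<in> (\<Union>j\<in>reps. column_of j)" using i by (intro UN_I[of j]) (auto simp: column_of_def)
  qed (use column_of(1) in blast)
  have "1 = (\<Sum>j\<in>reps. c j powr base_dim * 1)" using base_dim by simp
  also have "\<dots> \<le> (\<Sum>j\<in>reps. c j powr base_dim * (\<Sum>i\<in>column_of j. d i powr t))"
    using column_weight t reps(1) by (intro sum_mono mult_left_mono) auto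
  also have "\<dots> = (\<Sum>j\<in>reps. \<Sum>i\<in>column_of j. c i powr base_dim * d i powr t)"
    unfolding sum_distrib_left
  proof (intro sum.cong refl)
    fix j i assume "j \<in> reps" "i \<in> column_of j"
    then have "c i = c j" using same[of i j] reps(1) by (auto simp: column_of_def)
    then show "c j powr base_dim * d i powr t = c i powr base_dim * d i powr t" by simp
  qed
  also have "\<dots> = (\<Sum>i\<in>(\<Union>j\<in>reps. column_of j). c i powr base_dim * d i powr t)"
  proof (rule sum.UNION_disjoint[symmetric])
    show "\<forall>j\<in>reps. \<forall>k\<in>reps. j \<noteq> k \<longrightarrow> column_of j \<inter> column_of k = {}"
      using reps(2) by (auto simp: column_of_def inj_on_def)
  qed (use finite_reps column_of(2) in auto)
  finally show ?thesis using I_eq by simp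
qed

lemma fst_in_projection: "fst ` proj1 ` F = fst ` F"
  by (force simp: proj1_def image_iff)

lemma packs_full_height:
  assumes "fst ` F \<subseteq> fst ` E" "E \<subseteq> unit_square" "0 < p" "p \<le> 1" "0 < q" "q \<le> 1"
  shows "packs p q E (smallest powr base_dim * p powr (- base_dim))"
proof -
  have "packs p 1 E (smallest powr base_dim * p powr (- base_dim))"
    using assms by (intro packs_of_projection[OF packs_proj1]) (auto simp only: fst_in_projection)
  then show ?thesis by (rule packs_shrink) (use assms in auto)
qed

text \<open>
  The recursion stops when one side of the boxes is comparable to one. Boxes of full height then see
  the projection, of dimension \<open>base_dim\<close>; boxes of full width see any slice contained in \<open>F\<close>, and
  its dimension is at least \<open>t\<close>. In either case the other factor of the claimed bound is harmless.
\<close>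
lemma packs_F:
  assumes t: "0 \<le> t" "\<And>i. i \<in> I \<Longrightarrow> t \<le> fibre_dim i"
  shows "\<exists>C>0. \<forall>p q. 0 < p \<and> p \<le> 1 \<and> 0 < q \<and> q \<le> 1 \<longrightarrow> packs p q F (C * p powr (- base_dim) * q powr (- t))"
proof -
  obtain i where i: "i \<in> I" using ne by blast
  define A B where "A = smallest powr base_dim" and "B = smallest powr fibre_dim i"
  \<comment> \<open>Small enough to serve at both kinds of stopping scale.\<close>
  define C where "C = min A B * smallest powr base_dim * smallest powr t"
  have AB: "0 < A" "0 < B" using smallest(1) by (auto simp: A_def B_def)
  then have C: "0 < C" using smallest(1) by (simp add: C_def)
  have le1: "smallest powr base_dim \<le> 1" "smallest powr t \<le> 1"
    using smallest i base_dim t pos[OF i] by (force intro!: powr_le1)+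
  have "packs p q F (C * p powr (- base_dim) * q powr (- t))" if "0 < p" "p \<le> 1" "0 < q" "q \<le> 1" for p q
  proof (rule packs_selfaffine[where K = I and c = c and d = d and a = a and b = b and \<rho> = largest and D =
      "{0<..1} \<times> {0<..1}"])
    fix k l assume "k \<in> I" "l \<in> I" "k \<noteq> l"
    then show "a k + c k \<le> a l \<or> a l + c l \<le> a k \<or> b k + d k \<le> b l \<or> b l + d l \<le> b k"
      using diff rows by blast
  next
    fix k assume k: "k \<in> I"
    have "c k * d k \<le> largest * 1" using pos[OF k] largest k by (intro mult_mono) auto
    then show "c k * d k \<le> largest" by simp
  next
    show "(\<Union>k\<in>I. S k ` F) \<subseteq> F" using S_in_F by blast
    show "1 \<le> (\<Sum>i\<in>I. c i powr base_dim * d i powr t)" using total_weight t(2) by blast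
    fix p q :: real assume pq: "(p, q) \<in> {0<..1} \<times> {0<..1}"
    then have pq': "0 < p" "p \<le> 1" "0 < q" "q \<le> 1" by auto
    show "packs p q F (C * p powr - base_dim * q powr - t) \<or> (\<forall>k\<in>I. (p / c k, q / d k) \<in> {0<..1} \<times> {0<..1})"
    proof (cases "smallest \<le> p \<or> smallest \<le> q")
      case True
      then show ?thesis
      proof
        assume q: "smallest \<le> q"
        have "packs p q F (A * p powr (- base_dim))"
          unfolding A_def by (rule packs_full_height) (use F_unit pq' in auto)
        moreover have "C * p powr (- base_dim) * q powr (- t) \<le> A * p powr (- base_dim)"
        proof -
          have "C * q powr (- t) = (min A B * smallest powr base_dim) * (smallest powr t * q powr (- t))"
            by (simp add: C_def)
          also have "\<dots> \<le> (A * 1) * 1"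
            using AB le1 powr_quotient_le_1[OF smallest(1) q t(1)] by (intro mult_mono) auto
          finally show ?thesis using mult_right_mono[of "C * q powr (- t)" A "p powr (- base_dim)"]
            by (simp add: mult_ac)
        qed
        ultimately show ?thesis using packs_weaken[OF _ _ subset_refl] by blast
      next
        assume p: "smallest \<le> p"
        have "packs 1 q (vslice i) (B * q powr (- fibre_dim i))"
          unfolding B_def using packs_vslice[OF i] pq' by blast
        then have "packs 1 q F (B * q powr (- fibre_dim i))"
          by (rule packs_weaken) (auto simp: vslice_def)
        then have "packs p q F (B * q powr (- fibre_dim i))"
          by (rule packs_shrink) (use pq' in auto)
        moreover have "C * p powr (- base_dim) * q powr (- t) \<le> B * q powr (- fibre_dim i)"
        proof -
          have "C * p powr (- base_dim) =
              (min A B * smallest powr t) * (smallest powr base_dim * p powr (- base_dim))"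
            by (simp add: C_def)
          also have "\<dots> \<le> (B * 1) * 1"
            using AB le1 powr_quotient_le_1[OF smallest(1) p base_dim(1)] by (intro mult_mono) auto
          finally have "C * p powr (- base_dim) * q powr (- t) \<le> B * q powr (- t)"
            by (intro mult_right_mono) auto
          also have "\<dots> \<le> B * q powr (- fibre_dim i)"
            using AB t(2)[OF i] pq' by (intro mult_left_mono powr_mono') auto
          finally show ?thesis .
        qed
        ultimately show ?thesis using packs_weaken[OF _ _ subset_refl] by blast
      qed
    next
      case False
      have "p / c k \<le> 1 \<and> 0 < p / c k \<and> q / d k \<le> 1 \<and> 0 < q / d k" if k: "k \<in> I" for k
        using False smallest(2,3)[OF k] pos[OF k] pq' by auto
      then show ?thesis by auto
    qed
  qed (use fin pos largest C that in auto)
  then show ?thesis using C by blast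
qed

text \<open>
  The part of \<open>F\<close> over the cylinder of the projection given by the columns of \<open>ks\<close>, stretched
  horizontally to the unit width. The choice of the row is free at every step, and the vertical
  coordinate is not rescaled.
\<close>
primrec strip :: "'i list \<Rightarrow> (real \<times> real) set" where
  "strip [] = F"
| "strip (k # ks) = (\<Union>i\<in>column_of k. aff 1 (d i) 0 (b i) ` strip ks)"

lemma strip_unit: "strip ks \<subseteq> unit_square"
proof (induction ks)
  case (Cons k ks)
  show ?case
  proof
    fix p assume "p \<in> strip (k # ks)"
    then obtain i p' where ip: "i \<in> I" "p' \<in> strip ks" "p = aff 1 (d i) 0 (b i) p'"
      using column_of(1)[of k] by (fastforce simp del: split_paired_All)
    then have p': "0 \<le> fst p'" "fst p' \<le> 1" "0 \<le> snd p'" "snd p' \<le> 1" using Cons.IH by auto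
    have "d i * snd p' \<le> d i * 1" using p' pos[OF ip(1)] by (intro mult_left_mono) auto
    then have "d i * snd p' + b i \<le> 1" using pos[OF ip(1)] by linarith
    then show "p \<in> unit_square" using p' pos[OF ip(1)] ip(3) by (simp add: aff_def)
  qed
qed (use F_unit in simp)

lemma fst_strip: "set ks \<subseteq> I \<Longrightarrow> fst ` strip ks = fst ` F"
proof (induction ks)
  case (Cons k ks)
  then have "k \<in> column_of k" using column_of(3) by simp
  moreover have "fst ` aff 1 x 0 y ` T = fst ` T" for x y T by (force simp: aff_def image_iff)
  ultimately have "fst ` strip (k # ks) = fst ` strip ks" by (auto simp: image_UN)
  then show ?case using Cons by simp
qed simp

text \<open>
  Prescribing a column costs nothing: the heights in every column satisfy \<open>\<Sum> d\<^sub>i\<^sup>t \<ge> 1\<close>, so passing to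
  a longer strip preserves the bound with the same constant, until boxes have essentially full
  height.
\<close>
lemma packs_strip:
  assumes t: "0 \<le> t" "\<And>i. i \<in> I \<Longrightarrow> t \<le> fibre_dim i"
  shows "\<exists>C>0. \<forall>ks p q. set ks \<subseteq> I \<and> 0 < p \<and> p \<le> 1 \<and> 0 < q \<and> q \<le> 1 \<longrightarrow>
     packs p q (strip ks) (C * p powr (- base_dim) * q powr (- t))"
proof -
  obtain C0 where C0: "C0 > 0" "\<And>p q. 0 < p \<Longrightarrow> p \<le> 1 \<Longrightarrow> 0 < q \<Longrightarrow> q \<le> 1 \<Longrightarrow>
      packs p q F (C0 * p powr (- base_dim) * q powr (- t))" using packs_F[OF t] by blast
  define C where "C = min C0 (smallest powr base_dim * smallest powr t)"
  have C: "0 < C" using C0 smallest(1) by (simp add: C_def)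
  have "packs p q (strip ks) (C * p powr (- base_dim) * q powr (- t))"
    if "set ks \<subseteq> I" "0 < p" "p \<le> 1" "0 < q" "q \<le> 1" for ks p q
    using that
  proof (induction ks arbitrary: q)
    case Nil
    have "C * p powr (- base_dim) * q powr (- t) \<le> C0 * p powr (- base_dim) * q powr (- t)"
      by (intro mult_right_mono) (auto simp: C_def)
    then show ?case using packs_weaken[OF C0(2)] Nil by auto
  next
    case (Cons k ks)
    have k: "k \<in> I" using Cons.prems by simp
    show ?case
    proof (cases "smallest \<le> q")
      case True
      have "packs p q (strip (k # ks)) (smallest powr base_dim * p powr (- base_dim))"
        using fst_strip[OF Cons.prems(1)] strip_unit[of "k # ks"] Cons.prems(2-5)
            by (intro packs_full_height) simp_all
      moreover have "C * p powr (- base_dim) * q powr (- t) \<le> smallest powr base_dim * p powr (- base_dim)"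
      proof -
        have "C * q powr (- t) \<le> smallest powr base_dim * smallest powr t * q powr (- t)"
          by (intro mult_right_mono) (auto simp: C_def)
        also have "\<dots> = smallest powr base_dim * (smallest powr t * q powr (- t))" by simp
        also have "\<dots> \<le> smallest powr base_dim * 1"
          using powr_quotient_le_1[OF smallest(1) True t(1)] by (intro mult_left_mono) auto
        finally show ?thesis using mult_right_mono[of "C * q powr (- t)" "smallest powr base_dim"
            "p powr (- base_dim)"]
          by (simp add: mult_ac)
      qed
      ultimately show ?thesis using packs_weaken[OF _ _ subset_refl] by blast
    next
      case False
      have "packs p q (\<Union>i\<in>column_of k. aff 1 (d i) 0 (b i) ` strip ks)
         (\<Sum>i\<in>column_of k. C * p powr (- base_dim) * (q / d i) powr (- t))"
      proof (rule packs_union)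
        fix i l assume "i \<in> column_of k" "l \<in> column_of k" "i \<noteq> l"
        then show "0 + 1 \<le> (0::real) \<or> 0 + 1 \<le> (0::real) \<or> b i + d i \<le> b l \<or> b l + d l \<le> b i"
          using rows[of i l] by (auto simp: column_of_def)
      next
        fix i assume "i \<in> column_of k"
        then have i: "i \<in> I" using column_of(1) by blast
        show "0 < (1::real) \<and> 0 < d i \<and> 0 \<le> (0::real) \<and> 0 + 1 \<le> (1::real) \<and> 0 \<le> b i \<and> b i + d i \<le> 1"
          using pos[OF i] by simp
        show "packs (p / 1) (q / d i) (strip ks) (C * p powr (- base_dim) * (q / d i) powr (- t))"
          using Cons.IH[of "q / d i"] Cons.prems pos[OF i] False smallest(3)[OF i] by auto
      qed (use column_of(2) Cons.prems in auto)
      moreover have "C * p powr (- base_dim) * q powr (- t) \<le>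
          (\<Sum>i\<in>column_of k. C * p powr (- base_dim) * (q / d i) powr (- t))"
      proof -
        have "C * p powr (- base_dim) * q powr (- t) * 1 \<le>
            C * p powr (- base_dim) * q powr (- t) * (\<Sum>i\<in>column_of k. d i powr t)"
          using column_weight[OF k t(2)[OF k]] C by (intro mult_left_mono) auto
        also have "\<dots> = (\<Sum>i\<in>column_of k. C * p powr (- base_dim) * (q / d i) powr (- t))"
          unfolding sum_distrib_left
        proof (rule sum.cong[OF refl])
          fix i assume "i \<in> column_of k"
          then have "i \<in> I" using column_of(1) by blast
          then show "C * p powr (- base_dim) * q powr (- t) * d i powr t =
              C * p powr (- base_dim) * (q / d i) powr (- t)"
            using powr_scale[of q "d i" t] pos[of i] Cons.prems by simp
        qed
        finally show ?thesis by simp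
      qed
      ultimately show ?thesis using packs_weaken[OF _ _ subset_refl] by auto
    qed
  qed
  then show ?thesis using C by blast
qed

text \<open>
  Follow the columns along a coding of \<open>x\<close> until the product of their widths is comparable to \<open>\<theta>\<close>.
  The admissible range of \<open>\<theta>\<close> extends beyond 1 because one step divides by a width and may
  overshoot.
\<close>
lemma strip_at:
  assumes "x \<in> F" "0 < \<theta>" "\<theta> \<le> 1 / smallest"
  shows "\<exists>ks w u. set ks \<subseteq> I \<and> smallest * \<theta> \<le> w \<and> w \<le> \<theta> \<and> x \<in> aff w 1 u 0 ` strip ks \<and>
      aff w 1 u 0 ` strip ks \<subseteq> F"
proof -
  have base: "\<exists>ks w u. set ks \<subseteq> I \<and> smallest * \<theta> \<le> w \<and> w \<le> \<theta> \<and> x \<in> aff w 1 u 0 ` strip ks \<and>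
      aff w 1 u 0 ` strip ks \<subseteq> F"
    if "x \<in> F" "1 \<le> \<theta>" "\<theta> \<le> 1 / smallest" for x \<theta>
  proof -
    have "aff 1 1 0 0 = id" by (auto simp: aff_def)
    then show ?thesis using that smallest(1)
      by (intro exI[of _ "[]"] exI[of _ 1] exI[of _ 0]) (auto simp: field_simps)
  qed
  have main: "\<exists>ks w u. set ks \<subseteq> I \<and> smallest * \<theta> \<le> w \<and> w \<le> \<theta> \<and> x \<in> aff w 1 u 0 ` strip ks \<and>
      aff w 1 u 0 ` strip ks \<subseteq> F"
    if "largest ^ n \<le> \<theta>" "x \<in> F" "0 < \<theta>" "\<theta> \<le> 1 / smallest" for n x \<theta>
    using that
  proof (induction n arbitrary: x \<theta>)
    case 0
    then show ?case using base by simp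
  next
    case (Suc n)
    show ?case
    proof (cases "1 \<le> \<theta>")
      case True
      then show ?thesis using base Suc.prems by blast
    next
      case False
      from F_cases[OF Suc.prems(2)] obtain i x' where ix: "i \<in> I" "x' \<in> F" "x = S i x'" .
      have ci: "0 < c i" "c i \<le> largest" "smallest \<le> c i" using pos[OF ix(1)] largest smallest ix(1) by auto
      have "largest ^ n * c i \<le> largest ^ n * largest" using ci largest(1) by (intro mult_left_mono) auto
      then have "largest ^ n * c i \<le> \<theta>" using Suc.prems(1) by (simp add: mult.commute)
      then have "largest ^ n \<le> \<theta> / c i" using ci by (simp add: field_simps)
      moreover have "\<theta> / c i \<le> 1 / smallest" using False ci smallest(1) by (intro frac_le) auto
      ultimately obtain ks w u where IH: "set ks \<subseteq> I" "smallest * (\<theta> / c i) \<le> w" "w \<le> \<theta> / c i"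
        "x' \<in> aff w 1 u 0 ` strip ks" "aff w 1 u 0 ` strip ks \<subseteq> F"
        using Suc.IH[OF _ ix(2)] Suc.prems(3) ci by (metis divide_pos_pos)
      have comp: "aff (c i * w) 1 (c i * u + a i) 0 (aff 1 (d k) 0 (b k) p) = S k (aff w 1 u 0 p)"
          if "k \<in> column_of i" for k p
      proof -
        have "c k = c i" "a k = a i" using same[of k i] that ix(1) by (auto simp: column_of_def)
        then show ?thesis by (simp add: aff_comp)
      qed
      show ?thesis
      proof (rule exI[of _ "i # ks"], rule exI[of _ "c i * w"], rule exI[of _ "c i * u + a i"], intro conjI)
        show "set (i # ks) \<subseteq> I" using IH ix by simp
        show "smallest * \<theta> \<le> c i * w" "c i * w \<le> \<theta>" using IH(2,3) ci by (auto simp: field_simps)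
        obtain p where p: "p \<in> strip ks" "x' = aff w 1 u 0 p" using IH(4) by blast
        then have "x = aff (c i * w) 1 (c i * u + a i) 0 (aff 1 (d i) 0 (b i) p)"
          using comp[OF column_of(3)[OF ix(1)]] ix(3) by simp
        moreover have "aff 1 (d i) 0 (b i) p \<in> strip (i # ks)" using p(1) column_of(3)[OF ix(1)] by auto
        ultimately show "x \<in> aff (c i * w) 1 (c i * u + a i) 0 ` strip (i # ks)" by blast
        show "aff (c i * w) 1 (c i * u + a i) 0 ` strip (i # ks) \<subseteq> F"
        proof
          fix y assume "y \<in> aff (c i * w) 1 (c i * u + a i) 0 ` strip (i # ks)"
          then obtain k p where kp: "k \<in> column_of i" "p \<in> strip ks"
            "y = aff (c i * w) 1 (c i * u + a i) 0 (aff 1 (d k) 0 (b k) p)" by auto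
          then have "y = S k (aff w 1 u 0 p)" using comp by simp
          moreover have "aff w 1 u 0 p \<in> F" "k \<in> I" using IH(5) kp column_of(1) by blast+
          ultimately show "y \<in> F" using S_in_F by simp
        qed
      qed
    qed
  qed
  obtain n where "largest ^ n < \<theta>" using real_arch_pow_inv[of \<theta> largest] assms(2) largest by blast
  then show ?thesis using main[of n] assms by auto
qed

text \<open>
  If the height \<open>R\<^sub>2\<close> is comparable to 1, a strip of width about \<open>R\<^sub>1\<close> is a rich piece.
\<close>
lemma rich_strip_piece:
  assumes t: "0 \<le> t" "\<And>i. i \<in> I \<Longrightarrow> t \<le> fibre_dim i"
  shows "\<exists>C>0. \<forall>x R\<^sub>1 R\<^sub>2. x \<in> F \<and> 0 < R\<^sub>1 \<and> R\<^sub>1 \<le> 1 / smallest \<and> 1 \<le> R\<^sub>2 \<and> R\<^sub>2 \<le> 1 / smallest \<longrightarrow>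
     rich_piece F (base_dim + t) C smallest R\<^sub>1 R\<^sub>2 x"
proof -
  obtain C where C: "C > 0" "\<And>ks p q. set ks \<subseteq> I \<Longrightarrow> 0 < p \<Longrightarrow> p \<le> 1 \<Longrightarrow> 0 < q \<Longrightarrow> q \<le> 1 \<Longrightarrow>
     packs p q (strip ks) (C * p powr (- base_dim) * q powr (- t))" using packs_strip[OF t] by blast
  have rich: "rich (base_dim + t) C (strip ks)" if "set ks \<subseteq> I" for ks
    unfolding rich_def
  proof (intro conjI allI impI strip_unit)
    fix p :: real assume p: "0 < p \<and> p \<le> 1"
    have "p powr (- (base_dim + t)) = p powr (- base_dim) * p powr (- t)"
      by (simp add: powr_add[symmetric])
    then show "packs p p (strip ks) (C * p powr (- (base_dim + t)))"
      using C(2)[OF that, of p p] p by (simp add: mult.assoc)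
  qed
  have "rich_piece F (base_dim + t) C smallest R\<^sub>1 R\<^sub>2 x"
    if asm: "x \<in> F" "0 < R\<^sub>1" "R\<^sub>1 \<le> 1 / smallest" "1 \<le> R\<^sub>2" "R\<^sub>2 \<le> 1 / smallest" for x R\<^sub>1 R\<^sub>2
  proof -
    obtain ks w u where "set ks \<subseteq> I" "smallest * R\<^sub>1 \<le> w" "w \<le> R\<^sub>1" "x \<in> aff w 1 u 0 ` strip ks"
        "aff w 1 u 0 ` strip ks \<subseteq> F"
      using strip_at[OF asm(1,2,3)] by blast
    moreover have "smallest * R\<^sub>2 \<le> 1" using asm(5) smallest(1) by (simp add: field_simps)
    ultimately show ?thesis unfolding rich_piece_def using rich asm(4) by blast
  qed
  then show ?thesis using C(1) by blast
qed

lemma rich_piece_image: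
  assumes i: "i \<in> I" and P: "rich_piece F \<sigma> C \<epsilon> (R\<^sub>1 / c i) (R\<^sub>2 / d i) x"
  shows "rich_piece F \<sigma> C \<epsilon> R\<^sub>1 R\<^sub>2 (S i x)"
proof -
  have ci: "0 < c i" "0 < d i" using pos[OF i] by auto
  obtain T w h u v where T: "rich \<sigma> C T" "\<epsilon> * (R\<^sub>1 / c i) \<le> w" "w \<le> R\<^sub>1 / c i" "\<epsilon> * (R\<^sub>2 / d i) \<le> h"
      "h \<le> R\<^sub>2 / d i"
    "x \<in> aff w h u v ` T" "aff w h u v ` T \<subseteq> F"
    using P unfolding rich_piece_def by blast
  have im: "aff (c i * w) (d i * h) (c i * u + a i) (d i * v + b i) ` T = S i ` aff w h u v ` T"
    by (simp add: image_image aff_comp)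
  have "\<epsilon> * R\<^sub>1 \<le> c i * w" "c i * w \<le> R\<^sub>1" "\<epsilon> * R\<^sub>2 \<le> d i * h" "d i * h \<le> R\<^sub>2"
    using T(2-5) ci by (auto simp: field_simps)
  moreover have "S i x \<in> S i ` aff w h u v ` T" "S i ` aff w h u v ` T \<subseteq> F"
      using T(6,7) S_in_F[OF i] by blast+
  ultimately show ?thesis unfolding rich_piece_def using T(1) im by metis
qed

text \<open>
  Starting from a square, zoom in along a coding of \<open>x\<close> until one of the relative sizes reaches 1.
  The relation \<open>D\<close> is an invariant of the two sizes, used to keep track of which of them is the
  larger one.
\<close>
lemma rich_piece_descend:
  assumes base: "\<And>x R\<^sub>1 R\<^sub>2. x \<in> F \<Longrightarrow> D R\<^sub>1 R\<^sub>2 \<Longrightarrow> 0 < R\<^sub>1 \<Longrightarrow> R\<^sub>1 \<le> 1 / smallest \<Longrightarrow> 0 < R\<^sub>2 \<Longrightarrow> R\<^sub>2 \<le> 1 / smallest \<Longrightarrow>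
        1 \<le> R\<^sub>1 \<or> 1 \<le> R\<^sub>2 \<Longrightarrow> rich_piece F \<sigma> C smallest R\<^sub>1 R\<^sub>2 x"
    and D: "\<And>i R\<^sub>1 R\<^sub>2. i \<in> I \<Longrightarrow> D R\<^sub>1 R\<^sub>2 \<Longrightarrow> 0 < R\<^sub>1 \<Longrightarrow> 0 < R\<^sub>2 \<Longrightarrow> D (R\<^sub>1 / c i) (R\<^sub>2 / d i)"
    and x: "x \<in> F" and R: "D R R" "0 < R" "R \<le> 1"
  shows "rich_piece F \<sigma> C smallest R R x"
proof -
  have main: "rich_piece F \<sigma> C smallest R\<^sub>1 R\<^sub>2 x"
    if "largest ^ n \<le> R\<^sub>1" "x \<in> F" "D R\<^sub>1 R\<^sub>2" "0 < R\<^sub>1" "R\<^sub>1 \<le> 1 / smallest" "0 < R\<^sub>2"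
        "R\<^sub>2 \<le> 1 / smallest" for n x R\<^sub>1 R\<^sub>2
    using that
  proof (induction n arbitrary: x R\<^sub>1 R\<^sub>2)
    case 0
    then show ?case using base by simp
  next
    case (Suc n)
    show ?case
    proof (cases "1 \<le> R\<^sub>1 \<or> 1 \<le> R\<^sub>2")
      case True
      then show ?thesis using base Suc.prems by blast
    next
      case False
      from F_cases[OF Suc.prems(2)] obtain i x' where ix: "i \<in> I" "x' \<in> F" "x = S i x'" .
      have ci: "0 < c i" "c i \<le> largest" "smallest \<le> c i" "0 < d i" "smallest \<le> d i"
        using pos[OF ix(1)] largest smallest ix(1) by auto
      have "largest ^ n * c i \<le> largest ^ n * largest" using ci largest(1) by (intro mult_left_mono) auto
      then have "largest ^ n * c i \<le> R\<^sub>1" using Suc.prems(1) by (simp add: mult.commute)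
      then have "largest ^ n \<le> R\<^sub>1 / c i" using ci by (simp add: field_simps)
      moreover have "R\<^sub>1 / c i \<le> 1 / smallest" "R\<^sub>2 / d i \<le> 1 / smallest"
        using False ci smallest(1) by (auto intro!: frac_le)
      ultimately have "rich_piece F \<sigma> C smallest (R\<^sub>1 / c i) (R\<^sub>2 / d i) x'"
        using Suc.IH ix(1,2) D Suc.prems ci by auto
      then show ?thesis using rich_piece_image[OF ix(1)] ix(3) by simp
    qed
  qed
  obtain i where i: "i \<in> I" using ne by blast
  have "smallest \<le> 1" using smallest(2)[OF i] pos[OF i] by linarith
  then have "1 \<le> 1 / smallest" using smallest(1) by simp
  then have "R \<le> 1 / smallest" using R(3) by linarith
  moreover obtain n where "largest ^ n < R" using real_arch_pow_inv[of R largest] R(2) largest by blast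
  ultimately show ?thesis using main[of n] x R by auto
qed

text \<open>
  If no rectangle is higher than wide, the relative height stays at least the relative width, so it
  is the one that reaches 1 first and columns alone suffice.
\<close>
lemma lower_exponent_horizontal:
  assumes t: "0 \<le> t" "\<And>i. i \<in> I \<Longrightarrow> t \<le> fibre_dim i" and hor: "\<And>i. i \<in> I \<Longrightarrow> d i \<le> c i"
  shows "base_dim + t \<in> lower_exponents F"
proof -
  obtain C where C: "C > 0" and piece: "\<And>x R\<^sub>1 R\<^sub>2. x \<in> F \<Longrightarrow> 0 < R\<^sub>1 \<Longrightarrow> R\<^sub>1 \<le> 1 / smallest \<Longrightarrow> 1 \<le> R\<^sub>2 \<Longrightarrow>
      R\<^sub>2 \<le> 1 / smallest \<Longrightarrow>
     rich_piece F (base_dim + t) C smallest R\<^sub>1 R\<^sub>2 x" using rich_strip_piece[OF t] by blast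
  show ?thesis
  proof (rule lower_exponentI[OF _ bounded_F F_ne _ C smallest(1)])
    fix x R assume "x \<in> F" "0 < R" "R \<le> (1::real)"
    then show "rich_piece F (base_dim + t) C smallest R R x"
      by (intro rich_piece_descend[where D = "\<lambda>R\<^sub>1 R\<^sub>2. R\<^sub>1 \<le> R\<^sub>2"] piece) (use hor pos in \<open>auto intro!: frac_le\<close>)
  qed (use base_dim t in auto)
qed

end

lemma covers_nonneg: "covers p q E z \<Longrightarrow> 0 \<le> z"
  unfolding covers_def by (metis of_nat_0_le_iff order_trans)

section \<open>The upper bound: balls that meet a thin strip only\<close>

text \<open>
  Sparse balls only have to be found along one sequence of scales: it suffices that the radii tend
  to 0 and that the ratios \<open>R / r = \<kappa> / \<tau>\<^sup>n\<close> are unbounded.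
\<close>
lemma lower_exponent_le:
  assumes \<alpha>: "\<alpha> \<in> lower_exponents F" and \<theta>: "0 < \<theta>" "\<theta> < 1" and \<tau>: "0 < \<tau>" "\<tau> < 1"
    and \<kappa>: "0 < \<kappa>" and K: "0 < K"
    and thin: "\<And>n. \<exists>x\<in>F. \<exists>R. 0 < R \<and> R \<le> \<theta> ^ n \<and>
        real (covering_number (R * \<tau> ^ n / \<kappa>) (cball x R \<inter> F)) \<le> K * (\<tau> ^ n) powr (- \<sigma>)"
  shows "\<alpha> \<le> \<sigma>"
proof (rule ccontr)
  assume "\<not> \<alpha> \<le> \<sigma>"
  then have gt: "\<sigma> - \<alpha> < 0" by simp
  obtain C \<rho> where C: "0 < C" "0 < \<rho>" and low: "\<And>r R. 0 < r \<Longrightarrow> r < R \<Longrightarrow> R \<le> \<rho> \<Longrightarrow>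
      C * (R / r) powr \<alpha> \<le> real (INF x\<in>F. covering_number r (cball x R \<inter> F))"
    using \<alpha> unfolding lower_exponents_def by blast
  \<comment> \<open>Comparing the two estimates bounds the powers of a number greater than 1.\<close>
  define M where "M = K / (C * \<kappa> powr \<alpha>)"
  have bound: "(\<tau> powr (\<sigma> - \<alpha>)) ^ n \<le> M" if n: "\<theta> ^ n < \<rho>" "\<tau> ^ n < \<kappa>" for n
  proof -
    have l: "0 < \<tau> ^ n" using \<tau> by simp
    obtain x R where x: "x \<in> F" "0 < R" "R \<le> \<theta> ^ n"
      and N: "real (covering_number (R * \<tau> ^ n / \<kappa>) (cball x R \<inter> F)) \<le> K * (\<tau> ^ n) powr (- \<sigma>)"
      using thin by blast
    let ?r = "R * \<tau> ^ n / \<kappa>"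
    have r: "0 < ?r" "?r < R" "R \<le> \<rho>" using x n l \<kappa> by (auto simp: field_simps)
    have "(INF x\<in>F. covering_number ?r (cball x R \<inter> F)) \<le> covering_number ?r (cball x R \<inter> F)"
      by (rule cINF_lower[OF bdd_below_bot x(1)])
    then have "C * (R / ?r) powr \<alpha> \<le> K * (\<tau> ^ n) powr (- \<sigma>)"
      using low[OF r] N by linarith
    moreover have "R / ?r = \<kappa> / \<tau> ^ n" using x l \<kappa> by (simp add: field_simps)
    moreover have "(\<kappa> / \<tau> ^ n) powr \<alpha> = \<kappa> powr \<alpha> * (\<tau> ^ n) powr (- \<alpha>)"
      using \<kappa> l by (simp add: powr_divide powr_minus field_simps)
    ultimately have "(C * \<kappa> powr \<alpha>) * (\<tau> ^ n) powr (- \<alpha>) \<le> K * (\<tau> ^ n) powr (- \<sigma>)" by (simp add: mult.assoc)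
    then have "(C * \<kappa> powr \<alpha>) * (\<tau> ^ n) powr (- \<alpha>) * (\<tau> ^ n) powr \<sigma> \<le> K * (\<tau> ^ n) powr (- \<sigma>) * (\<tau> ^ n) powr \<sigma>"
      by (intro mult_right_mono) auto
    moreover have "(\<tau> ^ n) powr (- \<alpha>) * (\<tau> ^ n) powr \<sigma> = (\<tau> ^ n) powr (\<sigma> - \<alpha>)"
      "(\<tau> ^ n) powr (- \<sigma>) * (\<tau> ^ n) powr \<sigma> = 1"
      using l \<tau> by (simp_all add: powr_add[symmetric])
    ultimately have "(C * \<kappa> powr \<alpha>) * (\<tau> ^ n) powr (\<sigma> - \<alpha>) \<le> K" by (simp add: mult.assoc)
    then have "(\<tau> ^ n) powr (\<sigma> - \<alpha>) \<le> M"
      using C \<kappa> by (simp add: M_def field_simps)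
    moreover have "(\<tau> ^ n) powr (\<sigma> - \<alpha>) = (\<tau> powr (\<sigma> - \<alpha>)) ^ n"
      using \<tau> by (simp add: powr_powr powr_realpow[symmetric] mult.commute)
    ultimately show ?thesis by simp
  qed
  have eventually_power_gt: "eventually (\<lambda>n. M < x ^ n) sequentially" if x: "1 < x" for x :: real
  proof -
    obtain N where N: "M < x ^ N" using real_arch_pow[OF x] by blast
    have "M < x ^ n" if "N \<le> n" for n
      using N power_increasing[OF that, of x] x by linarith
    then show ?thesis unfolding eventually_sequentially by blast
  qed
  have "1 < \<tau> powr (\<sigma> - \<alpha>)"
    using powr_less_mono'[of \<tau> "\<sigma> - \<alpha>" 0] \<tau> gt by simp
  then have "eventually (\<lambda>n. M < (\<tau> powr (\<sigma> - \<alpha>)) ^ n) sequentially"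
    by (simp add: eventually_power_gt)
  moreover have "eventually (\<lambda>n. \<theta> ^ n < \<rho>) sequentially"
    using LIMSEQ_realpow_zero[of \<theta>] \<theta> C(2) by (intro order_tendstoD(2)) auto
  moreover have "eventually (\<lambda>n. \<tau> ^ n < \<kappa>) sequentially"
    using LIMSEQ_realpow_zero[of \<tau>] \<tau> \<kappa> by (intro order_tendstoD(2)) auto
  ultimately have "eventually (\<lambda>n. False) sequentially"
    by eventually_elim (use bound in force)
  then show False by simp
qed

context column_system
begin

definition width :: "'i list \<Rightarrow> real" where "width ks = prod_list (map c ks)"
definition height :: "'i list \<Rightarrow> real" where "height ks = prod_list (map d ks)"

primrec left :: "'i list \<Rightarrow> real" where
  "left [] = 0" | "left (k # ks) = c k * left ks + a k"
primrec bottom :: "'i list \<Rightarrow> real" where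
  "bottom [] = 0" | "bottom (k # ks) = d k * bottom ks + b k"

definition word :: "'i list \<Rightarrow> real \<times> real \<Rightarrow> real \<times> real" where
  "word ks = aff (width ks) (height ks) (left ks) (bottom ks)"

lemma word_Nil: "word [] p = p" by (simp add: word_def width_def height_def aff_def)

lemma word_Cons: "word (k # ks) p = S k (word ks p)"
  by (simp add: word_def width_def height_def aff_comp)

lemma width_pos: "set ks \<subseteq> I \<Longrightarrow> 0 < width ks" and height_pos: "set ks \<subseteq> I \<Longrightarrow> 0 < height ks"
  by (induction ks) (auto simp: width_def height_def pos)

lemma word_in_F: "set ks \<subseteq> I \<Longrightarrow> p \<in> F \<Longrightarrow> word ks p \<in> F"
  by (induction ks) (auto simp: word_Nil word_Cons intro: S_in_F)

text \<open>
  Abscissae and ordinates at which a cylinder cannot be touched by a neighbouring one. Usually this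
  is the open unit interval. With a single column there are no horizontal neighbours, and with at
  most one rectangle per column there are no vertical ones; then every position is allowed. This
  matters since in these cases \<open>F\<close> may lie entirely in one side of the unit square.
\<close>
definition inner_x :: "real set" where
  "inner_x = (if \<forall>i\<in>I. \<forall>k\<in>I. col i = col k then UNIV else {0<..<1})"
definition inner_y :: "real set" where
  "inner_y = (if inj_on col I then UNIV else {0<..<1})"

lemma inner_x_eq: "\<not> (\<forall>i\<in>I. \<forall>k\<in>I. col i = col k) \<Longrightarrow> inner_x = {0<..<1}"
  unfolding inner_x_def by (rule if_not_P)

lemma inner_x_eq_UNIV: "\<forall>i\<in>I. \<forall>k\<in>I. col i = col k \<Longrightarrow> inner_x = UNIV"
  unfolding inner_x_def by (rule if_P)

lemma inner_y_eq: "\<not> inj_on col I \<Longrightarrow> inner_y = {0<..<1}"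
  unfolding inner_y_def by (rule if_not_P)

lemma inner_y_eq_UNIV: "inj_on col I \<Longrightarrow> inner_y = UNIV"
  unfolding inner_y_def by (rule if_P)

lemma inner_x_step: assumes "i \<in> I" "x \<in> inner_x" shows "c i * x + a i \<in> inner_x"
proof (cases "\<forall>i\<in>I. \<forall>k\<in>I. col i = col k")
  case False
  then have "inner_x = {0<..<1}" by (rule inner_x_eq)
  then have "0 < x" "x < 1" using assms(2) by simp_all
  then have "0 < c i * x" "c i * x < c i * 1" using pos[OF assms(1)] by auto
  then have "0 < c i * x + a i" "c i * x + a i < 1" using pos[OF assms(1)] by linarith+
  then show ?thesis unfolding inner_x_eq[OF False] by simp
qed (simp only: inner_x_eq_UNIV UNIV_I)

lemma inner_y_step: assumes "i \<in> I" "y \<in> inner_y" shows "d i * y + b i \<in> inner_y"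
proof (cases "inj_on col I")
  case False
  then have "inner_y = {0<..<1}" by (rule inner_y_eq)
  then have "0 < y" "y < 1" using assms(2) by simp_all
  then have "0 < d i * y" "d i * y < d i * 1" using pos[OF assms(1)] by auto
  then have "0 < d i * y + b i" "d i * y + b i < 1" using pos[OF assms(1)] by linarith+
  then show ?thesis unfolding inner_y_eq[OF False] by simp
qed (simp only: inner_y_eq_UNIV UNIV_I)

lemma inner_x_width: "set ks \<subseteq> I \<Longrightarrow> x \<in> inner_x \<Longrightarrow> width ks * x + left ks \<in> inner_x"
proof (induction ks)
  case (Cons k ks)
  then have "c k * (width ks * x + left ks) + a k \<in> inner_x" using inner_x_step by auto
  moreover have "width (k # ks) * x + left (k # ks) = c k * (width ks * x + left ks) + a k"
    by (simp add: width_def distrib_left mult.assoc)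
  ultimately show ?case by (simp only:)
qed (simp add: width_def)

lemma inner_y_height: "set ks \<subseteq> I \<Longrightarrow> y \<in> inner_y \<Longrightarrow> height ks * y + bottom ks \<in> inner_y"
proof (induction ks)
  case (Cons k ks)
  then have "d k * (height ks * y + bottom ks) + b k \<in> inner_y" using inner_y_step by auto
  moreover have "height (k # ks) * y + bottom (k # ks) = d k * (height ks * y + bottom ks) + b k"
    by (simp add: height_def distrib_left mult.assoc)
  ultimately show ?case by (simp only:)
qed (simp add: height_def)

lemma column_separated:
  assumes "i \<in> I" "k \<in> I" "x \<in> inner_x" "p \<in> F" "fst (S k p) = c i * x + a i"
  shows "col k = col i"
proof (rule ccontr)
  assume ne: "col k \<noteq> col i"
  then have "\<not> (\<forall>i\<in>I. \<forall>k\<in>I. col i = col k)" using assms by blast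
  then have "inner_x = {0<..<1}" by (rule inner_x_eq)
  then have "0 < x" "x < 1" using assms(3) by simp_all
  then have "0 < c i * x" "c i * x < c i * 1" using pos[OF assms(1)] by auto
  then show False using diff[OF assms(2,1) ne] S_box[OF assms(2,4)] assms(5) by linarith
qed

lemma row_separated:
  assumes "i \<in> I" "k \<in> I" "y \<in> inner_y" "p \<in> F" "snd (S k p) = d i * y + b i" "col k = col i"
  shows "k = i"
proof (rule ccontr)
  assume ne: "k \<noteq> i"
  then have "\<not> inj_on col I" using assms unfolding inj_on_def by blast
  then have "inner_y = {0<..<1}" by (rule inner_y_eq)
  then have "0 < y" "y < 1" using assms(3) by simp_all
  then have "0 < d i * y" "d i * y < d i * 1" using pos[OF assms(1)] by auto
  then show False using rows[OF assms(2,1) ne assms(6)] S_box[OF assms(2,4)] assms(5) by linarith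
qed

text \<open>A point of \<open>F\<close> over the inner part of a cylinder of the projection must follow its columns.\<close>
lemma in_strip:
  "set ks \<subseteq> I \<Longrightarrow> p \<in> F \<Longrightarrow> fst p = width ks * x + left ks \<Longrightarrow> x \<in> inner_x \<Longrightarrow>
     p \<in> aff (width ks) 1 (left ks) 0 ` strip ks"
proof (induction ks arbitrary: p)
  case Nil
  have "p = aff 1 1 0 0 p" by (simp add: aff_def)
  then show ?case using Nil by (auto simp: width_def)
next
  case (Cons k ks)
  have k: "k \<in> I" "set ks \<subseteq> I" using Cons.prems by auto
  let ?g = "width ks * x + left ks"
  have g: "?g \<in> inner_x" using inner_x_width k Cons.prems by blast
  have fp: "fst p = c k * ?g + a k" using Cons.prems(3) by (simp add: width_def distrib_left mult.assoc)
  from F_cases[OF Cons.prems(2)] obtain i p' where ip: "i \<in> I" "p' \<in> F" "p = S i p'" .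
  have "col i = col k" using column_separated[OF k(1) ip(1) g ip(2)] fp ip(3) by simp
  then have ci: "c i = c k" "a i = a k" "i \<in> column_of k" using same[OF ip(1) k(1)] ip(1)
      by (auto simp: column_of_def)
  then have "fst p' = ?g" using fp ip(3) pos[OF k(1)] by (simp add: aff_def)
  then obtain s where s: "s \<in> strip ks" "p' = aff (width ks) 1 (left ks) 0 s"
    using Cons.IH[OF k(2) ip(2) _ Cons.prems(4)] by blast
  have "p = aff (width (k # ks)) 1 (left (k # ks)) 0 (aff 1 (d i) 0 (b i) s)"
    unfolding ip(3) s(2) aff_comp by (simp add: ci width_def)
  moreover have "aff 1 (d i) 0 (b i) s \<in> strip (k # ks)" using s(1) ci(3) by auto
  ultimately show ?case by blast
qed

text \<open>A point of \<open>F\<close> in the inner part of a cylinder must follow its word.\<close>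
lemma in_cylinder:
  "set ks \<subseteq> I \<Longrightarrow> word ks (x, y) \<in> F \<Longrightarrow> x \<in> inner_x \<Longrightarrow> y \<in> inner_y \<Longrightarrow> (x, y) \<in> F"
proof (induction ks)
  case (Cons k ks)
  have k: "k \<in> I" "set ks \<subseteq> I" using Cons.prems by auto
  let ?w = "word ks (x, y)"
  have w: "fst ?w \<in> inner_x" "snd ?w \<in> inner_y"
    using inner_x_width[OF k(2) Cons.prems(3)] inner_y_height[OF k(2) Cons.prems(4)]
        by (simp_all add: word_def aff_def)
  have "S k ?w \<in> F" using Cons.prems(2) by (simp add: word_Cons)
  from F_cases[OF this] obtain i p where ip: "i \<in> I" "p \<in> F" "S k ?w = S i p" .
  have "col i = col k" using column_separated[OF k(1) ip(1) w(1) ip(2)] ip(3)[symmetric]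
      by (simp add: aff_def)
  then have "i = k" using row_separated[OF k(1) ip(1) w(2) ip(2)] ip(3)[symmetric] by (simp add: aff_def)
  then have "?w = p" using ip(3) pos[OF k(1)] by (simp add: aff_def prod_eq_iff)
  then show ?case using Cons.IH k ip(2) Cons.prems by simp
qed (simp add: word_Nil)

text \<open>
  With two columns in use, the left one seen inside the right one provides a point strictly between
  0 and 1.
\<close>
lemma interior_x: "\<exists>z\<in>F. \<exists>\<epsilon>>0. \<forall>x. \<bar>x - fst z\<bar> < \<epsilon> \<longrightarrow> x \<in> inner_x"
proof (cases "\<forall>i\<in>I. \<forall>k\<in>I. col i = col k")
  case True
  then have "inner_x = UNIV" by (rule inner_x_eq_UNIV)
  moreover obtain z where "z \<in> F" using F_ne by blast
  ultimately show ?thesis by (intro bexI[of _ z] exI[of _ "1::real"]) simp_all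
next
  case False
  then have inner_x: "inner_x = {0<..<1}" by (rule inner_x_eq)
  from False obtain i k where ik: "i \<in> I" "k \<in> I" "a i + c i \<le> a k" using diff by (metis (full_types))
  obtain p where "p \<in> F" using F_ne by blast
  then have p: "S i p \<in> F" using S_in_F ik by blast
  have "0 \<le> fst (S i p)" "fst (S i p) \<le> a i + c i" using F_bounds[OF p] S_box[OF ik(1) \<open>p \<in> F\<close>] by auto
  moreover have "a k < 1" using pos[OF ik(2)] by linarith
  ultimately have "0 \<le> fst (S i p)" "fst (S i p) < 1" using ik(3) by linarith+
  then have "0 \<le> c k * fst (S i p)" "c k * fst (S i p) < c k * 1"
    using pos[OF ik(2)] by (simp_all only: mult_less_cancel_left_pos) simp
  moreover have "0 < a k" using ik(3) pos[OF ik(1)] by linarith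
  ultimately have "0 < c k * fst (S i p) + a k" "c k * fst (S i p) + a k < 1" using pos[OF ik(2)] by linarith+
  then have z: "0 < fst (S k (S i p))" "fst (S k (S i p)) < 1" by (simp_all add: aff_def)
  show ?thesis
    using S_in_F[OF ik(2) p] z inner_x
    by (intro bexI[of _ "S k (S i p)"] exI[of _ "min (fst (S k (S i p))) (1 - fst (S k (S i p)))"]) auto
qed

text \<open>
  The same with two rectangles in one column. Here the margin has to be uniform over a whole
  cylinder, since the point to be used inside it will depend on the scale.
\<close>
lemma interior_y: "\<exists>i\<in>I. \<exists>k\<in>I. \<exists>\<epsilon>>0. \<forall>p\<in>F. \<forall>y. \<bar>y - snd (S k (S i p))\<bar> < \<epsilon> \<longrightarrow> y \<in> inner_y"
proof (cases "inj_on col I")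
  case True
  then have "inner_y = UNIV" by (rule inner_y_eq_UNIV)
  moreover obtain i where "i \<in> I" using ne by blast
  ultimately show ?thesis by (intro bexI[of _ i] exI[of _ "1::real"]) simp_all
next
  case False
  then have inner_y: "inner_y = {0<..<1}" by (rule inner_y_eq)
  from False obtain i k where ik: "i \<in> I" "k \<in> I" "b i + d i \<le> b k" using rows unfolding inj_on_def
      by (metis (full_types))
  have d: "0 < d i" "0 < d k" "0 \<le> b i" "b k + d k \<le> 1" using pos ik by auto
  let ?\<epsilon> = "min (b k) (d k * (1 - b k))"
  have "0 < b k" "b k < 1" using ik(3) d by linarith+
  then have "0 < ?\<epsilon>" using d by simp
  moreover have "y \<in> inner_y" if p: "p \<in> F" and y: "\<bar>y - snd (S k (S i p))\<bar> < ?\<epsilon>" for p y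
  proof -
    have s: "0 \<le> snd (S i p)" "snd (S i p) \<le> b k"
      using S_box[OF ik(1) p] d ik(3) by linarith+
    then have "0 \<le> d k * snd (S i p)" "d k * snd (S i p) \<le> d k * b k" using d by (auto intro: mult_left_mono)
    then have "b k \<le> snd (S k (S i p))" "snd (S k (S i p)) \<le> d k * b k + b k" by (auto simp: aff_def)
    moreover have "d k * b k + b k + d k * (1 - b k) \<le> 1" using d by (simp add: algebra_simps)
    ultimately show ?thesis using y inner_y by auto
  qed
  ultimately show ?thesis using ik by blast
qed

lemma covers_full_height:
  assumes "set ks \<subseteq> I" "0 < p" "p \<le> 1" "1 \<le> q"
  shows "covers p q (strip ks) (smallest powr (- base_dim) * p powr (- base_dim))"
proof -
  have "covers p 1 (strip ks) (smallest powr (- base_dim) * p powr (- base_dim))"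
    using covers_proj1[OF assms(2,3)]
        by (rule covers_of_projection) (use fst_strip[OF assms(1)] fst_in_projection strip_unit in auto)
  then show ?thesis by (rule covers_weaken) (use assms in auto)
qed

text \<open>
  A strip that follows the column of \<open>i\<close> for \<open>n\<close> steps looks like the product of the projection with
  the slice, down to the height at which the prescribed columns are used up.
\<close>
lemma covers_strip_replicate:
  assumes i: "i \<in> I" and p: "0 < p" "p \<le> 1"
  shows "largest ^ n \<le> q \<Longrightarrow> q \<le> 1 / smallest \<Longrightarrow> covers p q (strip (replicate n i))
     (smallest powr (- base_dim) * smallest powr (- fibre_dim i) * p powr (- base_dim) * q powr (-
         fibre_dim i))"
    (is "_ \<Longrightarrow> _ \<Longrightarrow> covers p q _ (?C q)")
proof (induction n arbitrary: q)
  case 0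
  have "1 \<le> smallest powr (- fibre_dim i) * q powr (- fibre_dim i)"
    using 0 smallest(1) fibre_dim(1)[OF i] by (intro one_le_powr_quotient) auto
  then have "smallest powr (- base_dim) * p powr (- base_dim) * 1 \<le>
     smallest powr (- base_dim) * p powr (- base_dim) * (smallest powr (- fibre_dim i) * q powr (-
         fibre_dim i))"
    by (intro mult_left_mono) auto
  then have le: "smallest powr (- base_dim) * p powr (- base_dim) \<le> ?C q" by (simp add: mult_ac)
  have "covers p q (strip (replicate 0 i)) (smallest powr (- base_dim) * p powr (- base_dim))"
    by (rule covers_full_height) (use 0 p in simp_all)
  then show ?case by (rule covers_weaken[OF _ le subset_refl order_refl order_refl])
next
  case (Suc n)
  show ?case
  proof (cases "1 \<le> q")
    case True
    have "1 \<le> smallest powr (- fibre_dim i) * q powr (- fibre_dim i)"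
      using True Suc.prems smallest(1) fibre_dim(1)[OF i] by (intro one_le_powr_quotient) auto
    then have "smallest powr (- base_dim) * p powr (- base_dim) * 1 \<le>
       smallest powr (- base_dim) * p powr (- base_dim) * (smallest powr (- fibre_dim i) * q powr (-
           fibre_dim i))"
      by (intro mult_left_mono) auto
    then have le: "smallest powr (- base_dim) * p powr (- base_dim) \<le> ?C q" by (simp add: mult_ac)
    have "covers p q (strip (replicate (Suc n) i)) (smallest powr (- base_dim) * p powr (- base_dim))"
      by (rule covers_full_height) (use True p i in \<open>auto simp: set_replicate_conv_if\<close>)
    then show ?thesis by (rule covers_weaken[OF _ le subset_refl order_refl order_refl])
  next
    case False
    have q: "0 < q" using Suc.prems(1) largest(1) by (meson less_le_trans zero_less_power)
    have "covers p q (\<Union>k\<in>column_of i. aff 1 (d k) 0 (b k) ` strip (replicate n i)) (\<Sum>k\<in>column_of i. ?C (q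
        / d k))"
    proof (rule covers_union)
      fix k assume "k \<in> column_of i"
      then have k: "k \<in> I" using column_of(1) by blast
      then have dk: "0 < d k" "d k \<le> largest" "smallest \<le> d k" using pos[of k] largest(4) smallest(3) by auto
      show "0 < (1::real) \<and> 0 < d k" using dk by simp
      have "largest ^ n * d k \<le> largest ^ n * largest" using dk largest(1) by (intro mult_left_mono) auto
      then have "largest ^ n * d k \<le> q" using Suc.prems(1) by (simp add: mult.commute)
      then have "largest ^ n \<le> q / d k" using dk by (simp add: field_simps)
      moreover have "q / d k \<le> 1 / smallest" using False dk smallest(1) by (intro frac_le) auto
      ultimately show "covers (p / 1) (q / d k) (strip (replicate n i)) (?C (q / d k))"
        using Suc.IH by simp
    qed (rule column_of)
    moreover have "(\<Sum>k\<in>column_of i. ?C (q / d k)) = ?C q"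
    proof -
      have "(\<Sum>k\<in>column_of i. ?C (q / d k)) = (\<Sum>k\<in>column_of i. ?C q * d k powr fibre_dim i)"
      proof (rule sum.cong[OF refl])
        fix k assume "k \<in> column_of i"
        then have "0 < d k" using column_of(1) pos by blast
        then show "?C (q / d k) = ?C q * d k powr fibre_dim i"
            using powr_scale[OF q, of "d k" "fibre_dim i"] by simp
      qed
      also have "\<dots> = ?C q" using fibre_dim(2)[OF i] by (simp add: sum_distrib_left[symmetric])
      finally show ?thesis .
    qed
    ultimately show ?thesis by simp
  qed
qed

text \<open>
  Finitely many additional columns at the front change the count by a constant factor only.
\<close>
lemma covers_strip_Cons:
  assumes k: "k \<in> I" and C: "covers p q (strip ks) z" and q: "0 < q"
  shows "covers p q (strip (k # ks)) (real (card I) * z)"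
proof -
  have "covers p q (\<Union>i\<in>column_of k. aff 1 (d i) 0 (b i) ` strip ks) (\<Sum>i\<in>column_of k. z)"
  proof (rule covers_union[OF column_of(2)])
    fix i assume "i \<in> column_of k"
    then have i: "0 < d i" "d i \<le> 1" using column_of(1) pos by (force simp: column_of_def)+
    show "0 < (1::real) \<and> 0 < d i" using i by simp
    show "covers (p / 1) (q / d i) (strip ks) z"
      by (rule covers_weaken[OF C]) (use i q in \<open>auto simp: field_simps\<close>)
  qed
  moreover have "(\<Sum>i\<in>column_of k. z) \<le> real (card I) * z"
    using covers_nonneg[OF C] card_mono[OF fin column_of(1)] by (auto intro: mult_right_mono)
  ultimately show ?thesis unfolding strip.simps
      by (rule covers_weaken[OF _ _ subset_refl order_refl order_refl])
qed

lemma width_replicate: "width (replicate n k) = c k ^ n"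
  and height_replicate: "height (replicate n k) = d k ^ n"
  by (induction n) (auto simp: width_def height_def)

lemma balanced_power:
  fixes \<gamma> x :: real
  assumes "1 < \<gamma>" "0 < x" "x \<le> 1"
  shows "\<exists>m. 1 \<le> \<gamma> ^ m * x \<and> \<gamma> ^ m * x \<le> \<gamma>"
proof -
  obtain N where "1 / x < \<gamma> ^ N" using real_arch_pow[OF assms(1)] by blast
  then have ex: "\<exists>m. 1 \<le> \<gamma> ^ m * x" using assms(2) by (intro exI[of _ N]) (simp add: field_simps)
  define m where "m = (LEAST m. 1 \<le> \<gamma> ^ m * x)"
  have m: "1 \<le> \<gamma> ^ m * x" unfolding m_def by (rule LeastI_ex[OF ex])
  moreover have "\<gamma> ^ m * x \<le> \<gamma>"
  proof (cases m)
    case (Suc l)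
    then have "\<not> 1 \<le> \<gamma> ^ l * x" unfolding m_def by (metis lessI not_less_Least)
    then have "\<gamma> * (\<gamma> ^ l * x) \<le> \<gamma> * 1" using assms by (intro mult_left_mono) auto
    then show ?thesis using Suc by (simp add: mult.assoc)
  qed (use assms in auto)
  ultimately show ?thesis by blast
qed

text \<open>
  Iterating the elongated rectangle \<open>j\<close> makes room for \<open>n\<close> consecutive columns of \<open>i\<close>: the number
  \<open>m\<close> of iterations is chosen such that the cylinder of \<open>j\<^sup>m\<close>, narrowed down by these columns, is
  about as wide as high. The two extra symbols at the front keep the point away from the upper and
  lower sides of the cylinder of \<open>j\<^sup>m\<close>, the point \<open>z\<close> at the end keeps it away from the sides of the
  strip.
\<close>
lemma thin_pieces:
  assumes j: "j \<in> I" "d j < c j" and i: "i \<in> I"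
  shows "\<exists>\<kappa>>0. \<exists>K>0. \<forall>n. \<exists>x\<in>F. \<exists>R. 0 < R \<and> R \<le> c i ^ n \<and>
        real (covering_number (R * largest ^ n / \<kappa>) (cball x R \<inter> F)) \<le>
            K * (largest ^ n) powr (- (base_dim + fibre_dim i))"
proof -
  obtain z \<epsilon>\<^sub>1 where z: "z \<in> F" "0 < \<epsilon>\<^sub>1" "\<And>x. \<bar>x - fst z\<bar> < \<epsilon>\<^sub>1 \<Longrightarrow> x \<in> inner_x" using interior_x by blast
  obtain u\<^sub>2 u\<^sub>1 \<epsilon>\<^sub>2 where u: "u\<^sub>2 \<in> I" "u\<^sub>1 \<in> I" "0 < \<epsilon>\<^sub>2"
    "\<And>p y. p \<in> F \<Longrightarrow> \<bar>y - snd (S u\<^sub>1 (S u\<^sub>2 p))\<bar> < \<epsilon>\<^sub>2 \<Longrightarrow> y \<in> inner_y" using interior_y by blast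
  define \<epsilon> where "\<epsilon> = min 1 (min \<epsilon>\<^sub>1 \<epsilon>\<^sub>2)"
  have \<epsilon>: "0 < \<epsilon>" "\<epsilon> \<le> 1" "\<epsilon> \<le> \<epsilon>\<^sub>1" "\<epsilon> \<le> \<epsilon>\<^sub>2" using z u by (auto simp: \<epsilon>_def)
  define v where "v = c u\<^sub>1 * c u\<^sub>2"
  have v: "0 < v" "v \<le> 1" using pos[OF u(1)] pos[OF u(2)] by (auto simp: v_def intro!: mult_le_one)
  define \<gamma> where "\<gamma> = c j / d j"
  have dj: "0 < d j" "0 < c j" "c j < 1" "d j < 1" using pos[OF j(1)] by auto
  have \<gamma>: "1 < \<gamma>" using j dj by (simp add: \<gamma>_def)
  have ci: "0 < c i" "c i < 1" using pos[OF i] by auto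
  \<comment> \<open>With this value the small scale \<open>R * q / \<kappa>\<close> is five times a bound for both sides of a rescaled box.\<close>
  define \<kappa> where "\<kappa> = \<epsilon> * v / (10 * \<gamma>)"
  have \<kappa>: "0 < \<kappa>" using \<epsilon> v \<gamma> by (simp add: \<kappa>_def)
  define C where "C = smallest powr (- base_dim) * smallest powr (- fibre_dim i)"
  define K where "K = real (card I) * (real (card I) * C)"
  have K: "0 < K" using fin ne smallest(1) by (simp add: K_def C_def card_gt_0_iff)
  have "\<exists>x\<in>F. \<exists>R. 0 < R \<and> R \<le> c i ^ n \<and>
      real (covering_number (R * largest ^ n / \<kappa>) (cball x R \<inter> F)) \<le>
          K * (largest ^ n) powr (- (base_dim + fibre_dim i))" for n
  proof -
    define q where "q = largest ^ n"
    have q: "0 < q" "q \<le> 1" using largest(1,2) by (auto simp: q_def power_le_one)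
    \<comment> \<open>The cylinder of \<open>j\<^sup>m\<close> is \<open>\<gamma>\<^sup>m\<close> times wider than high, and \<open>n\<close> columns of \<open>i\<close> undo this.\<close>
    obtain m where m: "1 \<le> \<gamma> ^ m * c i ^ n" "\<gamma> ^ m * c i ^ n \<le> \<gamma>"
      using balanced_power[OF \<gamma>, of "c i ^ n"] ci by (auto simp: power_le_one)
    define D where "D = d j ^ m"
    define ks where "ks = u\<^sub>1 # u\<^sub>2 # replicate n i"
    define ms where "ms = replicate m j"
    have ks: "set ks \<subseteq> I" and ms: "set ms \<subseteq> I" using u i j by (auto simp: ks_def ms_def)
    have D: "0 < D" using dj by (simp add: D_def)
    have cm: "c j ^ m = D * \<gamma> ^ m" using dj by (simp add: D_def \<gamma>_def power_divide)
    have Dle: "D \<le> c i ^ n"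
    proof -
      have "D * 1 \<le> D * (\<gamma> ^ m * c i ^ n)" using m(1) D by (intro mult_left_mono) auto
      also have "\<dots> = c j ^ m * c i ^ n" using cm by simp
      also have "\<dots> \<le> 1 * c i ^ n" using dj ci by (intro mult_right_mono power_le_one) auto
      finally show ?thesis by simp
    qed
    have wks: "width ks = v * c i ^ n" using width_replicate[of n i] by (simp add: ks_def v_def width_def)
    have wms: "width ms = c j ^ m" "height ms = D"
        by (simp_all add: ms_def D_def width_replicate height_replicate)
    define W where "W = width ms * width ks"
    have W_eq: "W = D * v * (\<gamma> ^ m * c i ^ n)" by (simp add: W_def wks wms cm)
    have W1: "D * v \<le> W" using mult_left_mono[OF m(1), of "D * v"] D v by (simp add: W_eq)
    have W2: "W \<le> D * \<gamma>"
    proof -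
      have "W \<le> D * v * \<gamma>" using mult_left_mono[OF m(2), of "D * v"] D v by (simp add: W_eq)
      also have "\<dots> \<le> D * 1 * \<gamma>" using D v \<gamma> by (intro mult_right_mono mult_left_mono) auto
      finally show ?thesis by simp
    qed
    have W0: "0 < W" using W1 D v by (meson less_le_trans mult_pos_pos)
    \<comment> \<open>Less than \<open>\<epsilon>\<close> times the height \<open>D\<close> and the width \<open>W\<close> of the strip, so the ball stays in its inner part.\<close>
    define R where "R = \<epsilon> / 2 * v * D"
    have R: "0 < R" using \<epsilon> v D by (simp add: R_def)
    have RD: "R / D < \<epsilon>" "R / W < \<epsilon>"
    proof -
      have "R < \<epsilon> * (v * D)" using \<epsilon> v D by (simp add: R_def)
      moreover have "\<epsilon> * (v * D) \<le> \<epsilon> * W" using W1 \<epsilon> by (intro mult_left_mono) (auto simp: mult.commute)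
      moreover have "\<epsilon> * (v * D) \<le> \<epsilon> * (1 * D)" using v D \<epsilon> by (intro mult_left_mono mult_right_mono) auto
      ultimately show "R / D < \<epsilon>" "R / W < \<epsilon>" using D W0 by (auto simp: pos_divide_less_eq)
    qed
    have "R \<le> 1 * 1 * D" unfolding R_def using \<epsilon> v D by (intro mult_right_mono mult_mono) auto
    then have R2: "R \<le> c i ^ n" using Dle by simp
    define y where "y = word ks z"
    define x where "x = word ms y"
    have y: "y \<in> F" using word_in_F[OF ks z(1)] by (simp add: y_def)
    have x: "x \<in> F" using word_in_F[OF ms y] by (simp add: x_def)
    have h_in: "h \<in> inner_y" if "\<bar>h - snd y\<bar> < \<epsilon>" for h
    proof -
      have "set (replicate n i) \<subseteq> I" using i by (simp add: set_replicate_conv_if)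
      then have "word (replicate n i) z \<in> F" using z(1) by (rule word_in_F)
      moreover have "y = S u\<^sub>1 (S u\<^sub>2 (word (replicate n i) z))" by (simp add: y_def ks_def word_Cons)
      ultimately show ?thesis using u(4) that \<epsilon> by fastforce
    qed
    have sub: "cball x R \<inter> F \<subseteq> aff W D (width ms * left ks + left ms) (bottom ms) ` strip ks"
    proof
      fix p assume p: "p \<in> cball x R \<inter> F"
      \<comment> \<open>The coordinates of \<open>p\<close> relative to the cylinder of \<open>ms\<close>, and its abscissa relative to the strip.\<close>
      define g h where "g = (fst p - left ms) / width ms" and "h = (snd p - bottom ms) / D"
      define \<zeta> where "\<zeta> = (g - left ks) / width ks"
      have wp: "0 < width ms" "0 < width ks" using width_pos ms ks by auto
      have pw: "p = word ms (g, h)" using wp(1) D wms(2) by (simp add: word_def aff_def g_def h_def)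
      have g: "g = width ks * \<zeta> + left ks" using wp by (simp add: \<zeta>_def)
      have dist: "\<bar>fst p - fst x\<bar> \<le> R" "\<bar>snd p - snd x\<bar> \<le> R"
        using p abs_fst_le_dist[of p x] abs_snd_le_dist[of p x] by (auto simp: dist_commute)
      have "fst p - fst x = W * (\<zeta> - fst z)"
        unfolding pw x_def y_def word_def aff_def by (simp add: g W_def algebra_simps)
      then have "W * \<bar>\<zeta> - fst z\<bar> \<le> R" using dist(1) W0 by (simp add: abs_mult)
      then have "\<bar>\<zeta> - fst z\<bar> \<le> R / W" using W0 by (simp add: field_simps)
      then have \<zeta>: "\<zeta> \<in> inner_x" using RD z(3) \<epsilon> by force
      have "snd p - snd x = D * (h - snd y)"
        unfolding pw x_def word_def aff_def by (simp add: wms algebra_simps)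
      then have "D * \<bar>h - snd y\<bar> \<le> R" using dist(2) D by (simp add: abs_mult)
      then have "\<bar>h - snd y\<bar> \<le> R / D" using D by (simp add: field_simps)
      then have h: "h \<in> inner_y" using RD h_in by force
      have g_in: "g \<in> inner_x" using inner_x_width[OF ks \<zeta>] g by simp
      have "(g, h) \<in> F" using in_cylinder[OF ms _ g_in h] pw p by simp
      then obtain s where s: "s \<in> strip ks" "(g, h) = aff (width ks) 1 (left ks) 0 s"
        using in_strip[OF ks _ _ \<zeta>] g by (metis fst_conv imageE)
      have "p = aff W D (width ms * left ks + left ms) (bottom ms) s"
        unfolding pw s(2) word_def aff_comp by (simp add: W_def wms)
      then show "p \<in> aff W D (width ms * left ks + left ms) (bottom ms) ` strip ks" using s(1) by blast
    qed
    have "smallest \<le> 1" using smallest(2)[OF i] ci by linarith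
    then have "1 \<le> 1 / smallest" using smallest(1) by simp
    then have "covers q q (strip (replicate n i)) (C * q powr (- base_dim) * q powr (- fibre_dim i))"
      unfolding C_def using covers_strip_replicate[OF i q, of n q] q by (simp add: q_def)
    then have "covers q q (strip ks) (real (card I) * (real (card I) * (C * q powr (- base_dim) * q powr
        (- fibre_dim i))))"
      unfolding ks_def using u q by (intro covers_strip_Cons)
    moreover have "real (card I) * (real (card I) * (C * q powr (- base_dim) * q powr (- fibre_dim i))) =
        K * q powr (- (base_dim + fibre_dim i))"
      by (simp add: K_def powr_add[symmetric] mult.assoc)
    ultimately have "covers q q (strip ks) (K * q powr (- (base_dim + fibre_dim i)))" by simp
    then have "covers (W * q) (D * q) (cball x R \<inter> F) (K * q powr (- (base_dim + fibre_dim i)))"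
      by (intro covers_weaken[OF covers_aff[OF _ W0 D] order_refl sub order_refl order_refl])
    moreover have r: "R * q / \<kappa> = 5 * (D * \<gamma> * q)" using \<epsilon> v \<gamma> by (simp add: R_def \<kappa>_def field_simps)
    moreover have "W * q \<le> D * \<gamma> * q" using W2 q by (intro mult_right_mono) auto
    moreover have "D * q \<le> D * \<gamma> * q"
      using D q \<gamma> mult_left_mono[of 1 \<gamma> D] by (intro mult_right_mono) auto
    moreover have "0 < R * q / \<kappa>" using R q \<kappa> by simp
    ultimately have "real (covering_number (R * q / \<kappa>) (cball x R \<inter> F)) \<le>
        K * q powr (- (base_dim + fibre_dim i))"
      by (intro covering_number_le_covers[of "W * q" "D * q"]) simp_all
    then show ?thesis using x R R2 unfolding q_def by blast
  qed
  then show ?thesis using \<kappa> K by blast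
qed

lemma lower_exponent_upper_bound:
  assumes "j \<in> I" "d j < c j" "i \<in> I" "\<alpha> \<in> lower_exponents F"
  shows "\<alpha> \<le> base_dim + fibre_dim i"
proof -
  obtain \<kappa> K where "0 < \<kappa>" "0 < K" and thin: "\<And>n. \<exists>x\<in>F. \<exists>R. 0 < R \<and> R \<le> c i ^ n \<and>
        real (covering_number (R * largest ^ n / \<kappa>) (cball x R \<inter> F)) \<le>
            K * (largest ^ n) powr (- (base_dim + fibre_dim i))"
    using thin_pieces[OF assms(1,2,3)] by blast
  then show ?thesis
    using lower_exponent_le[OF assms(4) _ _ largest(1,2) _ _ thin] pos[OF assms(3)] by blast
qed

end

section \<open>Reflection in the diagonal\<close>
lemma dist_swap: "dist (prod.swap x) (prod.swap y) = dist x y" for x y :: "real \<times> real"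
  by (simp add: dist_prod_def add.commute)

lemma covering_number_swap: "covering_number r (prod.swap ` E) =
    covering_number r E" for E :: "(real \<times> real) set"
proof -
  let ?P = "\<lambda>n (E :: (real \<times> real) set) U. finite U \<and> card U = n \<and> E \<subseteq> \<Union>U \<and> (\<forall>A\<in>U. open A \<and> bounded A \<and>
      diameter A \<le> r)"
  have step: "\<exists>U. ?P n (prod.swap ` E) U" if ex: "\<exists>U. ?P n E U" for n and E :: "(real \<times> real) set"
  proof -
    obtain U where U: "?P n E U" using ex by (rule exE)
    have img: "open (prod.swap ` A) \<and> bounded (prod.swap ` A) \<and> diameter (prod.swap ` A) \<le> r" if "A \<in> U" for A
    proof -
      have A: "open A" "bounded A" "diameter A \<le> r" using U that by auto
      have "prod.swap ` A = prod.swap -` A" by (force simp: image_iff)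
      moreover have "open (prod.swap -` A)"
        using A(1) by (intro open_vimage) (auto simp: prod.swap_def intro!: continuous_intros)
      ultimately have "open (prod.swap ` A)" by simp
      moreover have "bounded (prod.swap ` A)"
        using A(2) unfolding bounded_def by (metis (no_types, lifting) dist_swap imageE)
      moreover have "diameter (prod.swap ` A) = diameter A"
      proof -
        have "(\<lambda>(x, y). dist x y) ` (prod.swap ` A \<times> prod.swap ` A) = (\<lambda>(x, y). dist x y) ` (A \<times> A)"
          by (force simp: image_iff dist_prod_def add.commute)
        then show ?thesis by (simp add: diameter_def)
      qed
      ultimately show ?thesis using A(3) by simp
    qed
    have "inj_on ((`) prod.swap) U" by (intro inj_onI) (simp add: inj_image_eq_iff)
    then have "card ((`) prod.swap ` U) = n" using U card_image by metis
    moreover have "prod.swap ` E \<subseteq> \<Union>((`) prod.swap ` U)"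
      using U by (metis (no_types, lifting) image_Union image_mono)
    ultimately show ?thesis using U img
        by (intro exI[of _ "(`) prod.swap ` U"]) (simp only: finite_imageI ball_simps, simp)
  qed
  have "(\<exists>U. ?P n (prod.swap ` E) U) \<longleftrightarrow> (\<exists>U. ?P n E U)" for n
    using step[of n E] step[of n "prod.swap ` E"] by (auto simp: image_image)
  then show ?thesis unfolding covering_number_def by simp
qed

lemma has_box_dim_swap: "has_box_dim (prod.swap ` E) s \<longleftrightarrow> has_box_dim E s" for E :: "(real \<times> real) set"
  by (simp add: has_box_dim_def covering_number_swap)

lemma lower_exponents_swap: "lower_exponents (prod.swap ` F) = lower_exponents F"
proof -
  have "cball (prod.swap x) R \<inter> prod.swap ` F = prod.swap ` (cball x R \<inter> F)" for x :: "real \<times> real" and R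
    by (force simp: image_iff dist_prod_def add.commute)
  then have "covering_number r (cball (prod.swap x) R \<inter> prod.swap ` F) =
      covering_number r (cball x R \<inter> F)" for r x R
    by (simp add: covering_number_swap)
  then show ?thesis by (simp add: lower_exponents_def image_image)
qed

lemma lower_dim_eqI:
  assumes "M \<in> lower_exponents F" "\<And>\<alpha>. \<alpha> \<in> lower_exponents F \<Longrightarrow> \<alpha> \<le> M"
  shows "lower_dim F = M"
proof -
  have "lower_dim F = Sup (lower_exponents F)" by (simp add: lower_dim_def lower_exponents_def)
  then show ?thesis using assms by (simp add: cSup_eq_maximum)
qed

lemma packs_swap:
  assumes "packs p q E z"
  shows "packs q p (prod.swap ` E) z"
proof -
  obtain Q where QQ: "is_packing p q E z Q"
    using assms unfolding packs_def by (rule exE)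
  show ?thesis unfolding packs_def
  proof (intro exI[of _ "prod.swap ` Q"] conjI ballI impI)
    show "z \<le> real (card (prod.swap ` Q))" using QQ by (simp add: card_image)
  next
    fix w w' assume "w \<in> prod.swap ` Q" "w' \<in> prod.swap ` Q" "w \<noteq> w'"
    then obtain v v' where v: "v \<in> Q" "v' \<in> Q" "v \<noteq> v'" "w = prod.swap v" "w' = prod.swap v'" by blast
    then have "p \<le> \<bar>fst v - fst v'\<bar> \<or> q \<le> \<bar>snd v - snd v'\<bar>" using QQ by blast
    then show "q \<le> \<bar>fst w - fst w'\<bar> \<or> p \<le> \<bar>snd w - snd w'\<bar>" using v by auto
  next
    fix w assume "w \<in> prod.swap ` Q"
    then obtain v where v: "v \<in> Q" "w = prod.swap v" by blast
    then obtain e where "e \<in> E" "fst v \<le> fst e \<and> fst e \<le> fst v + p \<and> snd v \<le> snd e \<and> snd e \<le> snd v + q"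
      using QQ by blast
    then show "\<exists>e\<in>prod.swap ` E. in_box q p w e"
      using v by (intro bexI[of _ "prod.swap e"]) auto
    have "0 \<le> fst v \<and> fst v + p \<le> 1 \<and> 0 \<le> snd v \<and> snd v + q \<le> 1" using QQ v(1) by blast
    then show "0 \<le> fst w" "fst w + q \<le> 1" "0 \<le> snd w" "snd w + p \<le> 1" using v(2) by auto
  qed (use QQ in simp)
qed

lemma rich_swap: "rich \<sigma> C T \<Longrightarrow> rich \<sigma> C (prod.swap ` T)"
  unfolding rich_def by (intro conjI allI impI packs_swap) auto

lemma rich_piece_swap:
  assumes "rich_piece (prod.swap ` F) \<sigma> C \<epsilon> R\<^sub>1 R\<^sub>2 (prod.swap x)"
  shows "rich_piece F \<sigma> C \<epsilon> R\<^sub>2 R\<^sub>1 x"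
proof -
  obtain T c d a b where T: "rich \<sigma> C T" "\<epsilon> * R\<^sub>1 \<le> c" "c \<le> R\<^sub>1" "\<epsilon> * R\<^sub>2 \<le> d" "d \<le> R\<^sub>2"
    "prod.swap x \<in> aff c d a b ` T" "aff c d a b ` T \<subseteq> prod.swap ` F"
    using assms unfolding rich_piece_def by blast
  have eq: "aff d c b a ` prod.swap ` T = prod.swap ` aff c d a b ` T"
    by (simp add: image_image aff_def)
  have "x \<in> prod.swap ` aff c d a b ` T" using T(6) by (metis imageI swap_swap)
  moreover have "prod.swap ` aff c d a b ` T \<subseteq> F"
  proof -
    have "prod.swap ` aff c d a b ` T \<subseteq> prod.swap ` prod.swap ` F" using T(7) by (rule image_mono)
    then show ?thesis by (simp add: image_image)
  qed
  ultimately show ?thesis unfolding rich_piece_def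
    using T(2-5) rich_swap[OF T(1)] eq by metis
qed

lemma rich_piece_weaken:
  assumes P: "rich_piece F \<sigma>' C' \<epsilon> R\<^sub>1 R\<^sub>2 x" and \<sigma>: "\<sigma> \<le> \<sigma>'" and C: "0 \<le> C" "C \<le> C'"
  shows "rich_piece F \<sigma> C \<epsilon> R\<^sub>1 R\<^sub>2 x"
proof -
  have "rich \<sigma> C T" if "rich \<sigma>' C' T" for T
    unfolding rich_def
  proof (intro conjI allI impI)
    show "T \<subseteq> unit_square" using that by (simp add: rich_def)
    fix p :: real assume p: "0 < p \<and> p \<le> 1"
    have "C * p powr (- \<sigma>) \<le> C' * p powr (- \<sigma>')"
      using p \<sigma> C by (intro mult_mono powr_mono') auto
    moreover have "packs p p T (C' * p powr (- \<sigma>'))" using that p by (simp add: rich_def)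
    ultimately show "packs p p T (C * p powr (- \<sigma>))" using packs_weaken by blast
  qed
  then show ?thesis using P unfolding rich_piece_def by blast
qed

context column_system
begin

lemma fibre_dim_Min: "(MIN i\<in>I. fibre_dim i) \<in> fibre_dim ` I" "i \<in> I \<Longrightarrow> (MIN i\<in>I. fibre_dim i) \<le> fibre_dim i"
  using fin ne by (auto intro!: Min_in Min_le)

lemma fibre_dim_Min_nonneg: "0 \<le> (MIN i\<in>I. fibre_dim i)"
  using fibre_dim_Min(1) fibre_dim(1) by auto

lemma lower_dim_horizontal:
  assumes hor: "\<And>i. i \<in> I \<Longrightarrow> d i \<le> c i" and j: "j \<in> I" "d j < c j"
  shows "lower_dim F = base_dim + (MIN i\<in>I. fibre_dim i)"
proof (rule lower_dim_eqI)
  show "base_dim + (MIN i\<in>I. fibre_dim i) \<in> lower_exponents F"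
    using fibre_dim_Min_nonneg fibre_dim_Min(2) hor by (intro lower_exponent_horizontal)
  fix \<alpha> assume "\<alpha> \<in> lower_exponents F"
  moreover obtain i where "i \<in> I" "(MIN i\<in>I. fibre_dim i) = fibre_dim i" using fibre_dim_Min(1) by blast
  ultimately show "\<alpha> \<le> base_dim + (MIN i\<in>I. fibre_dim i)"
    using lower_exponent_upper_bound[OF j] by simp
qed

end

section \<open>The two classes of carpets\<close>
lemma division_mono:
  assumes t: "division n t" and "i < j" "j \<le> n"
  shows "t i < t j"
proof -
  have "t i < t (i + Suc m)" if "i + Suc m \<le> n" for m
    using that
  proof (induction m)
    case (Suc m)
    then have "t (i + Suc m) < t (Suc (i + Suc m))" using t unfolding division_def by auto
    then show ?case using Suc by auto
  qed (use t in \<open>auto simp: division_def\<close>)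
  from this[of "j - Suc i"] show ?thesis using assms by simp
qed

lemma division_bounds:
  assumes t: "division n t" and k: "k < n"
  shows "0 \<le> t k" "t k < t (Suc k)" "t (Suc k) \<le> 1"
proof -
  have "t 0 = 0" "t n = 1" using t by (auto simp: division_def)
  then show "0 \<le> t k" using division_mono[OF t, of 0 k] k by (cases k) auto
  show "t k < t (Suc k)" using division_mono[OF t, of k "Suc k"] k by simp
  show "t (Suc k) \<le> 1" using division_mono[OF t, of "Suc k" n] \<open>t n = 1\<close> k by (cases "Suc k = n") auto
qed

lemma division_proper:
  assumes t: "division n t" and k: "k < n" and n: "2 \<le> n"
  shows "t (Suc k) - t k < 1"
proof (cases k)
  case 0
  have "t (Suc 0) < t n" using division_mono[OF t, of "Suc 0" n] n by simp
  then show ?thesis using t 0 by (simp add: division_def)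
next
  case (Suc l)
  have "t 0 < t k" using division_mono[OF t, of 0 k] k Suc by simp
  then show ?thesis using division_bounds[OF t k] t by (simp add: division_def)
qed

lemma division_separated:
  assumes t: "division n t" and "k < n" "l < n" "k \<noteq> l"
  shows "t (Suc k) \<le> t l \<or> t (Suc l) \<le> t k"
proof -
  have "t (Suc k) \<le> t l" if "k < l" "l < n" for k l
    using division_mono[OF t, of "Suc k" l] that by (cases "Suc k = l") auto
  then show ?thesis using assms by (meson nat_neq_iff)
qed

lemma aff_map_eq: "aff_map c d a b i = aff (c i) (d i) (a i) (b i)"
  by (auto simp: aff_map_def aff_def)

lemma column_system_of_divisions:
  assumes m: "2 \<le> m" "division m v" and h: "\<And>j. j < m \<Longrightarrow> division (n j) (h j)"
    and inj: "inj_on (\<lambda>i. (col i, tier i)) I"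
    and i: "\<And>i. i \<in> I \<Longrightarrow> col i < m \<and> tier i < n (col i) \<and>
           a i = v (col i) \<and> c i = v (Suc (col i)) - v (col i) \<and>
           b i = h (col i) (tier i) \<and> d i = h (col i) (Suc (tier i)) - h (col i) (tier i)"
    and d: "\<And>i. i \<in> I \<Longrightarrow> d i < 1"
    and I: "finite I" "I \<noteq> {}" and F: "attractor I (aff_map c d a b) F"
  shows "column_system I col c d a b F"
proof
  fix k assume k: "k \<in> I"
  show "0 < c k \<and> c k < 1 \<and> 0 < d k \<and> d k < 1 \<and> 0 \<le> a k \<and> a k + c k \<le> 1 \<and> 0 \<le> b k \<and> b k + d k \<le> 1"
    using division_bounds[OF m(2), of "col k"] division_proper[OF m(2) _ m(1), of "col k"]
      division_bounds[OF h, of "col k" "tier k"] i[OF k] d[OF k] by auto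
next
  fix k l assume kl: "k \<in> I" "l \<in> I" "col k = col l"
  then show "c k = c l \<and> a k = a l" using i[OF kl(1)] i[OF kl(2)] by simp
next
  fix k l assume kl: "k \<in> I" "l \<in> I" "col k \<noteq> col l"
  then show "a k + c k \<le> a l \<or> a l + c l \<le> a k"
    using division_separated[OF m(2), of "col k" "col l"] i[OF kl(1)] i[OF kl(2)] by simp
next
  fix k l assume kl: "k \<in> I" "l \<in> I" "k \<noteq> l" "col k = col l"
  then have "tier k \<noteq> tier l" using inj unfolding inj_on_def by blast
  then show "b k + d k \<le> b l \<or> b l + d l \<le> b k"
    using division_separated[OF h, of "col k" "tier k" "tier l"] i[OF kl(1)] i[OF kl(2)] kl(4) by simp
qed (use I F in \<open>auto simp: attractor_def aff_map_eq\<close>)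

lemma column_system_Lalley_Gatzouras:
  assumes E: "extended_Lalley_Gatzouras I c d a b" and I: "finite I" "I \<noteq> {}"
    and F: "attractor I (aff_map c d a b) F"
  shows "\<exists>col. column_system I col c d a b F"
proof -
  obtain m v n h col tier where m: "m \<ge> 2" "division m v" and h: "\<And>j. j < m \<Longrightarrow> division (n j) (h j)"
    and inj: "inj_on (\<lambda>i. (col i, tier i)) I"
    and i: "\<And>i. i \<in> I \<Longrightarrow> col i < m \<and> tier i < n (col i) \<and>
           a i = v (col i) \<and> c i = v (Suc (col i)) - v (col i) \<and>
           b i = h (col i) (tier i) \<and> d i = h (col i) (Suc (tier i)) - h (col i) (tier i) \<and> c i \<ge> d i"
    using E unfolding extended_Lalley_Gatzouras_def by blast
  have "d k < 1" if "k \<in> I" for k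
    using division_proper[OF m(2) _ m(1), of "col k"] i[OF that] by simp
  then have "column_system I col c d a b F"
    using i by (intro column_system_of_divisions[OF m h inj _ _ I F]) auto
  then show ?thesis by blast
qed

lemma column_system_Baranski:
  assumes E: "Baranski I c d a b" and I: "finite I" "I \<noteq> {}"
    and F: "attractor I (aff_map c d a b) F"
  shows "\<exists>col. column_system I col c d a b F"
proof -
  obtain m v n h col tier where m: "m \<ge> 2" "division m v" and n: "n \<ge> 2" "division n h"
    and inj: "inj_on (\<lambda>i. (col i, tier i)) I"
    and i: "\<And>i. i \<in> I \<Longrightarrow> col i < m \<and> tier i < n \<and>
           a i = v (col i) \<and> c i = v (Suc (col i)) - v (col i) \<and>
           b i = h (tier i) \<and> d i = h (Suc (tier i)) - h (tier i)"
    using E unfolding Baranski_def by blast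
  have "d k < 1" if "k \<in> I" for k
    using division_proper[OF n(2) _ n(1), of "tier k"] i[OF that] by simp
  then have "column_system I col c d a b F"
    using i by (intro column_system_of_divisions[where n = "\<lambda>_. n" and h =
        "\<lambda>_. h", OF m n(2) inj _ _ I F]) auto
  then show ?thesis by blast
qed

lemma Baranski_swap: "Baranski I c d a b \<Longrightarrow> Baranski I d c b a"
  unfolding Baranski_def
proof (elim exE conjE)
  fix m v n h and col tier :: "'a \<Rightarrow> nat"
  assume *: "m \<ge> 2" "division m v" "n \<ge> 2" "division n h" "inj_on (\<lambda>i. (col i, tier i)) I"
    "\<forall>i\<in>I. col i < m \<and> tier i < n \<and> a i = v (col i) \<and> c i = v (Suc (col i)) - v (col i) \<and>
           b i = h (tier i) \<and> d i = h (Suc (tier i)) - h (tier i)"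
  have "inj_on (\<lambda>i. (tier i, col i)) I" using *(5) by (auto simp: inj_on_def)
  then show "\<exists>m v n h col tier. m \<ge> 2 \<and> division m v \<and> n \<ge> 2 \<and> division n h \<and>
        inj_on (\<lambda>i. (col i, tier i)) I \<and>
        (\<forall>i\<in>I. col i < m \<and> tier i < n \<and>
           b i = v (col i) \<and> d i = v (Suc (col i)) - v (col i) \<and>
           a i = h (tier i) \<and> c i = h (Suc (tier i)) - h (tier i))"
    using * by (intro exI[of _ n] exI[of _ h] exI[of _ m] exI[of _ v] exI[of _ tier] exI[of _ col]) simp
qed

lemma attractor_swap:
  assumes "attractor I (aff_map c d a b) F"
  shows "attractor I (aff_map d c b a) (prod.swap ` F)"
proof -
  have F: "F \<noteq> {}" "compact F" "F = (\<Union>i\<in>I. aff_map c d a b i ` F)" using assms by (auto simp: attractor_def)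
  have "aff_map d c b a i ` prod.swap ` F = prod.swap ` aff_map c d a b i ` F" for i
    by (simp add: image_image aff_map_def)
  then have "(\<Union>i\<in>I. aff_map d c b a i ` prod.swap ` F) = prod.swap ` (\<Union>i\<in>I. aff_map c d a b i ` F)"
    by (simp add: image_UN)
  moreover have "compact (prod.swap ` F)"
    using F(2) by (intro compact_continuous_image) (auto simp: prod.swap_def intro!: continuous_intros)
  ultimately show ?thesis using F by (simp add: attractor_def)
qed

text \<open>
  Zooming in ends either with a column strip or with a row strip, depending on which side length of
  the cylinder reaches the radius first; each is at least as rich as the minimum requires.
  Conversely there are rectangles elongated in either direction, so the upper bound applies to
  columns and to rows.
\<close>
lemma lower_dim_mixed:
  assumes H: "column_system I col c d a b F" and V: "column_system I tier d c b a (prod.swap ` F)"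
    and j: "j \<in> I" "d j < c j" and k: "k \<in> I" "c k < d k"
  shows "lower_dim F = (MIN i\<in>I. min (column_system.base_dim I col c + column_system.fibre_dim I col d i)
      (column_system.base_dim I tier d + column_system.fibre_dim I tier c i))"
    (is "_ = Min (?f ` I)")
proof -
  interpret H: column_system I col c d a b F by (rule H)
  interpret V: column_system I tier d c b a "prod.swap ` F" by (rule V)
  define M where "M = Min (?f ` I)"
  have Mle: "M \<le> H.base_dim + H.fibre_dim i" "M \<le> V.base_dim + V.fibre_dim i" if "i \<in> I" for i
  proof -
    have "M \<le> ?f i" unfolding M_def using H.fin that by (intro Min_le) auto
    then show "M \<le> H.base_dim + H.fibre_dim i" "M \<le> V.base_dim + V.fibre_dim i" by auto
  qed
  have "M \<in> ?f ` I" unfolding M_def using H.fin H.ne by (intro Min_in) auto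
  then obtain i0 where i0: "i0 \<in> I" "M = ?f i0" by blast
  have M0: "0 \<le> M"
    using i0 H.base_dim(1) V.base_dim(1) H.fibre_dim(1) V.fibre_dim(1) by simp
  have small: "V.smallest = H.smallest" by (simp add: H.smallest_def V.smallest_def Un_commute)
  obtain C\<^sub>1 where C\<^sub>1: "0 < C\<^sub>1" "\<And>x R\<^sub>1 R\<^sub>2. x \<in> F \<Longrightarrow> 0 < R\<^sub>1 \<Longrightarrow> R\<^sub>1 \<le> 1 / H.smallest \<Longrightarrow> 1 \<le> R\<^sub>2 \<Longrightarrow>
      R\<^sub>2 \<le> 1 / H.smallest \<Longrightarrow>
     rich_piece F (H.base_dim + (MIN i\<in>I. H.fibre_dim i)) C\<^sub>1 H.smallest R\<^sub>1 R\<^sub>2 x"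
    using H.rich_strip_piece[OF H.fibre_dim_Min_nonneg H.fibre_dim_Min(2)] by blast
  obtain C\<^sub>2 where C\<^sub>2: "0 < C\<^sub>2" "\<And>x R\<^sub>1 R\<^sub>2. x \<in> prod.swap ` F \<Longrightarrow> 0 < R\<^sub>1 \<Longrightarrow> R\<^sub>1 \<le> 1 / H.smallest \<Longrightarrow> 1 \<le> R\<^sub>2 \<Longrightarrow>
      R\<^sub>2 \<le> 1 / H.smallest \<Longrightarrow>
     rich_piece (prod.swap ` F) (V.base_dim + (MIN i\<in>I. V.fibre_dim i)) C\<^sub>2 H.smallest R\<^sub>1 R\<^sub>2 x"
    using V.rich_strip_piece[OF V.fibre_dim_Min_nonneg V.fibre_dim_Min(2)] small by auto
  have MH: "M \<le> H.base_dim + (MIN i\<in>I. H.fibre_dim i)" using H.fibre_dim_Min(1) Mle(1) by auto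
  have MV: "M \<le> V.base_dim + (MIN i\<in>I. V.fibre_dim i)" using V.fibre_dim_Min(1) Mle(2) by auto
  define C where "C = min C\<^sub>1 C\<^sub>2"
  have C: "0 < C" "C \<le> C\<^sub>1" "C \<le> C\<^sub>2" using C\<^sub>1 C\<^sub>2 by (auto simp: C_def)
  have "M \<in> lower_exponents F"
  proof (rule lower_exponentI[OF _ H.bounded_F H.F_ne M0 C(1) H.smallest(1)])
    fix x R assume x: "x \<in> F" and R: "0 < R" "R \<le> (1::real)"
    show "rich_piece F M C H.smallest R R x"
    proof (rule H.rich_piece_descend[where D = "\<lambda>_ _. True"])
      fix x R\<^sub>1 R\<^sub>2 assume x: "x \<in> F" and R: "0 < R\<^sub>1" "R\<^sub>1 \<le> 1 / H.smallest" "0 < R\<^sub>2" "R\<^sub>2 \<le> 1 / H.smallest"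
          "1 \<le> R\<^sub>1 \<or> 1 \<le> R\<^sub>2"
      from R(5) show "rich_piece F M C H.smallest R\<^sub>1 R\<^sub>2 x"
      proof
        assume "1 \<le> R\<^sub>2"
        from C\<^sub>1(2)[OF x R(1,2) this R(4)] show ?thesis using MH less_imp_le[OF C(1)] C(2)
            by (rule rich_piece_weaken)
      next
        assume "1 \<le> R\<^sub>1"
        from rich_piece_swap[OF C\<^sub>2(2)[OF imageI[OF x] R(3,4) this R(2)]]
        show ?thesis using MV less_imp_le[OF C(1)] C(3) by (rule rich_piece_weaken)
      qed
    qed (use x R in auto)
  qed
  moreover have "\<alpha> \<le> M" if \<alpha>: "\<alpha> \<in> lower_exponents F" for \<alpha>
  proof -
    have "\<alpha> \<le> H.base_dim + H.fibre_dim i0" by (rule H.lower_exponent_upper_bound[OF j i0(1) \<alpha>])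
    moreover have "\<alpha> \<le> V.base_dim + V.fibre_dim i0"
      by (rule V.lower_exponent_upper_bound[OF k i0(1)]) (use \<alpha> in \<open>simp add: lower_exponents_swap\<close>)
    ultimately show ?thesis using i0(2) by simp
  qed
  ultimately show ?thesis unfolding M_def[symmetric] by (rule lower_dim_eqI)
qed

lemma slice2_eq_swap:
  assumes V: "column_system I tier d c b a (prod.swap ` F)" and H: "column_system I col c d a b F" and i:
      "i \<in> I"
  shows "slice2 (aff_map c d a b i) F = prod.swap ` column_system.vslice d b (prod.swap ` F) i"
proof -
  interpret H: column_system I col c d a b F by (rule H)
  interpret V: column_system I tier d c b a "prod.swap ` F" by (rule V)
  show ?thesis by (force simp: slice2_def V.vslice_def aff_map_eq H.fixed_point_S[OF i] image_iff)
qed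

lemma proj2_eq_swap: "proj2 ` F = prod.swap ` proj1 ` prod.swap ` F"
  by (simp add: image_image proj1_def proj2_def)

theorem theorem2p13:
  fixes I :: "'i set" and c d a b :: "'i \<Rightarrow> real" and F :: "(real \<times> real) set"
    and S :: "'i \<Rightarrow> real \<times> real \<Rightarrow> real \<times> real"
  assumes carpet: "self_affine_carpet I c d a b F"
    and S: "S = aff_map c d a b"
  shows
    "(horizontal_type I c d \<longrightarrow>
        box_dim_exists (proj1 ` F) \<and> (\<forall>i\<in>I. box_dim_exists (slice1 (S i) F)) \<and>
        lower_dim F = box_dim (proj1 ` F) + (MIN i\<in>I. box_dim (slice1 (S i) F))) \<and>
     (vertical_type I c d \<longrightarrow>
        box_dim_exists (proj2 ` F) \<and> (\<forall>i\<in>I. box_dim_exists (slice2 (S i) F)) \<and>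
        lower_dim F = box_dim (proj2 ` F) + (MIN i\<in>I. box_dim (slice2 (S i) F))) \<and>
     (mixed_type I c d \<longrightarrow>
        box_dim_exists (proj1 ` F) \<and> (\<forall>i\<in>I. box_dim_exists (slice1 (S i) F)) \<and>
        box_dim_exists (proj2 ` F) \<and> (\<forall>i\<in>I. box_dim_exists (slice2 (S i) F)) \<and>
        lower_dim F =
          (MIN i\<in>I. min (box_dim (proj1 ` F) + box_dim (slice1 (S i) F))
                         (box_dim (proj2 ` F) + box_dim (slice2 (S i) F))))"
proof -
  have I: "finite I" "I \<noteq> {}" and cls: "extended_Lalley_Gatzouras I c d a b \<or> Baranski I c d a b"
    and nonsim: "\<exists>i\<in>I. c i \<noteq> d i" and F: "attractor I (aff_map c d a b) F"
    using carpet by (auto simp: self_affine_carpet_def)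
  obtain col where H: "column_system I col c d a b F"
    using cls column_system_Lalley_Gatzouras[OF _ I F] column_system_Baranski[OF _ I F] by blast
  interpret H: column_system I col c d a b F by (rule H)
  have p1: "box_dim (proj1 ` F) = H.base_dim" "box_dim_exists (proj1 ` F)"
    using box_dim_eqI[OF H.has_box_dim_proj1] by auto
  have s1: "box_dim (slice1 (S i) F) = H.fibre_dim i" "box_dim_exists (slice1 (S i) F)" if "i \<in> I" for i
    using box_dim_eqI[OF H.has_box_dim_vslice[OF that]] H.slice1_eq_vslice[OF that]
        by (simp_all add: S aff_map_eq)
  have Vex: "\<exists>tier. column_system I tier d c b a (prod.swap ` F)" if "\<not> horizontal_type I c d"
  proof -
    have "\<not> extended_Lalley_Gatzouras I c d a b"
      using that unfolding extended_Lalley_Gatzouras_def horizontal_type_def by blast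
    then have "Baranski I c d a b" using cls by blast
    then show ?thesis using column_system_Baranski[OF Baranski_swap I attractor_swap[OF F]] by blast
  qed
  have dims2: "box_dim (proj2 ` F) = column_system.base_dim I tier d \<and> box_dim_exists (proj2 ` F) \<and>
      (\<forall>i\<in>I. box_dim (slice2 (S i) F) = column_system.fibre_dim I tier c i \<and> box_dim_exists (slice2 (S i) F))"
    if V: "column_system I tier d c b a (prod.swap ` F)" for tier
  proof -
    interpret V: column_system I tier d c b a "prod.swap ` F" by (rule V)
    have "has_box_dim (proj2 ` F) V.base_dim"
      unfolding proj2_eq_swap has_box_dim_swap by (rule V.has_box_dim_proj1)
    moreover have "has_box_dim (slice2 (S i) F) (V.fibre_dim i)" if "i \<in> I" for i
      unfolding S slice2_eq_swap[OF V H that] has_box_dim_swap by (rule V.has_box_dim_vslice[OF that])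
    ultimately show ?thesis using box_dim_eqI by blast
  qed
  have hor: "lower_dim F = box_dim (proj1 ` F) + (MIN i\<in>I. box_dim (slice1 (S i) F))"
      if hor: "horizontal_type I c d"
  proof -
    obtain j where "j \<in> I" "d j < c j" using nonsim hor unfolding horizontal_type_def by (metis order_le_less)
    then have "lower_dim F = H.base_dim + (MIN i\<in>I. H.fibre_dim i)"
      using hor by (intro H.lower_dim_horizontal) (auto simp: horizontal_type_def)
    also have "(MIN i\<in>I. H.fibre_dim i) = (MIN i\<in>I. box_dim (slice1 (S i) F))"
      using s1(1) by (intro arg_cong[where f = Min] image_cong) auto
    finally show ?thesis using p1 by simp
  qed
  have ver: "box_dim_exists (proj2 ` F) \<and> (\<forall>i\<in>I. box_dim_exists (slice2 (S i) F)) \<and>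
        lower_dim F = box_dim (proj2 ` F) + (MIN i\<in>I. box_dim (slice2 (S i) F))" if ver: "vertical_type I c d"
  proof -
    obtain j where j: "j \<in> I" "c j < d j" using nonsim ver unfolding vertical_type_def
        by (metis order_le_less)
    then have "\<not> horizontal_type I c d" unfolding horizontal_type_def by (meson not_le)
    then obtain tier where V: "column_system I tier d c b a (prod.swap ` F)" using Vex by blast
    interpret V: column_system I tier d c b a "prod.swap ` F" by (rule V)
    have "lower_dim F = lower_dim (prod.swap ` F)"
      using lower_exponents_swap[of F] unfolding lower_dim_def lower_exponents_def by simp
    also have "\<dots> = V.base_dim + (MIN i\<in>I. V.fibre_dim i)"
      using ver j by (intro V.lower_dim_horizontal) (auto simp: vertical_type_def)
    also have "(MIN i\<in>I. V.fibre_dim i) = (MIN i\<in>I. box_dim (slice2 (S i) F))"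
      using dims2[OF V] by (intro arg_cong[where f = Min] image_cong) auto
    finally show ?thesis using dims2[OF V] by simp
  qed
  have mix: "box_dim_exists (proj2 ` F) \<and> (\<forall>i\<in>I. box_dim_exists (slice2 (S i) F)) \<and>
        lower_dim F =
          (MIN i\<in>I. min (box_dim (proj1 ` F) + box_dim (slice1 (S i) F))
                         (box_dim (proj2 ` F) + box_dim (slice2 (S i) F)))" if mix: "mixed_type I c d"
  proof -
    obtain j k where jk: "j \<in> I" "d j < c j" "k \<in> I" "c k < d k"
      using mix by (auto simp: mixed_type_def horizontal_type_def vertical_type_def not_le)
    obtain tier where V: "column_system I tier d c b a (prod.swap ` F)"
      using Vex mix by (auto simp: mixed_type_def)
    have "lower_dim F = (MIN i\<in>I. min (H.base_dim + H.fibre_dim i)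
        (column_system.base_dim I tier d + column_system.fibre_dim I tier c i))"
      by (rule lower_dim_mixed[OF H V jk])
    also have "\<dots> = (MIN i\<in>I. min (box_dim (proj1 ` F) + box_dim (slice1 (S i) F))
                         (box_dim (proj2 ` F) + box_dim (slice2 (S i) F)))"
      using dims2[OF V] s1(1) p1(1) by (intro arg_cong[where f = Min] image_cong) auto
    finally show ?thesis using dims2[OF V] by blast
  qed
  show ?thesis using p1(2) s1(2) hor ver mix by blast
qed

end
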